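(* For every positive integer $d$, $$\mathrm{Ext}^{1}_{\mathcal{F}(\mathsf{gr};\mathbb{Z})}(\mathfrak{a}, S^{d}\circ\mathfrak{a}) \cong \begin{cases} \mathbb{Z}/p & \text{if } d=p^l \text{ for some prime } p \text{ and some integer } l\geq 1,\\ 0 & \text{otherwise.}\end{cases}$$
   Context: $\mathsf{gr}$ is the category of finitely generated free groups and group homomorphisms, and $\mathcal{F}(\mathsf{gr};\mathbb{Z})$ is the abelian category of functors from $\mathsf{gr}$ to the category $\mathsf{Ab}$ of abelian groups; Ext-groups are taken in this category. $\mathfrak{a}\in\mathcal{F}(\mathsf{gr};\mathbb{Z})$ is the abelianization functor $G\mapsto G/[G,G]$. $S^d$ is the $d$-th symmetric power functor on finitely generated free abelian groups, $S^d(A)=(A^{\otimes d})_{\mathfrak{S}_d}$ (coinvariants under the symmetric group $\mathfrak{S}_d$), and $S^d\circ\mathfrak{a}$ is its composite with abelianization. *)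

theory Defs
  imports
    "HOL-Algebra.Generated_Groups"
    "HOL-Algebra.Free_Abelian_Groups"
    "HOL-Computational_Algebra.Primes"
    "HOL-Combinatorics.Permutations"
begin

section \<open>Finitely generated free groups\<close>

text \<open>A letter \<open>(b, True)\<close> stands for \<open>b\<close>, and \<open>(b, False)\<close> for its inverse.\<close>

definition word_val :: "'x monoid \<Rightarrow> ('x \<times> bool) list \<Rightarrow> 'x" where
  "word_val G w =
     foldr (\<lambda>(b, s) y. (if s then b else inv\<^bsub>G\<^esub> b) \<otimes>\<^bsub>G\<^esub> y) w \<one>\<^bsub>G\<^esub>"

definition reduced_word :: "('x \<times> bool) list \<Rightarrow> bool" where
  "reduced_word w \<longleftrightarrow> successively (\<lambda>(a, s) (b, t). \<not> (a = b \<and> s \<noteq> t)) w"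

definition free_basis :: "'x monoid \<Rightarrow> 'x set \<Rightarrow> bool" where
  "free_basis G B \<longleftrightarrow>
     B \<subseteq> carrier G \<and> generate G B = carrier G \<and>
     (\<forall>w. w \<noteq> [] \<and> fst ` set w \<subseteq> B \<and> reduced_word w \<longrightarrow> word_val G w \<noteq> \<one>\<^bsub>G\<^esub>)"

text \<open>The objects of the category of finitely generated free groups: all such groups whose
  carrier is a subset of \<open>'x\<close>. If \<open>'x\<close> is infinite, every finitely generated free group is
  isomorphic to one of them.\<close>

definition gr :: "'x monoid set" where
  "gr = {G. group G \<and>
            (\<exists>S. finite S \<and> S \<subseteq> carrier G \<and> generate G S = carrier G) \<and>
            (\<exists>B. free_basis G B)}"


section \<open>Functors to abelian groups\<close>

text \<open>Morphisms are homomorphisms that are undefined off the carrier, so that equality of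
  morphisms is equality of functions. Composition is \<^term>\<open>compose\<close>.
  A set \<open>C\<close> of groups stands for the corresponding full subcategory of the category of groups.
  Abelian groups are written multiplicatively.\<close>

definition mor :: "'x monoid \<Rightarrow> 'y monoid \<Rightarrow> ('x \<Rightarrow> 'y) set" where
  "mor G H = hom G H \<inter> extensional (carrier G)"

record ('x, 'y) fctr =
  ob :: "'x monoid \<Rightarrow> 'y monoid"
  ar :: "'x monoid \<Rightarrow> 'x monoid \<Rightarrow> ('x \<Rightarrow> 'x) \<Rightarrow> 'y \<Rightarrow> 'y"

definition ab_functor :: "'x monoid set \<Rightarrow> ('x, 'y) fctr \<Rightarrow> bool" where
  "ab_functor C F \<longleftrightarrow>
     (\<forall>G\<in>C. comm_group (ob F G)) \<and>
     (\<forall>G\<in>C. \<forall>H\<in>C. \<forall>f\<in>mor G H. ar F G H f \<in> mor (ob F G) (ob F H)) \<and>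
     (\<forall>G\<in>C. ar F G G (\<lambda>x\<in>carrier G. x) = (\<lambda>x\<in>carrier (ob F G). x)) \<and>
     (\<forall>G\<in>C. \<forall>H\<in>C. \<forall>K\<in>C. \<forall>f\<in>mor G H. \<forall>g\<in>mor H K.
        ar F G K (compose (carrier G) g f) =
        compose (carrier (ob F G)) (ar F H K g) (ar F G H f))"

definition nat_trans ::
  "'x monoid set \<Rightarrow> ('x, 'a) fctr \<Rightarrow> ('x, 'b) fctr \<Rightarrow> ('x monoid \<Rightarrow> 'a \<Rightarrow> 'b) \<Rightarrow> bool" where
  "nat_trans C F F' \<eta> \<longleftrightarrow>
     (\<forall>G\<in>C. \<eta> G \<in> mor (ob F G) (ob F' G)) \<and>
     (\<forall>G\<in>C. \<forall>H\<in>C. \<forall>f\<in>mor G H.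
        compose (carrier (ob F G)) (\<eta> H) (ar F G H f) =
        compose (carrier (ob F G)) (ar F' G H f) (\<eta> G))"

definition fctr_comp :: "('y, 'z) fctr \<Rightarrow> ('x, 'y) fctr \<Rightarrow> ('x, 'z) fctr" where
  "fctr_comp F' F =
     \<lparr>ob = (\<lambda>G. ob F' (ob F G)),
      ar = (\<lambda>G H f. ar F' (ob F G) (ob F H) (ar F G H f))\<rparr>"


section \<open>Abelianization and symmetric powers\<close>

text \<open>The map \<open>A Mod N \<rightarrow> B Mod M\<close> induced by a homomorphism \<open>f\<close> from \<open>A\<close> to \<open>B\<close> with
  \<open>f ` N \<subseteq> M\<close>; the union is over equal cosets.\<close>

definition quot_map ::
  "'a monoid \<Rightarrow> 'a set \<Rightarrow> 'b monoid \<Rightarrow> 'b set \<Rightarrow> ('a \<Rightarrow> 'b) \<Rightarrow> 'a set \<Rightarrow> 'b set" where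
  "quot_map A N B M f = (\<lambda>X\<in>carrier (A Mod N). \<Union>x\<in>X. M #>\<^bsub>B\<^esub> f x)"

definition abelianization :: "('x, 'x set) fctr" where
  "abelianization =
     \<lparr>ob = (\<lambda>G. G Mod derived G (carrier G)),
      ar = (\<lambda>G H f. quot_map G (derived G (carrier G)) H (derived H (carrier H)) f)\<rparr>"

text \<open>The tensor power of \<open>A\<close> is the free abelian group on the \<open>d\<close>-tuples of elements of \<open>A\<close>
  modulo multilinearity in each entry.\<close>

definition tuples :: "nat \<Rightarrow> 'a monoid \<Rightarrow> 'a list set" where
  "tuples d A = {xs. length xs = d \<and> set xs \<subseteq> carrier A}"

definition multilin :: "nat \<Rightarrow> 'a monoid \<Rightarrow> ('a list \<Rightarrow>\<^sub>0 int) set" where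
  "multilin d A =
     generate (free_Abelian_group (tuples d A))
       {frag_of (xs[i := a \<otimes>\<^bsub>A\<^esub> b]) - frag_of (xs[i := a]) - frag_of (xs[i := b]) | xs i a b.
          xs \<in> tuples d A \<and> i < d \<and> a \<in> carrier A \<and> b \<in> carrier A}"

definition tensor_pow :: "nat \<Rightarrow> 'a monoid \<Rightarrow> ('a list \<Rightarrow>\<^sub>0 int) set monoid" where
  "tensor_pow d A = free_Abelian_group (tuples d A) Mod multilin d A"

definition tensor_map ::
  "nat \<Rightarrow> 'a monoid \<Rightarrow> 'b monoid \<Rightarrow> ('a list \<Rightarrow> 'b list) \<Rightarrow>
   ('a list \<Rightarrow>\<^sub>0 int) set \<Rightarrow> ('b list \<Rightarrow>\<^sub>0 int) set" where
  "tensor_map d A B h =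
     quot_map (free_Abelian_group (tuples d A)) (multilin d A)
       (free_Abelian_group (tuples d B)) (multilin d B)
       (frag_extend (\<lambda>xs. frag_of (h xs)))"

text \<open>\<^term>\<open>permute_list\<close> gives a right action of the symmetric group; the coinvariants do not
  depend on this choice, since \<open>\<sigma>\<close> ranges over the whole group.\<close>

definition coinv_rel :: "nat \<Rightarrow> 'a monoid \<Rightarrow> ('a list \<Rightarrow>\<^sub>0 int) set set" where
  "coinv_rel d A =
     generate (tensor_pow d A)
       {tensor_map d A A (permute_list \<sigma>) t \<otimes>\<^bsub>tensor_pow d A\<^esub> inv\<^bsub>tensor_pow d A\<^esub> t | \<sigma> t.
          \<sigma> permutes {..<d} \<and> t \<in> carrier (tensor_pow d A)}"

definition sym_pow :: "nat \<Rightarrow> ('a, ('a list \<Rightarrow>\<^sub>0 int) set set) fctr" where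
  "sym_pow d =
     \<lparr>ob = (\<lambda>A. tensor_pow d A Mod coinv_rel d A),
      ar = (\<lambda>A B f. quot_map (tensor_pow d A) (coinv_rel d A) (tensor_pow d B) (coinv_rel d B)
                      (tensor_map d A B (map f)))\<rparr>"


section \<open>The first Ext-group in the functor category\<close>

text \<open>Extensions \<open>0 \<rightarrow> F \<rightarrow> E \<rightarrow> Q \<rightarrow> 0\<close> in the category of functors from \<open>C\<close> to abelian groups,
  up to equivalence, with the Baer sum. Exactness in this category is objectwise.\<close>

record ('x, 'f, 'e, 'q) extn =
  mid :: "('x, 'e) fctr"
  incl :: "'x monoid \<Rightarrow> 'f \<Rightarrow> 'e"
  proj :: "'x monoid \<Rightarrow> 'e \<Rightarrow> 'q"

definition is_extn ::
  "'x monoid set \<Rightarrow> ('x, 'q) fctr \<Rightarrow> ('x, 'f) fctr \<Rightarrow> ('x, 'f, 'e, 'q) extn \<Rightarrow> bool" where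
  "is_extn C Q F X \<longleftrightarrow>
     ab_functor C (mid X) \<and>
     nat_trans C F (mid X) (incl X) \<and>
     nat_trans C (mid X) Q (proj X) \<and>
     (\<forall>G\<in>C. incl X G \<in> mon (ob F G) (ob (mid X) G) \<and>
             incl X G ` carrier (ob F G) = kernel (ob (mid X) G) (ob Q G) (proj X G) \<and>
             proj X G \<in> epi (ob (mid X) G) (ob Q G))"

text \<open>The two middle functors may take values in different types.\<close>

definition extn_equiv ::
  "'x monoid set \<Rightarrow> ('x, 'q) fctr \<Rightarrow> ('x, 'f) fctr \<Rightarrow>
   ('x, 'f, 'e, 'q) extn \<Rightarrow> ('x, 'f, 'e2, 'q) extn \<Rightarrow> bool" where
  "extn_equiv C Q F X Y \<longleftrightarrow>
     (\<exists>\<eta>. nat_trans C (mid X) (mid Y) \<eta> \<and>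
          (\<forall>G\<in>C. \<eta> G \<in> iso (ob (mid X) G) (ob (mid Y) G) \<and>
                  (\<forall>a\<in>carrier (ob F G). \<eta> G (incl X G a) = incl Y G a) \<and>
                  (\<forall>x\<in>carrier (ob (mid X) G). proj Y G (\<eta> G x) = proj X G x)))"

definition split_extn ::
  "('x, 'q) fctr \<Rightarrow> ('x, 'f) fctr \<Rightarrow> ('x, 'f, 'f \<times> 'q, 'q) extn" where
  "split_extn Q F =
     \<lparr>mid = \<lparr>ob = (\<lambda>G. ob F G \<times>\<times> ob Q G),
             ar = (\<lambda>G H f. \<lambda>(a, q)\<in>carrier (ob F G \<times>\<times> ob Q G). (ar F G H f a, ar Q G H f q))\<rparr>,
      incl = (\<lambda>G. \<lambda>a\<in>carrier (ob F G). (a, \<one>\<^bsub>ob Q G\<^esub>)),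
      proj = (\<lambda>G. \<lambda>(a, q)\<in>carrier (ob F G \<times>\<times> ob Q G). q)\<rparr>"

text \<open>The Baer sum of \<open>X\<close> and \<open>Y\<close>: the pullback of the middle terms over \<open>Q\<close>, modulo the
  antidiagonal copy of \<open>F\<close>.\<close>

definition baer_pb ::
  "('x, 'f, 'e, 'q) extn \<Rightarrow> ('x, 'f, 'e, 'q) extn \<Rightarrow> 'x monoid \<Rightarrow> ('e \<times> 'e) monoid" where
  "baer_pb X Y G =
     (ob (mid X) G \<times>\<times> ob (mid Y) G)
       \<lparr>carrier := {(x, y). x \<in> carrier (ob (mid X) G) \<and> y \<in> carrier (ob (mid Y) G) \<and>
                            proj X G x = proj Y G y}\<rparr>"

definition baer_antidiag ::
  "('x, 'f) fctr \<Rightarrow> ('x, 'f, 'e, 'q) extn \<Rightarrow> ('x, 'f, 'e, 'q) extn \<Rightarrow>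
   'x monoid \<Rightarrow> ('e \<times> 'e) set" where
  "baer_antidiag F X Y G =
     {(incl X G a, incl Y G (inv\<^bsub>ob F G\<^esub> a)) | a. a \<in> carrier (ob F G)}"

definition baer_sum ::
  "('x, 'f) fctr \<Rightarrow> ('x, 'f, 'e, 'q) extn \<Rightarrow> ('x, 'f, 'e, 'q) extn \<Rightarrow>
   ('x, 'f, ('e \<times> 'e) set, 'q) extn" where
  "baer_sum F X Y =
     \<lparr>mid = \<lparr>ob = (\<lambda>G. baer_pb X Y G Mod baer_antidiag F X Y G),
             ar = (\<lambda>G H f. quot_map (baer_pb X Y G) (baer_antidiag F X Y G)
                             (baer_pb X Y H) (baer_antidiag F X Y H)
                             (\<lambda>(x, y). (ar (mid X) G H f x, ar (mid Y) G H f y)))\<rparr>,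
      incl = (\<lambda>G. \<lambda>a\<in>carrier (ob F G).
                baer_antidiag F X Y G #>\<^bsub>baer_pb X Y G\<^esub> (incl X G a, \<one>\<^bsub>ob (mid Y) G\<^esub>)),
      proj = (\<lambda>G. \<lambda>c\<in>carrier (baer_pb X Y G Mod baer_antidiag F X Y G).
                the_elem ((\<lambda>(x, y). proj X G x) ` c))\<rparr>"

text \<open>\<open>'e\<close> is the type in which the middle terms of the extensions take their values. It has to be
  large enough to contain an isomorphic copy of every extension of \<open>Q\<close> by \<open>F\<close>; if \<open>F\<close> and \<open>Q\<close>
  have countable values, every infinite type will do. Since the Baer sum has values in another
  type, it is transported back along equivalences of extensions, and likewise for the
  split extension.\<close>

definition extn_rel ::
  "'x monoid set \<Rightarrow> ('x, 'q) fctr \<Rightarrow> ('x, 'f) fctr \<Rightarrow>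
   (('x, 'f, 'e, 'q) extn \<times> ('x, 'f, 'e, 'q) extn) set" where
  "extn_rel C Q F =
     {(X, Y). is_extn C Q F X \<and> is_extn C Q F Y \<and> extn_equiv C Q F X Y}"

definition Ext1 ::
  "'e itself \<Rightarrow> 'x monoid set \<Rightarrow> ('x, 'q) fctr \<Rightarrow> ('x, 'f) fctr \<Rightarrow>
   ('x, 'f, 'e, 'q) extn set monoid" where
  "Ext1 _ C Q F =
     \<lparr>carrier = {X. is_extn C Q F X} // extn_rel C Q F,
      monoid.mult = (\<lambda>c c'. {Z. is_extn C Q F Z \<and>
                            (\<exists>X\<in>c. \<exists>Y\<in>c'. extn_equiv C Q F Z (baer_sum F X Y))}),
      one = {Z. is_extn C Q F Z \<and> extn_equiv C Q F Z (split_extn Q F)}\<rparr>"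

end

(* For free groups the bar construction resolves the abelianization, so an extension of it by a functor F
   is determined by a 2-cocycle with values in F of the free group on two generators. For F = S^d of the
   abelianization such a cocycle is a homogeneous polynomial f(x, y) of degree d with integer coefficients
   and f(x, y) + f(x + y, z) = f(y, z) + f(x, y + z); comparing the coefficients of x^i y^j z shows that f is
   a rational multiple of (x + y)^d - x^d - y^d, and the coboundaries are the integer multiples of this
   polynomial. Hence Ext^1 is cyclic of order g, where g is the greatest common divisor of the binomial
   coefficients d choose i with 0 < i < d (and g = 1 if d = 1). Concretely, an extension is split
   set-theoretically: a lift e of the generator of the infinite cyclic group over the middle term gives the
   section that sends h to the image of e under the homomorphism generator -> h. This section turns out to
   be a function of the class of h in the abelianization. Conversely each multiple of
   ((x + y)^d - x^d - y^d) / g twists the addition of the direct sum. *)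
theory Submission
  imports
    Defs
    "HOL-Algebra.Bij"
    "HOL-Library.Multiset"
    "HOL-Computational_Algebra.Polynomial"
begin

text \<open>S^d(A) is handled as a bare quotient for every abelian group A, with no basis and
  possibly with torsion, so one cannot divide by g inside it. Identities needed in S^d(A) are
  therefore proved in a polynomial ring with one variable for each element, where nonzero integers
  cancel, and then pushed down. Conversely, elements of S^d of an abelianized free group are told
  apart by evaluating the free generators at integer polynomials. Freeness is used in three ranks:
  rank one gives the section and its naturality, rank two makes its defect of additivity universal,
  hence a single binary form, and rank three turns associativity into the polynomial cocycle
  identity. The modulus is g because a natural section is determined by one lift e; two lifts differ
  by c x^d, and this changes the multiple of the cocycle polynomial by c g. The section depends only
  on classes in the abelianization because the cocycle is symmetric and normalised: commutativity of
  the middle term then makes the section trivial on commutators.\<close>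

section \<open>Quotients and symmetric powers\<close>

lemma morD: "f \<in> mor G H \<Longrightarrow> f \<in> hom G H"
  by (simp add: mor_def)

lemma mor_closed: "f \<in> mor G H \<Longrightarrow> x \<in> carrier G \<Longrightarrow> f x \<in> carrier H"
  by (auto simp: mor_def hom_def)

lemma mor_mult:
  "f \<in> mor G H \<Longrightarrow> x \<in> carrier G \<Longrightarrow> y \<in> carrier G \<Longrightarrow> f (x \<otimes>\<^bsub>G\<^esub> y) = f x \<otimes>\<^bsub>H\<^esub> f y"
  by (auto simp: mor_def hom_def)

lemma mor_one: "f \<in> mor G H \<Longrightarrow> group G \<Longrightarrow> group H \<Longrightarrow> f \<one>\<^bsub>G\<^esub> = \<one>\<^bsub>H\<^esub>"
  by (simp add: hom_one morD)

lemma mor_inv: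
  "f \<in> mor G H \<Longrightarrow> group G \<Longrightarrow> group H \<Longrightarrow> x \<in> carrier G \<Longrightarrow> f (inv\<^bsub>G\<^esub> x) = inv\<^bsub>H\<^esub> f x"
  by (meson group_hom.hom_inv group_hom.intro group_hom_axioms.intro morD)

lemma mor_ext:
  "f \<in> mor G H \<Longrightarrow> g \<in> mor G H' \<Longrightarrow> (\<And>x. x \<in> carrier G \<Longrightarrow> f x = g x) \<Longrightarrow> f = g"
  by (auto simp: mor_def intro: extensionalityI)

lemma comm_group_group: "comm_group G \<Longrightarrow> group G"
  by (simp add: comm_group_def)

lemma group_homI: "group G \<Longrightarrow> group H \<Longrightarrow> h \<in> hom G H \<Longrightarrow> group_hom G H h"
  by (simp add: group_hom.intro group_hom_axioms.intro)

text \<open>Two representatives of a coset of N differ by an element of N, which f sends into M, so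
  the union in \<open>quot_map\<close> collapses to a single coset.\<close>

lemma quot_map_coset:
  assumes "N \<lhd> A" "M \<lhd> B" "f \<in> hom A B" "f ` N \<subseteq> M" "x \<in> carrier A"
  shows "quot_map A N B M f (N #>\<^bsub>A\<^esub> x) = M #>\<^bsub>B\<^esub> f x"
proof -
  interpret N: normal N A by fact
  interpret M: normal M B by fact
  have "M #>\<^bsub>B\<^esub> f y = M #>\<^bsub>B\<^esub> f x" if "y \<in> N #>\<^bsub>A\<^esub> x" for y
  proof -
    obtain n where n: "n \<in> N" "y = n \<otimes>\<^bsub>A\<^esub> x"
      using \<open>y \<in> _\<close> by (auto simp: r_coset_def)
    have fx: "f x \<in> carrier B" and fn: "f n \<in> M"
      using assms n by (auto simp: hom_def)
    have "f y = f n \<otimes>\<^bsub>B\<^esub> f x"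
      using assms n N.subset by (auto simp: hom_def)
    then show ?thesis
      using fx fn M.subset
      by (metis M.coset_join2 M.coset_mult_assoc M.subgroup_axioms subsetD)
  qed
  moreover have "x \<in> N #>\<^bsub>A\<^esub> x"
    using assms N.rcos_self N.subgroup_axioms by blast
  moreover have "N #>\<^bsub>A\<^esub> x \<in> carrier (A Mod N)"
    using assms by (auto simp: carrier_FactGroup)
  ultimately have "(\<Union>y\<in>N #>\<^bsub>A\<^esub> x. M #>\<^bsub>B\<^esub> f y) = M #>\<^bsub>B\<^esub> f x"
    by blast
  then show ?thesis
    using \<open>N #>\<^bsub>A\<^esub> x \<in> carrier (A Mod N)\<close> by (simp add: quot_map_def)
qed

lemma quot_map_mor:
  assumes "N \<lhd> A" "M \<lhd> B" "f \<in> hom A B" "f ` N \<subseteq> M"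
  shows "quot_map A N B M f \<in> mor (A Mod N) (B Mod M)"
proof -
  interpret N: normal N A by fact
  interpret M: normal M B by fact
  have "quot_map A N B M f \<in> hom (A Mod N) (B Mod M)"
  proof (rule homI)
    fix X assume "X \<in> carrier (A Mod N)"
    then obtain x where "x \<in> carrier A" "X = N #>\<^bsub>A\<^esub> x"
      by (auto simp: carrier_FactGroup)
    then show "quot_map A N B M f X \<in> carrier (B Mod M)"
      using quot_map_coset[OF assms] assms(3) by (auto simp: carrier_FactGroup hom_def)
  next
    fix X Y assume "X \<in> carrier (A Mod N)" "Y \<in> carrier (A Mod N)"
    then obtain x y where xy: "x \<in> carrier A" "X = N #>\<^bsub>A\<^esub> x" "y \<in> carrier A" "Y = N #>\<^bsub>A\<^esub> y"
      by (auto simp: carrier_FactGroup)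
    then have f: "f x \<in> carrier B" "f y \<in> carrier B" "f (x \<otimes>\<^bsub>A\<^esub> y) = f x \<otimes>\<^bsub>B\<^esub> f y"
      using assms(3) by (auto simp: hom_def)
    show "quot_map A N B M f (X \<otimes>\<^bsub>A Mod N\<^esub> Y)
        = quot_map A N B M f X \<otimes>\<^bsub>B Mod M\<^esub> quot_map A N B M f Y"
      using xy f by (simp add: N.rcos_sum M.rcos_sum quot_map_coset[OF assms])
  qed
  then show ?thesis
    by (simp add: mor_def quot_map_def)
qed

lemma generate_hom_image:
  assumes "group A" "subgroup M B" "group B" "f \<in> hom A B" "K \<subseteq> carrier A" "f ` K \<subseteq> M"
  shows "f ` generate A K \<subseteq> M"
proof -
  interpret f: group_hom A B f by (intro group_homI assms)
  have "generate B (f ` K) \<subseteq> M"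
    using assms by (meson group.generate_subgroup_incl)
  then show ?thesis
    using f.generate_img[OF assms(5)] by simp
qed

text \<open>The generated set is exhausted by countable stages: F 0 holds the unit, K and the
  inverses, and each later stage adds all products of two elements of the previous one. Countability
  is what later permits copying groups into a prescribed infinite type.\<close>

lemma countable_generate:
  assumes "countable K"
  shows "countable (generate G K)"
proof -
  have "\<exists>T. generate G K \<subseteq> T \<and> countable T"
  proof -
    define F where "F = rec_nat ({\<one>\<^bsub>G\<^esub>} \<union> K \<union> m_inv G ` K) (\<lambda>_ T. T \<union> (\<lambda>(x, y). x \<otimes>\<^bsub>G\<^esub> y) ` (T \<times> T))"
    have F0: "F 0 = {\<one>\<^bsub>G\<^esub>} \<union> K \<union> m_inv G ` K"
      and FS: "F (Suc n) = F n \<union> (\<lambda>(x, y). x \<otimes>\<^bsub>G\<^esub> y) ` (F n \<times> F n)" for n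
      by (simp_all add: F_def)
    have "countable (F n)" for n
      by (induction n) (simp_all add: F0 FS assms)
    then have c: "countable (\<Union>n. F n)" by simp
    have mono: "F m \<subseteq> F (m + n)" for m n
      by (induction n) (auto simp: FS)
    have "x \<in> (\<Union>n. F n)" if "x \<in> generate G K" for x
      using that
    proof induction
      case (eng x y)
      then obtain m n where "x \<in> F m" "y \<in> F n" by auto
      then have "x \<in> F (m + n)" "y \<in> F (m + n)"
        using mono[of m n] mono[of n m] by (auto simp: add.commute)
      then have "x \<otimes>\<^bsub>G\<^esub> y \<in> F (Suc (m + n))"
        by (force simp: FS)
      then show ?case by blast
    qed (rule UN_I[of 0]; simp add: F0)+
    with c show ?thesis by blast
  qed
  then show ?thesis
    using countable_subset by blast
qed

section \<open>Tensor and symmetric powers by generators and relations\<close>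

definition tens :: "nat \<Rightarrow> 'a monoid \<Rightarrow> 'a list \<Rightarrow> ('a list \<Rightarrow>\<^sub>0 int) set" where
  "tens d A xs = multilin d A #>\<^bsub>free_Abelian_group (tuples d A)\<^esub> frag_of xs"

text \<open>The monomial x_1 ... x_d in the symmetric power; \<open>tens\<close> is the pure tensor
  above it.\<close>

definition symt :: "nat \<Rightarrow> 'a monoid \<Rightarrow> 'a list \<Rightarrow> ('a list \<Rightarrow>\<^sub>0 int) set set" where
  "symt d A xs = coinv_rel d A #>\<^bsub>tensor_pow d A\<^esub> tens d A xs"

abbreviation Sym :: "nat \<Rightarrow> 'a monoid \<Rightarrow> ('a list \<Rightarrow>\<^sub>0 int) set set monoid" where
  "Sym d A \<equiv> ob (sym_pow d) A"

lemma ob_sym_pow: "Sym d A = tensor_pow d A Mod coinv_rel d A"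
  by (simp add: sym_pow_def)

lemma tuples_update: "xs \<in> tuples d A \<Longrightarrow> a \<in> carrier A \<Longrightarrow> xs[i := a] \<in> tuples d A"
  unfolding tuples_def using set_update_subset_insert[of xs i a] by auto

lemma free_hom_ext:
  assumes "group B" "h \<in> hom (free_Abelian_group S) B" "h' \<in> hom (free_Abelian_group S) B"
    "\<And>x. x \<in> S \<Longrightarrow> h (frag_of x) = h' (frag_of x)" "Poly_Mapping.keys u \<subseteq> S"
  shows "h u = h' u"
proof -
  let ?F = "free_Abelian_group S"
  interpret h: group_hom ?F B h
    by (intro group_homI assms) auto
  interpret h': group_hom ?F B h'
    by (intro group_homI assms) auto
  show ?thesis
    using assms(5)
  proof (induction rule: free_Abelian_group_induct[consumes 1])
    case 1
    show ?case using h.hom_one h'.hom_one by simp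
  next
    case (2 x y)
    have "x - y = x \<otimes>\<^bsub>?F\<^esub> inv\<^bsub>?F\<^esub> y" "x \<in> carrier ?F" "y \<in> carrier ?F"
      using 2 by simp_all
    then show ?case
      using 2 by (metis h.hom_inv h.hom_mult h'.hom_inv h'.hom_mult h.G.inv_closed)
  next
    case (3 a)
    then show ?case using assms by simp
  qed
qed

definition multilin_gens :: "nat \<Rightarrow> 'a monoid \<Rightarrow> ('a list \<Rightarrow>\<^sub>0 int) set" where
  "multilin_gens d A =
     {frag_of (xs[i := a \<otimes>\<^bsub>A\<^esub> b]) - frag_of (xs[i := a]) - frag_of (xs[i := b]) | xs i a b.
        xs \<in> tuples d A \<and> i < d \<and> a \<in> carrier A \<and> b \<in> carrier A}"

context
  fixes d :: nat and A :: "'a monoid"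
  assumes A: "comm_group A"
begin

interpretation A: comm_group A by (fact A)

lemma multilin_gens_closed: "multilin_gens d A \<subseteq> carrier (free_Abelian_group (tuples d A))"
proof -
  have "Poly_Mapping.keys (frag_of x - frag_of y - frag_of z) \<subseteq> {x, y, z}" for x y z :: "'a list"
    using keys_diff[of "frag_of x - frag_of y" "frag_of z"] keys_diff[of "frag_of x" "frag_of y"]
    by auto
  then show ?thesis
    unfolding multilin_gens_def
    by (auto simp: subset_iff intro!: tuples_update dest!: spec)
qed

lemma multilin_normal: "multilin d A \<lhd> free_Abelian_group (tuples d A)"
proof -
  interpret F: comm_group "free_Abelian_group (tuples d A)" by (rule abelian_free_Abelian_group)
  show ?thesis
    unfolding multilin_def
    using F.generate_is_subgroup[OF multilin_gens_closed] F.subgroup_imp_normal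
    by (simp add: multilin_gens_def)
qed

lemma comm_group_tensor_pow: "comm_group (tensor_pow d A)"
  unfolding tensor_pow_def
  using abelian_free_Abelian_group comm_group.abelian_FactGroup multilin_normal normal_imp_subgroup
  by blast

lemma tens_closed: "xs \<in> tuples d A \<Longrightarrow> tens d A xs \<in> carrier (tensor_pow d A)"
  by (auto simp: tens_def tensor_pow_def carrier_FactGroup)


lemma multilin_gen_mem:
  assumes "xs \<in> tuples d A" "i < d" "a \<in> carrier A" "b \<in> carrier A"
  shows "frag_of (xs[i := a \<otimes>\<^bsub>A\<^esub> b]) - frag_of (xs[i := a]) - frag_of (xs[i := b]) \<in> multilin d A"
  unfolding multilin_def using assms by (blast intro: generate.incl)

lemma tens_update_mult:
  assumes "xs \<in> tuples d A" "i < d" "a \<in> carrier A" "b \<in> carrier A"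
  shows "tens d A (xs[i := a \<otimes>\<^bsub>A\<^esub> b]) = tens d A (xs[i := a]) \<otimes>\<^bsub>tensor_pow d A\<^esub> tens d A (xs[i := b])"
proof -
  let ?F = "free_Abelian_group (tuples d A)"
  interpret N: normal "multilin d A" ?F by (rule multilin_normal)
  let ?u = "frag_of (xs[i := a \<otimes>\<^bsub>A\<^esub> b])" and ?v = "frag_of (xs[i := a])" and ?w = "frag_of (xs[i := b])"
  have c: "?u \<in> carrier ?F" "?v \<in> carrier ?F" "?w \<in> carrier ?F"
    using assms by (auto intro!: tuples_update)
  then have vw: "?v + ?w \<in> carrier ?F"
    using N.m_closed[OF c(2,3)] by simp
  have "?u = (?u - ?v - ?w) \<otimes>\<^bsub>?F\<^esub> (?v + ?w)"
    by simp
  then have "?u \<in> multilin d A #>\<^bsub>?F\<^esub> (?v + ?w)"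
    using multilin_gen_mem[OF assms] unfolding r_coset_def by blast
  then have "multilin d A #>\<^bsub>?F\<^esub> ?u = multilin d A #>\<^bsub>?F\<^esub> (?v + ?w)"
    using N.repr_independence N.subgroup_axioms vw by metis
  then show ?thesis
    using c by (simp add: tens_def tensor_pow_def N.rcos_sum del: carrier_free_Abelian_group_iff)
qed

lemma tensor_pow_hom_ext:
  assumes "group B" "h \<in> hom (tensor_pow d A) B" "h' \<in> hom (tensor_pow d A) B"
    "\<And>xs. xs \<in> tuples d A \<Longrightarrow> h (tens d A xs) = h' (tens d A xs)" "t \<in> carrier (tensor_pow d A)"
  shows "h t = h' t"
proof -
  let ?F = "free_Abelian_group (tuples d A)"
  interpret N: normal "multilin d A" ?F by (rule multilin_normal)
  obtain u where u: "u \<in> carrier ?F" "t = multilin d A #>\<^bsub>?F\<^esub> u"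
    using assms(5) by (auto simp: tensor_pow_def carrier_FactGroup)
  have "(h \<circ> (\<lambda>a. multilin d A #>\<^bsub>?F\<^esub> a)) u = (h' \<circ> (\<lambda>a. multilin d A #>\<^bsub>?F\<^esub> a)) u"
  proof (rule free_hom_ext)
    show "h \<circ> (\<lambda>a. multilin d A #>\<^bsub>?F\<^esub> a) \<in> hom ?F B"
      using assms N.r_coset_hom_Mod hom_compose by (metis tensor_pow_def)
    show "h' \<circ> (\<lambda>a. multilin d A #>\<^bsub>?F\<^esub> a) \<in> hom ?F B"
      using assms N.r_coset_hom_Mod hom_compose by (metis tensor_pow_def)
  qed (use assms u in \<open>auto simp: tens_def\<close>)
  then show ?thesis using u by simp
qed

lemma tensor_pow_universal:
  assumes "comm_group B" "\<And>xs. xs \<in> tuples d A \<Longrightarrow> u xs \<in> carrier B"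
    "\<And>xs i a b. \<lbrakk>xs \<in> tuples d A; i < d; a \<in> carrier A; b \<in> carrier A\<rbrakk>
      \<Longrightarrow> u (xs[i := a \<otimes>\<^bsub>A\<^esub> b]) = u (xs[i := a]) \<otimes>\<^bsub>B\<^esub> u (xs[i := b])"
  obtains h where "h \<in> hom (tensor_pow d A) B" "\<And>xs. xs \<in> tuples d A \<Longrightarrow> h (tens d A xs) = u xs"
proof -
  let ?F = "free_Abelian_group (tuples d A)"
  interpret N: normal "multilin d A" ?F by (rule multilin_normal)
  interpret B: comm_group B by fact
  obtain k where k: "k \<in> hom ?F B" "\<And>x. x \<in> tuples d A \<Longrightarrow> k (frag_of x) = u x"
    using B.free_Abelian_group_universal[of u "tuples d A"] assms by blast
  interpret k: group_hom ?F B k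
    by (intro group_homI k) auto
  have "k ` multilin d A \<subseteq> {\<one>\<^bsub>B\<^esub>}"
    unfolding multilin_def
  proof (rule generate_hom_image[OF _ _ _ k(1)], goal_cases)
    case 4
    show ?case using multilin_gens_closed by (simp add: multilin_gens_def)
  next
    case 5
    have "k (frag_of (xs[i := a \<otimes>\<^bsub>A\<^esub> b]) - frag_of (xs[i := a]) - frag_of (xs[i := b])) = \<one>\<^bsub>B\<^esub>"
      if h: "xs \<in> tuples d A" "i < d" "a \<in> carrier A" "b \<in> carrier A" for xs i a b
    proof -
      let ?u = "frag_of (xs[i := a \<otimes>\<^bsub>A\<^esub> b])" and ?v = "frag_of (xs[i := a])" and ?w = "frag_of (xs[i := b])"
      have m: "xs[i := a \<otimes>\<^bsub>A\<^esub> b] \<in> tuples d A" "xs[i := a] \<in> tuples d A" "xs[i := b] \<in> tuples d A"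
        using h by (auto intro!: tuples_update)
      then have c: "?u \<in> carrier ?F" "?v \<in> carrier ?F" "?w \<in> carrier ?F"
        by simp_all
      have g: "?u - ?v - ?w \<in> carrier ?F"
        using multilin_gen_mem[OF h] N.subset by blast
      \<comment> \<open>The relation is added back to v + w, so that additivity of k applies;
        cancelling in B then shows that k kills the relation.\<close>
      have "k ?u = k ((?u - ?v - ?w) \<otimes>\<^bsub>?F\<^esub> (?v \<otimes>\<^bsub>?F\<^esub> ?w))"
        by simp
      also have "\<dots> = k (?u - ?v - ?w) \<otimes>\<^bsub>B\<^esub> (k ?v \<otimes>\<^bsub>B\<^esub> k ?w)"
        using g c k.hom_mult N.m_closed by metis
      finally have "k (?u - ?v - ?w) \<otimes>\<^bsub>B\<^esub> (u (xs[i := a]) \<otimes>\<^bsub>B\<^esub> u (xs[i := b]))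
          = u (xs[i := a]) \<otimes>\<^bsub>B\<^esub> u (xs[i := b])"
        using k(2) m assms(3)[OF h] by simp
      then show ?thesis
        using assms(2) m g k.hom_closed by simp
    qed
    then show ?case by blast
  qed (auto simp: B.triv_subgroup)
  then have "multilin d A \<subseteq> kernel ?F B k"
    using N.subset by (auto simp: kernel_def simp del: carrier_free_Abelian_group_iff)
  from k.FactGroup_universal_kernel[OF multilin_normal this]
  obtain h where "h \<in> hom (?F Mod multilin d A) B"
    "\<And>x. x \<in> carrier ?F \<Longrightarrow> h (multilin d A #>\<^bsub>?F\<^esub> x) = k x"
    by blast
  then show ?thesis
    using that[of h] k by (simp add: tensor_pow_def tens_def)
qed

end

text \<open>The hypothesis on h allows the changed entry to move to another position j and to take
  other values. This covers both \<open>map f\<close>, where the position stays, and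
  \<open>permute_list\<close>, where it moves.\<close>

lemma tensor_map_tens:
  assumes A: "comm_group A" and B: "comm_group B"
    and h: "\<And>xs. xs \<in> tuples d A \<Longrightarrow> h xs \<in> tuples d B"
    and hM: "\<And>xs i a b. \<lbrakk>xs \<in> tuples d A; i < d; a \<in> carrier A; b \<in> carrier A\<rbrakk>
      \<Longrightarrow> \<exists>ys\<in>tuples d B. \<exists>j<d. \<exists>a'\<in>carrier B. \<exists>b'\<in>carrier B. h (xs[i := a]) = ys[j := a']
         \<and> h (xs[i := b]) = ys[j := b'] \<and> h (xs[i := a \<otimes>\<^bsub>A\<^esub> b]) = ys[j := a' \<otimes>\<^bsub>B\<^esub> b']"
  shows "tensor_map d A B h \<in> mor (tensor_pow d A) (tensor_pow d B)" (is ?mor)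
    and "xs \<in> tuples d A \<Longrightarrow> tensor_map d A B h (tens d A xs) = tens d B (h xs)"
proof -
  let ?f = "frag_extend (\<lambda>xs. frag_of (h xs))"
  let ?F = "free_Abelian_group (tuples d A)" and ?G = "free_Abelian_group (tuples d B)"
  have cl: "?f u \<in> carrier ?G" if "Poly_Mapping.keys u \<subseteq> tuples d A" for u
    using that
  proof (induction rule: free_Abelian_group_induct[consumes 1])
    case (2 x y)
    then show ?case
      using keys_diff[of "?f x" "?f y"] by (auto simp: frag_extend_diff)
  qed (auto simp: h)
  have f: "?f \<in> hom ?F ?G"
    by (rule homI) (use cl in \<open>auto simp: frag_extend_add\<close>)
  interpret N: normal "multilin d B" ?G by (rule multilin_normal[OF B])
  have "?f ` multilin d A \<subseteq> multilin d B"
    unfolding multilin_def[of d A]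
  proof (rule generate_hom_image[OF _ _ _ f], goal_cases)
    case 4
    show ?case using multilin_gens_closed[OF A] by (simp add: multilin_gens_def)
  next
    case 5
    have "?f (frag_of (xs[i := a \<otimes>\<^bsub>A\<^esub> b]) - frag_of (xs[i := a]) - frag_of (xs[i := b])) \<in> multilin d B"
      if hyp: "xs \<in> tuples d A" "i < d" "a \<in> carrier A" "b \<in> carrier A" for xs i a b
      using hM[OF hyp] multilin_gen_mem[OF B] by (force simp: frag_extend_diff)
    then show ?case by blast
  qed (auto simp: N.subgroup_axioms)
  note * = multilin_normal[OF A] multilin_normal[OF B] f this
  show ?mor
    unfolding tensor_map_def tensor_pow_def by (rule quot_map_mor[OF *])
  show "tensor_map d A B h (tens d A xs) = tens d B (h xs)" if "xs \<in> tuples d A"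
    unfolding tensor_map_def tens_def using that by (subst quot_map_coset[OF *]) auto
qed

lemma tensor_map_map:
  assumes A: "comm_group A" and B: "comm_group B" and f: "f \<in> hom A B"
  shows "tensor_map d A B (map f) \<in> mor (tensor_pow d A) (tensor_pow d B)"
    and "xs \<in> tuples d A \<Longrightarrow> tensor_map d A B (map f) (tens d A xs) = tens d B (map f xs)"
proof -
  have t: "map f xs \<in> tuples d B" if "xs \<in> tuples d A" for xs
    using that f by (auto simp: tuples_def hom_def)
  have m: "\<exists>ys\<in>tuples d B. \<exists>j<d. \<exists>a'\<in>carrier B. \<exists>b'\<in>carrier B. map f (xs[i := a]) = ys[j := a']
         \<and> map f (xs[i := b]) = ys[j := b'] \<and> map f (xs[i := a \<otimes>\<^bsub>A\<^esub> b]) = ys[j := a' \<otimes>\<^bsub>B\<^esub> b']"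
    if "xs \<in> tuples d A" "i < d" "a \<in> carrier A" "b \<in> carrier A" for xs i a b
    using that f t
    by (intro bexI[of _ "map f xs"] exI[of _ i] bexI[of _ "f a"] bexI[of _ "f b"] conjI)
       (auto simp: map_update hom_def)
  show "tensor_map d A B (map f) \<in> mor (tensor_pow d A) (tensor_pow d B)"
    by (rule tensor_map_tens(1)[OF A B t m])
  show "xs \<in> tuples d A \<Longrightarrow> tensor_map d A B (map f) (tens d A xs) = tens d B (map f xs)"
    by (rule tensor_map_tens(2)[OF A B t m])
qed

text \<open>Entry j of the permuted list is entry \<sigma> j of xs, so what stood at i ends up at
  the preimage of i.\<close>

lemma permute_list_update:
  assumes "\<sigma> permutes {..<length xs}" "i < length xs"
  shows "permute_list \<sigma> (xs[i := a]) = (permute_list \<sigma> xs)[inv_into UNIV \<sigma> i := a]"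
proof (rule nth_equalityI)
  fix j assume "j < length (permute_list \<sigma> (xs[i := a]))"
  then have j: "j < length xs" by simp
  have "\<sigma> j < length xs"
    using assms(1) j permutes_in_image by fastforce
  moreover have "\<sigma> j = i \<longleftrightarrow> j = inv_into UNIV \<sigma> i"
    using assms(1) by (metis permutes_inverses(1) permutes_inverses(2))
  ultimately show "permute_list \<sigma> (xs[i := a]) ! j = (permute_list \<sigma> xs)[inv_into UNIV \<sigma> i := a] ! j"
    using assms j by (auto simp: permute_list_nth nth_list_update)
qed simp

lemma tensor_map_permute:
  assumes A: "comm_group A" and \<sigma>: "\<sigma> permutes {..<d}"
  shows "tensor_map d A A (permute_list \<sigma>) \<in> mor (tensor_pow d A) (tensor_pow d A)"
    and "xs \<in> tuples d A \<Longrightarrow> tensor_map d A A (permute_list \<sigma>) (tens d A xs) = tens d A (permute_list \<sigma> xs)"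
proof -
  have t: "permute_list \<sigma> xs \<in> tuples d A" if "xs \<in> tuples d A" for xs
    using that \<sigma> by (auto simp: tuples_def)
  have m: "\<exists>ys\<in>tuples d A. \<exists>j<d. \<exists>a'\<in>carrier A. \<exists>b'\<in>carrier A. permute_list \<sigma> (xs[i := a]) = ys[j := a']
         \<and> permute_list \<sigma> (xs[i := b]) = ys[j := b'] \<and> permute_list \<sigma> (xs[i := a \<otimes>\<^bsub>A\<^esub> b]) = ys[j := a' \<otimes>\<^bsub>A\<^esub> b']"
    if "xs \<in> tuples d A" "i < d" "a \<in> carrier A" "b \<in> carrier A" for xs i a b
    using that \<sigma> t permutes_in_image[OF permutes_inv[OF \<sigma>], of i]
    by (intro bexI[of _ "permute_list \<sigma> xs"] exI[of _ "inv_into UNIV \<sigma> i"] bexI[of _ a] bexI[of _ b] conjI)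
       (auto simp: permute_list_update tuples_def)
  show "tensor_map d A A (permute_list \<sigma>) \<in> mor (tensor_pow d A) (tensor_pow d A)"
    by (rule tensor_map_tens(1)[OF A A t m])
  show "xs \<in> tuples d A \<Longrightarrow> tensor_map d A A (permute_list \<sigma>) (tens d A xs) = tens d A (permute_list \<sigma> xs)"
    by (rule tensor_map_tens(2)[OF A A t m])
qed

context
  fixes d :: nat and A :: "'a monoid"
  assumes A: "comm_group A"
begin

interpretation T: comm_group "tensor_pow d A" by (rule comm_group_tensor_pow[OF A])

lemma coinv_gens_closed:
  "{tensor_map d A A (permute_list \<sigma>) t \<otimes>\<^bsub>tensor_pow d A\<^esub> inv\<^bsub>tensor_pow d A\<^esub> t | \<sigma> t.
          \<sigma> permutes {..<d} \<and> t \<in> carrier (tensor_pow d A)} \<subseteq> carrier (tensor_pow d A)"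
  using mor_closed[OF tensor_map_permute(1)[OF A]] by auto

lemma coinv_rel_normal: "coinv_rel d A \<lhd> tensor_pow d A"
  unfolding coinv_rel_def
  using T.generate_is_subgroup[OF coinv_gens_closed] T.subgroup_imp_normal by blast

lemma comm_group_sym_pow: "comm_group (Sym d A)"
  unfolding ob_sym_pow
  using T.abelian_FactGroup coinv_rel_normal normal_imp_subgroup by blast

lemma symt_closed: "xs \<in> tuples d A \<Longrightarrow> symt d A xs \<in> carrier (Sym d A)"
  using tens_closed[OF A] by (auto simp: symt_def ob_sym_pow carrier_FactGroup)

lemma symt_update_mult:
  assumes "xs \<in> tuples d A" "i < d" "a \<in> carrier A" "b \<in> carrier A"
  shows "symt d A (xs[i := a \<otimes>\<^bsub>A\<^esub> b])
    = symt d A (xs[i := a]) \<otimes>\<^bsub>Sym d A\<^esub> symt d A (xs[i := b])"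
proof -
  interpret N: normal "coinv_rel d A" "tensor_pow d A" by (rule coinv_rel_normal)
  show ?thesis
    using assms tens_closed[OF A] tuples_update[OF assms(1)]
    by (simp add: symt_def ob_sym_pow tens_update_mult[OF A] N.rcos_sum)
qed

lemma symt_permute:
  assumes "xs \<in> tuples d A" "\<sigma> permutes {..<d}"
  shows "symt d A (permute_list \<sigma> xs) = symt d A xs"
proof -
  interpret N: normal "coinv_rel d A" "tensor_pow d A" by (rule coinv_rel_normal)
  let ?s = "tens d A (permute_list \<sigma> xs)" and ?t = "tens d A xs"
  have p: "permute_list \<sigma> xs \<in> tuples d A"
    using assms by (auto simp: tuples_def)
  have c: "?s \<in> carrier (tensor_pow d A)" "?t \<in> carrier (tensor_pow d A)"
    using tens_closed[OF A] assms p by auto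
  have "?s \<otimes>\<^bsub>tensor_pow d A\<^esub> inv\<^bsub>tensor_pow d A\<^esub> ?t \<in> coinv_rel d A"
    unfolding coinv_rel_def tensor_map_permute(2)[OF A assms(2,1), symmetric]
    using assms c by (blast intro: generate.incl)
  then have "?s \<in> coinv_rel d A #>\<^bsub>tensor_pow d A\<^esub> ?t"
    using c N.rcos_module_rev T.group_axioms by blast
  then show ?thesis
    unfolding symt_def using T.repr_independence c N.subgroup_axioms by metis
qed

text \<open>Lists with the same multiset are permutations of each other, and coinvariants ignore
  permutations. Hence monomials can be indexed by multisets, which are the monomials of the
  polynomial ring used below.\<close>

lemma symt_mset:
  assumes "xs \<in> tuples d A" "mset xs = mset ys"
  shows "symt d A xs = symt d A ys"
proof -
  have "ys \<in> tuples d A"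
    using assms mset_eq_length[OF assms(2)] mset_eq_setD[OF assms(2)] by (auto simp: tuples_def)
  moreover obtain \<sigma> where "\<sigma> permutes {..<length ys}" "permute_list \<sigma> ys = xs"
    using assms(2) mset_eq_permutation by blast
  ultimately show ?thesis
    using symt_permute by (auto simp: tuples_def)
qed

lemma sym_pow_hom_ext:
  assumes "group B" "h \<in> hom (Sym d A) B" "h' \<in> hom (Sym d A) B"
    "\<And>xs. xs \<in> tuples d A \<Longrightarrow> h (symt d A xs) = h' (symt d A xs)" "t \<in> carrier (Sym d A)"
  shows "h t = h' t"
proof -
  let ?q = "\<lambda>a. coinv_rel d A #>\<^bsub>tensor_pow d A\<^esub> a"
  interpret N: normal "coinv_rel d A" "tensor_pow d A" by (rule coinv_rel_normal)
  obtain u where u: "u \<in> carrier (tensor_pow d A)" "t = ?q u"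
    using assms(5) by (auto simp: ob_sym_pow carrier_FactGroup)
  have "(h \<circ> ?q) u = (h' \<circ> ?q) u"
  proof (rule tensor_pow_hom_ext[OF A])
    show "h \<circ> ?q \<in> hom (tensor_pow d A) B"
      using assms N.r_coset_hom_Mod hom_compose by (metis ob_sym_pow)
    show "h' \<circ> ?q \<in> hom (tensor_pow d A) B"
      using assms N.r_coset_hom_Mod hom_compose by (metis ob_sym_pow)
  qed (use assms u in \<open>auto simp: symt_def\<close>)
  then show ?thesis using u by simp
qed

lemma sym_pow_universal:
  assumes "comm_group B" "\<And>xs. xs \<in> tuples d A \<Longrightarrow> u xs \<in> carrier B"
    "\<And>xs i a b. \<lbrakk>xs \<in> tuples d A; i < d; a \<in> carrier A; b \<in> carrier A\<rbrakk>
      \<Longrightarrow> u (xs[i := a \<otimes>\<^bsub>A\<^esub> b]) = u (xs[i := a]) \<otimes>\<^bsub>B\<^esub> u (xs[i := b])"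
    "\<And>xs \<sigma>. \<lbrakk>xs \<in> tuples d A; \<sigma> permutes {..<d}\<rbrakk> \<Longrightarrow> u (permute_list \<sigma> xs) = u xs"
  obtains h where "h \<in> hom (Sym d A) B" "\<And>xs. xs \<in> tuples d A \<Longrightarrow> h (symt d A xs) = u xs"
proof -
  interpret B: comm_group B by fact
  obtain k where k: "k \<in> hom (tensor_pow d A) B" "\<And>x. x \<in> tuples d A \<Longrightarrow> k (tens d A x) = u x"
    using tensor_pow_universal[OF A assms(1-3)] by blast
  interpret k: group_hom "tensor_pow d A" B k
    by (intro group_homI k) auto
  interpret N: normal "coinv_rel d A" "tensor_pow d A" by (rule coinv_rel_normal)
  \<comment> \<open>The symmetry of u passes from tuples to all tensors, since pure tensors
    generate.\<close>
  have inv: "k (tensor_map d A A (permute_list \<sigma>) t) = k t"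
    if "\<sigma> permutes {..<d}" "t \<in> carrier (tensor_pow d A)" for \<sigma> t
  proof -
    have "(k \<circ> tensor_map d A A (permute_list \<sigma>)) t = k t"
    proof (rule tensor_pow_hom_ext[OF A _ hom_compose[OF morD[OF tensor_map_permute(1)[OF A that(1)]] k(1)] k(1) _ that(2)])
      fix xs assume "xs \<in> tuples d A"
      then show "(k \<circ> tensor_map d A A (permute_list \<sigma>)) (tens d A xs) = k (tens d A xs)"
        using that assms(4) by (simp add: tensor_map_permute(2)[OF A that(1)] k(2) tuples_def)
    qed auto
    then show ?thesis by simp
  qed
  have "k ` coinv_rel d A \<subseteq> {\<one>\<^bsub>B\<^esub>}"
    unfolding coinv_rel_def
  proof (rule generate_hom_image[OF _ _ _ k(1) coinv_gens_closed], goal_cases)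
    case 4
    show ?case
      using mor_closed[OF tensor_map_permute(1)[OF A]] by (auto simp: inv)
  qed (auto simp: B.triv_subgroup)
  then have "coinv_rel d A \<subseteq> kernel (tensor_pow d A) B k"
    using N.subset by (auto simp: kernel_def)
  from k.FactGroup_universal_kernel[OF coinv_rel_normal this]
  obtain h where "h \<in> hom (tensor_pow d A Mod coinv_rel d A) B"
    "\<And>x. x \<in> carrier (tensor_pow d A) \<Longrightarrow> h (coinv_rel d A #>\<^bsub>tensor_pow d A\<^esub> x) = k x"
    by blast
  then show ?thesis
    using that[of h] k tens_closed[OF A] by (simp add: ob_sym_pow symt_def)
qed

end

section \<open>Functoriality of the symmetric powers\<close>

lemma sym_pow_ar:
  assumes A: "comm_group A" and B: "comm_group B" and f: "f \<in> hom A B"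
  shows "ar (sym_pow d) A B f \<in> mor (Sym d A) (Sym d B)"
    and "xs \<in> tuples d A \<Longrightarrow> ar (sym_pow d) A B f (symt d A xs) = symt d B (map f xs)"
proof -
  let ?\<tau> = "tensor_map d A B (map f)"
  note \<tau> = tensor_map_map[OF A B f, where d = d]
  interpret TA: comm_group "tensor_pow d A" by (rule comm_group_tensor_pow[OF A])
  interpret TB: comm_group "tensor_pow d B" by (rule comm_group_tensor_pow[OF B])
  interpret \<tau>: group_hom "tensor_pow d A" "tensor_pow d B" ?\<tau>
    by (intro group_homI) (auto intro: morD \<tau>)
  have tup: "map f xs \<in> tuples d B" if "xs \<in> tuples d A" for xs
    using that f by (auto simp: tuples_def hom_def)
  \<comment> \<open>Permuting the factors commutes with applying f to each of them, so the
    generating relations for A go to generating relations for B.\<close>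
  have com: "?\<tau> (tensor_map d A A (permute_list \<sigma>) t) = tensor_map d B B (permute_list \<sigma>) (?\<tau> t)"
    if "\<sigma> permutes {..<d}" "t \<in> carrier (tensor_pow d A)" for \<sigma> t
  proof -
    note pA = tensor_map_permute[OF A that(1)] and pB = tensor_map_permute[OF B that(1)]
    have "(?\<tau> \<circ> tensor_map d A A (permute_list \<sigma>)) t = (tensor_map d B B (permute_list \<sigma>) \<circ> ?\<tau>) t"
    proof (rule tensor_pow_hom_ext[OF A _ hom_compose[OF morD[OF pA(1)] morD[OF \<tau>(1)]]
             hom_compose[OF morD[OF \<tau>(1)] morD[OF pB(1)]] _ that(2)])
      fix xs assume xs: "xs \<in> tuples d A"
      then have "permute_list \<sigma> xs \<in> tuples d A"
        using that(1) by (auto simp: tuples_def)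
      then show "(?\<tau> \<circ> tensor_map d A A (permute_list \<sigma>)) (tens d A xs)
          = (tensor_map d B B (permute_list \<sigma>) \<circ> ?\<tau>) (tens d A xs)"
        using xs that(1) tup by (simp add: pA pB \<tau> permute_list_map tuples_def)
    qed auto
    then show ?thesis by simp
  qed
  have "?\<tau> ` coinv_rel d A \<subseteq> coinv_rel d B"
    unfolding coinv_rel_def[of d A]
  proof (rule generate_hom_image[OF _ _ _ morD[OF \<tau>(1)] coinv_gens_closed[OF A]], goal_cases)
    case 4
    have "?\<tau> (tensor_map d A A (permute_list \<sigma>) t \<otimes>\<^bsub>tensor_pow d A\<^esub> inv\<^bsub>tensor_pow d A\<^esub> t) \<in> coinv_rel d B"
      if "\<sigma> permutes {..<d}" "t \<in> carrier (tensor_pow d A)" for \<sigma> t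
    proof -
      have "?\<tau> (tensor_map d A A (permute_list \<sigma>) t \<otimes>\<^bsub>tensor_pow d A\<^esub> inv\<^bsub>tensor_pow d A\<^esub> t)
          = tensor_map d B B (permute_list \<sigma>) (?\<tau> t) \<otimes>\<^bsub>tensor_pow d B\<^esub> inv\<^bsub>tensor_pow d B\<^esub> ?\<tau> t"
        using that mor_closed[OF tensor_map_permute(1)[OF A]] by (simp add: com)
      then show ?thesis
        unfolding coinv_rel_def
        by (intro generate.incl CollectI exI[of _ \<sigma>] exI[of _ "?\<tau> t"]) (use that in simp)
    qed
    then show ?case by blast
  qed (auto intro: normal_imp_subgroup coinv_rel_normal[OF B])
  note * = coinv_rel_normal[OF A] coinv_rel_normal[OF B] morD[OF \<tau>(1)] this
  have ar: "ar (sym_pow d) A B f = quot_map (tensor_pow d A) (coinv_rel d A) (tensor_pow d B) (coinv_rel d B) ?\<tau>"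
    by (simp add: sym_pow_def)
  show "ar (sym_pow d) A B f \<in> mor (Sym d A) (Sym d B)"
    unfolding ob_sym_pow ar by (rule quot_map_mor[OF *])
  show "ar (sym_pow d) A B f (symt d A xs) = symt d B (map f xs)" if "xs \<in> tuples d A"
    unfolding ar symt_def using that by (simp add: quot_map_coset[OF *] tens_closed[OF A] \<tau>(2))
qed

lemma sym_pow_id:
  assumes A: "comm_group A"
  shows "ar (sym_pow d) A A (\<lambda>x\<in>carrier A. x) = (\<lambda>x\<in>carrier (Sym d A). x)"
proof -
  let ?S = "Sym d A"
  interpret A: comm_group A by (fact A)
  interpret S: comm_group ?S by (rule comm_group_sym_pow[OF A])
  have id: "(\<lambda>x\<in>carrier A. x) \<in> hom A A" "(\<lambda>x\<in>carrier ?S. x) \<in> mor ?S ?S"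
    by (auto simp: hom_def mor_def)
  note ar = sym_pow_ar[OF A A id(1), where d = d]
  show ?thesis
  proof (rule mor_ext[OF ar(1) id(2)])
    show "ar (sym_pow d) A A (\<lambda>x\<in>carrier A. x) t = (\<lambda>x\<in>carrier ?S. x) t" if "t \<in> carrier ?S" for t
    proof (rule sym_pow_hom_ext[OF A _ morD[OF ar(1)] morD[OF id(2)] _ that])
      fix xs assume xs: "xs \<in> tuples d A"
      then have "map (\<lambda>x\<in>carrier A. x) xs = xs"
        by (auto simp: tuples_def intro!: map_idI)
      then show "ar (sym_pow d) A A (\<lambda>x\<in>carrier A. x) (symt d A xs) = (\<lambda>x\<in>carrier ?S. x) (symt d A xs)"
        using xs symt_closed[OF A] by (simp add: ar)
    qed auto
  qed
qed

lemma sym_pow_comp: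
  assumes A: "comm_group A" and B: "comm_group B" and D: "comm_group D"
    and f: "f \<in> hom A B" and g: "g \<in> hom B D"
  shows "ar (sym_pow d) A D (compose (carrier A) g f) =
     compose (carrier (Sym d A)) (ar (sym_pow d) B D g) (ar (sym_pow d) A B f)"
proof -
  interpret A: comm_group A by (fact A)
  interpret S: comm_group "Sym d A" by (rule comm_group_sym_pow[OF A])
  interpret S': comm_group "Sym d D" by (rule comm_group_sym_pow[OF D])
  have c: "compose (carrier A) g f \<in> hom A D"
    by (rule A.hom_compose) (use f g in auto)
  note F = sym_pow_ar[OF A B f, where d = d] and G = sym_pow_ar[OF B D g, where d = d] and C = sym_pow_ar[OF A D c, where d = d]
  have k: "compose (carrier (Sym d A)) (ar (sym_pow d) B D g) (ar (sym_pow d) A B f)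
      \<in> mor (Sym d A) (Sym d D)"
    using S.hom_compose[OF morD[OF F(1)] morD[OF G(1)]] by (simp add: mor_def)
  show ?thesis
  proof (rule mor_ext[OF C(1) k])
    fix t assume t: "t \<in> carrier (Sym d A)"
    show "ar (sym_pow d) A D (compose (carrier A) g f) t =
       compose (carrier (Sym d A)) (ar (sym_pow d) B D g) (ar (sym_pow d) A B f) t"
    proof (rule sym_pow_hom_ext[OF A _ morD[OF C(1)] morD[OF k] _ t])
      fix xs assume xs: "xs \<in> tuples d A"
      then have fxs: "map f xs \<in> tuples d B"
        using f by (auto simp: tuples_def hom_def)
      have m: "map (compose (carrier A) g f) xs = map g (map f xs)"
        using xs by (auto simp: tuples_def compose_def)
      show "ar (sym_pow d) A D (compose (carrier A) g f) (symt d A xs) =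
         compose (carrier (Sym d A)) (ar (sym_pow d) B D g) (ar (sym_pow d) A B f) (symt d A xs)"
        using xs symt_closed[OF A xs] fxs
        by (simp only: C(2) m compose_eq F(2) G(2))
    qed auto
  qed
qed

section \<open>Polynomial expressions in symmetric powers\<close>

text \<open>Puts additive groups into the record format of the functors, so that rings can be
  sources and targets of homomorphisms.\<close>

definition add_grp :: "'r::ab_group_add monoid" where
  "add_grp = \<lparr>carrier = UNIV, monoid.mult = (+), one = 0\<rparr>"

lemma add_grp_simps [simp]:
  "carrier add_grp = UNIV" "x \<otimes>\<^bsub>add_grp\<^esub> y = x + y" "\<one>\<^bsub>add_grp\<^esub> = 0"
  by (simp_all add: add_grp_def)

lemma comm_group_add_grp: "comm_group (add_grp :: 'r::ab_group_add monoid)"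
proof (rule comm_groupI)
  show "\<exists>y\<in>carrier add_grp. y \<otimes>\<^bsub>add_grp\<^esub> x = \<one>\<^bsub>add_grp\<^esub>" for x :: 'r
    by (auto intro: exI[of _ "- x"])
qed (auto simp: algebra_simps)

lemma inv_add_grp [simp]: "inv\<^bsub>add_grp\<^esub> x = - x"
  by (rule group.inv_equality[OF comm_group_group[OF comm_group_add_grp]]) auto

text \<open>Additively, a ring of finitely supported functions on monomials is free on all
  monomials, so homomorphisms from it are given by their values there.\<close>

lemma free_Abelian_group_UNIV: "free_Abelian_group UNIV = add_grp"
  by (simp add: free_Abelian_group_def add_grp_def)

lemma hom_add_grp_simps:
  assumes "h \<in> hom add_grp G" "group G"
  shows "h (x + y) = h x \<otimes>\<^bsub>G\<^esub> h y" "h 0 = \<one>\<^bsub>G\<^esub>" "h (- x) = inv\<^bsub>G\<^esub> h x" "h x \<in> carrier G"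
proof -
  interpret h: group_hom add_grp G h
    by (rule group_homI[OF comm_group_group[OF comm_group_add_grp] assms(2,1)])
  show "h (x + y) = h x \<otimes>\<^bsub>G\<^esub> h y" "h 0 = \<one>\<^bsub>G\<^esub>" "h (- x) = inv\<^bsub>G\<^esub> h x" "h x \<in> carrier G"
    using h.hom_mult[of x y] h.hom_one h.hom_inv[of x] h.hom_closed[of x] by simp_all
qed

text \<open>For comparing forms term by term: the two rings may differ, because only the integer
  coefficients are shared, and only the values at monomials need checking.\<close>

lemma hom_add_grp_lincomb_cong:
  fixes u :: "'i \<Rightarrow> 'r::ring_1" and u' :: "'i \<Rightarrow> 's::ring_1"
  assumes h: "h \<in> hom add_grp G" "group G" and h': "h' \<in> hom add_grp G"
    and u: "\<And>i. i \<in> I \<Longrightarrow> h (u i) = h' (u' i)"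
  shows "h (\<Sum>i\<in>I. of_int (c i) * u i) = h' (\<Sum>i\<in>I. of_int (c i) * u' i)"
proof -
  note s = hom_add_grp_simps[OF h] hom_add_grp_simps[OF h' h(2)]
  have nat: "h (of_nat n * u i) = h' (of_nat n * u' i)" if "i \<in> I" for n i
    by (induction n) (simp_all add: s distrib_right u that)
  have int: "h (of_int n * u i) = h' (of_int n * u' i)" if "i \<in> I" for n i
    by (cases n rule: int_cases2) (use that in \<open>simp_all add: nat s\<close>)
  show ?thesis
    using int by (induction I rule: infinite_finite_induct) (simp_all add: s)
qed

text \<open>The coefficients are a plain sequence of integers, so that one and the same form can be
  evaluated in every commutative ring.\<close>

definition hform :: "nat \<Rightarrow> (nat \<Rightarrow> int) \<Rightarrow> 'r::comm_ring_1 \<Rightarrow> 'r \<Rightarrow> 'r" where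
  "hform d a X Y = (\<Sum>i\<le>d. of_int (a i) * (X ^ i * Y ^ (d - i)))"

lemma hform_add: "hform d (\<lambda>i. a i + b i) X Y = hform d a X Y + hform d b X Y"
  by (simp add: hform_def distrib_right sum.distrib)

lemma hform_uminus: "hform d (\<lambda>i. - a i) X Y = - hform d a X Y"
  by (simp add: hform_def sum_negf)

lemma hform_scale: "hform d (\<lambda>i. k * a i) X Y = of_int k * hform d a X Y"
  by (simp add: hform_def sum_distrib_left mult.assoc)

lemma hform_cong: "(\<And>i. i \<le> d \<Longrightarrow> a i = b i) \<Longrightarrow> hform d a X Y = hform d b X Y"
  by (simp add: hform_def)

lemma hform_times_left:
  "X * hform d a X Y = hform (Suc d) (\<lambda>i. if i = 0 then 0 else a (i - 1)) X Y"
  unfolding hform_def by (subst sum.atMost_Suc_shift) (simp add: sum_distrib_left algebra_simps)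

lemma hform_times_right:
  "Y * hform d a X Y = hform (Suc d) (\<lambda>i. if i = Suc d then 0 else a i) X Y"
  unfolding hform_def by (auto simp: sum_distrib_left algebra_simps Suc_diff_le intro!: sum.cong)

text \<open>Multiplication by X shifts the coefficients, multiplication by Y does not. This is what
  expands a monomial whose entries are combinations of two generators.\<close>

lemma hform_prod_list:
  assumes "\<And>p. p \<in> set ps \<Longrightarrow> \<exists>m n. p = of_int m * X + of_int n * Y"
  shows "\<exists>a. prod_list ps = hform (length ps) a X Y"
  using assms
proof (induction ps)
  case Nil
  have "prod_list [] = hform (length []) (\<lambda>_. 1) X Y"
    by (simp add: hform_def)
  then show ?case by blast
next
  case (Cons p ps)
  obtain a where a: "prod_list ps = hform (length ps) a X Y"
    using Cons by auto
  obtain m n where p: "p = of_int m * X + of_int n * Y"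
    using Cons.prems[of p] by auto
  have "prod_list (p # ps) = of_int m * (X * hform (length ps) a X Y) + of_int n * (Y * hform (length ps) a X Y)"
    by (simp add: a p algebra_simps)
  also have "\<dots> = hform (length (p # ps))
     (\<lambda>i. m * (if i = 0 then 0 else a (i - 1)) + n * (if i = Suc (length ps) then 0 else a i)) X Y"
    by (simp only: hform_times_left hform_times_right hform_add length_Cons flip: hform_scale)
  finally show ?case by blast
qed

text \<open>\<open>'a multiset \<Rightarrow>\<^sub>0 int\<close> is the polynomial ring with one variable for each element of \<open>'a\<close>.
  The part of degree \<open>d\<close> maps onto the \<open>d\<close>-th symmetric power, so that polynomial identities can be
  proved in a commutative ring without torsion.\<close>

type_synonym 'a mring = "'a multiset \<Rightarrow>\<^sub>0 int"

definition var :: "'a \<Rightarrow> 'a mring" where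
  "var a = frag_of {#a#}"

text \<open>Only monomials of degree d with entries in the carrier have a prescribed value;
  \<open>SOME\<close> leaves the rest open. The map is merely additive: multiplicative information
  enters through products of exactly d linear forms.\<close>

definition mring_to_sym :: "nat \<Rightarrow> 'a monoid \<Rightarrow> 'a mring \<Rightarrow> ('a list \<Rightarrow>\<^sub>0 int) set set" where
  "mring_to_sym d A = (SOME h. h \<in> hom add_grp (Sym d A) \<and>
     (\<forall>xs\<in>tuples d A. h (frag_of (mset xs)) = symt d A xs))"

text \<open>The ring product is convolution over the monoid of multisets, so multiplying variables
  adds up their multisets.\<close>

lemma prod_list_var: "prod_list (map var xs) = frag_of (mset xs)"
proof (induction xs)
  case (Cons a xs)
  have "frag_of {#a#} * frag_of (mset xs) = frag_of ({#a#} + mset xs)"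
    by (simp only: mult_single) simp
  then show ?case
    using Cons by (simp add: var_def)
qed simp

lemma mring_to_sym:
  assumes A: "comm_group A"
  shows "mring_to_sym d A \<in> hom add_grp (Sym d A)"
    and "xs \<in> tuples d A \<Longrightarrow> mring_to_sym d A (frag_of (mset xs)) = symt d A xs"
proof -
  interpret S: comm_group "Sym d A" by (rule comm_group_sym_pow[OF A])
  \<comment> \<open>A multiset of d carrier elements is listed in some order, which does not matter
    by \<open>symt_mset\<close>; every other multiset goes to the unit.\<close>
  define f where "f M = (if \<exists>xs\<in>tuples d A. mset xs = M
    then symt d A (SOME xs. xs \<in> tuples d A \<and> mset xs = M) else \<one>\<^bsub>Sym d A\<^esub>)" for M
  have f: "f (mset xs) = symt d A xs" if "xs \<in> tuples d A" for xs
  proof -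
    have "(SOME ys. ys \<in> tuples d A \<and> mset ys = mset xs) \<in> tuples d A
        \<and> mset (SOME ys. ys \<in> tuples d A \<and> mset ys = mset xs) = mset xs"
      by (rule someI) (use that in auto)
    then show ?thesis
      using that symt_mset[OF A] unfolding f_def by metis
  qed
  have "f M \<in> carrier (Sym d A)" for M
  proof (cases "\<exists>xs\<in>tuples d A. mset xs = M")
    case True
    then obtain xs where "xs \<in> tuples d A" "mset xs = M" by blast
    then show ?thesis using f[of xs] symt_closed[OF A, of xs d] by simp
  next
    case False
    then have "f M = \<one>\<^bsub>Sym d A\<^esub>" unfolding f_def by (rule if_not_P)
    then show ?thesis by simp
  qed
  then have "range f \<subseteq> carrier (Sym d A)"
    by blast
  then obtain h where "h \<in> hom (free_Abelian_group UNIV) (Sym d A)"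
    "\<And>M. M \<in> UNIV \<Longrightarrow> h (frag_of M) = f M"
    by (rule S.free_Abelian_group_universal) (rule that; simp)
  then have "h \<in> hom add_grp (Sym d A) \<and>
     (\<forall>xs\<in>tuples d A. h (frag_of (mset xs)) = symt d A xs)"
    using f by (simp add: free_Abelian_group_UNIV)
  from someI[of "\<lambda>h. h \<in> hom add_grp (Sym d A) \<and>
     (\<forall>xs\<in>tuples d A. h (frag_of (mset xs)) = symt d A xs)", OF this]
  show "mring_to_sym d A \<in> hom add_grp (Sym d A)"
    and "xs \<in> tuples d A \<Longrightarrow> mring_to_sym d A (frag_of (mset xs)) = symt d A xs"
    by (simp_all add: mring_to_sym_def)
qed

text \<open>Records that p is an integer combination of variables with value v in A. It is a
  relation since different forms share a value: the variable of a product and the sum of the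
  variables of its factors represent the same element.\<close>

inductive linform :: "'a monoid \<Rightarrow> 'a mring \<Rightarrow> 'a \<Rightarrow> bool" for A where
  var: "a \<in> carrier A \<Longrightarrow> linform A (var a) a"
| zero: "linform A 0 \<one>\<^bsub>A\<^esub>"
| add: "linform A p v \<Longrightarrow> linform A q w \<Longrightarrow> linform A (p + q) (v \<otimes>\<^bsub>A\<^esub> w)"
| minus: "linform A p v \<Longrightarrow> linform A (- p) (inv\<^bsub>A\<^esub> v)"

lemma linform_closed: "linform A p v \<Longrightarrow> group A \<Longrightarrow> v \<in> carrier A"
  by (induction rule: linform.induct) (auto intro: group.is_monoid monoid.m_closed monoid.one_closed group.inv_closed)

lemma list_all2_linform_closed:
  "list_all2 (linform A) ps vs \<Longrightarrow> group A \<Longrightarrow> set vs \<subseteq> carrier A"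
  by (induction rule: list_all2_induct) (auto dest: linform_closed)

context
  fixes d :: nat and A :: "'a monoid"
  assumes A: "comm_group A"
begin

interpretation A: comm_group A by (fact A)
interpretation S: comm_group "Sym d A" by (rule comm_group_sym_pow[OF A])

lemma symt_Cons_mult:
  assumes "v \<in> carrier A" "w \<in> carrier A" "set vs \<subseteq> carrier A" "Suc (length vs) = d"
  shows "symt d A ((v \<otimes>\<^bsub>A\<^esub> w) # vs) = symt d A (v # vs) \<otimes>\<^bsub>Sym d A\<^esub> symt d A (w # vs)"
  using symt_update_mult[OF A, of "v # vs" d 0 v w] assms by (auto simp: tuples_def)

lemma symt_Cons_one:
  assumes "set vs \<subseteq> carrier A" "Suc (length vs) = d"
  shows "symt d A (\<one>\<^bsub>A\<^esub> # vs) = \<one>\<^bsub>Sym d A\<^esub>"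
  using symt_Cons_mult[of "\<one>\<^bsub>A\<^esub>" "\<one>\<^bsub>A\<^esub>" vs] symt_closed[OF A, of "\<one>\<^bsub>A\<^esub> # vs" d] assms
  by (simp add: tuples_def)

lemma symt_Cons_inv:
  assumes "v \<in> carrier A" "set vs \<subseteq> carrier A" "Suc (length vs) = d"
  shows "symt d A ((inv\<^bsub>A\<^esub> v) # vs) = inv\<^bsub>Sym d A\<^esub> symt d A (v # vs)"
proof -
  have "symt d A ((inv\<^bsub>A\<^esub> v) # vs) \<otimes>\<^bsub>Sym d A\<^esub> symt d A (v # vs) = \<one>\<^bsub>Sym d A\<^esub>"
    using symt_Cons_mult[of "inv\<^bsub>A\<^esub> v" v vs] symt_Cons_one[of vs] assms by simp
  then show ?thesis
    using assms symt_closed[OF A, of "v # vs" d] symt_closed[OF A, of "(inv\<^bsub>A\<^esub> v) # vs" d]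
    by (intro S.inv_equality[symmetric]) (auto simp: tuples_def)
qed

text \<open>The linear forms are expanded one at a time. In the inner induction on a form, sums and
  inverses follow from multilinearity, and a variable is moved to the list \<open>as\<close> of
  entries that are already variables.\<close>

lemma mring_to_sym_prod_aux:
  assumes "list_all2 (linform A) ps vs" "set as \<subseteq> carrier A" "length vs + length as = d"
  shows "mring_to_sym d A (prod_list ps * prod_list (map var as)) = symt d A (vs @ as)"
  using assms
proof (induction ps vs arbitrary: as rule: list_all2_induct)
  case Nil
  then show ?case
    using mring_to_sym(2)[OF A, of as d] by (simp add: prod_list_var tuples_def)
next
  case (Cons p ps v vs)
  let ?L = "mring_to_sym d A"
  note L = hom_add_grp_simps[OF mring_to_sym(1)[OF A] S.is_group]
  let ?R = "prod_list ps * prod_list (map var as)"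
  have vs: "set vs \<subseteq> carrier A"
    using list_all2_linform_closed[OF Cons.hyps(2) A.is_group] .
  have len: "Suc (length (vs @ as)) = d" and vas: "set (vs @ as) \<subseteq> carrier A"
    using Cons.prems vs by auto
  from \<open>linform A p v\<close> have "?L (p * ?R) = symt d A (v # vs @ as)"
  proof (induction rule: linform.induct)
    case (var a)
    have "?L (var a * ?R) = ?L (prod_list ps * prod_list (map var (a # as)))"
      by (simp add: algebra_simps)
    also have "\<dots> = symt d A (vs @ a # as)"
      using Cons var by (intro Cons.IH) auto
    also have "\<dots> = symt d A (a # vs @ as)"
      using Cons.prems var vs by (intro symt_mset[OF A]) (auto simp: tuples_def)
    finally show ?case .
  next
    case (add p v q w)
    then have "v \<in> carrier A" "w \<in> carrier A"
      using linform_closed[OF _ A.is_group] by auto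
    then show ?case
      using add symt_Cons_mult[OF _ _ vas len] by (simp add: distrib_right L)
  next
    case (minus p v)
    then have "v \<in> carrier A"
      using linform_closed[OF _ A.is_group] by auto
    then show ?case
      using minus symt_Cons_inv[OF _ vas len] by (simp add: L)
  qed (use symt_Cons_one[OF vas len] in \<open>simp add: L\<close>)
  then show ?case
    by (simp add: mult.assoc)
qed

lemma mring_to_sym_prod:
  assumes "list_all2 (linform A) ps vs" "length vs = d"
  shows "mring_to_sym d A (prod_list ps) = symt d A vs"
  using mring_to_sym_prod_aux[OF assms(1), of "[]"] assms(2) by simp

lemma mring_to_sym_monomial:
  assumes "linform A p v" "linform A q w" "i \<le> d"
  shows "mring_to_sym d A (p ^ i * q ^ (d - i)) = symt d A (replicate i v @ replicate (d - i) w)"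
proof -
  have "list_all2 (linform A) (replicate i p @ replicate (d - i) q) (replicate i v @ replicate (d - i) w)"
    using assms(1,2) by (simp add: list_all2_conv_all_nth nth_append)
  from mring_to_sym_prod[OF this] show ?thesis
    using assms by simp
qed

text \<open>Modulo the subgroup generated by the monomials, the quotient map and the constant map
  agree on monomials, hence everywhere; so that subgroup is the whole group.\<close>

lemma sym_pow_generated: "carrier (Sym d A) = generate (Sym d A) (symt d A ` tuples d A)"
proof
  let ?S = "Sym d A" and ?H = "generate (Sym d A) (symt d A ` tuples d A)"
  have K: "symt d A ` tuples d A \<subseteq> carrier ?S"
    using symt_closed[OF A, of _ d] by blast
  then have H: "subgroup ?H ?S"
    by (rule S.generate_is_subgroup)
  then interpret H: normal ?H ?S
    using S.subgroup_imp_normal by blast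
  interpret Q: group "?S Mod ?H" by (rule H.factorgroup_is_group)
  show "carrier ?S \<subseteq> ?H"
  proof
    fix t assume t: "t \<in> carrier ?S"
    have "?H #>\<^bsub>?S\<^esub> t = (\<lambda>_. ?H) t"
    proof (rule sym_pow_hom_ext[OF A _ H.r_coset_hom_Mod _ _ t])
      show "(\<lambda>_. ?H) \<in> hom ?S (?S Mod ?H)"
        using Q.one_closed Q.l_one[OF Q.one_closed] unfolding one_FactGroup by (intro homI) simp_all
      show "?H #>\<^bsub>?S\<^esub> symt d A xs = ?H" if "xs \<in> tuples d A" for xs
        using that K by (intro S.coset_join2[OF _ H]) (blast intro: generate.incl)+
    qed (rule Q.is_group)
    then show "t \<in> ?H"
      using S.coset_join1[OF _ t H] H.subset by blast
  qed
  show "?H \<subseteq> carrier ?S"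
    by (rule S.generate_incl[OF K])
qed

lemma countable_sym_pow:
  assumes "countable (carrier A)"
  shows "countable (carrier (Sym d A))"
proof -
  have "countable (tuples d A)"
    by (rule countable_subset[OF _ countable_lists[OF assms]]) (auto simp: tuples_def)
  then show ?thesis
    by (simp add: sym_pow_generated countable_generate)
qed

end

text \<open>The element \<Sum> a_i v^i w^(d-i) of S^d(A), computed in the polynomial ring.\<close>

definition pol :: "nat \<Rightarrow> 'a monoid \<Rightarrow> (nat \<Rightarrow> int) \<Rightarrow> 'a \<Rightarrow> 'a \<Rightarrow> ('a list \<Rightarrow>\<^sub>0 int) set set" where
  "pol d A a v w = mring_to_sym d A (hform d a (var v) (var w))"

section \<open>The cocycle polynomial\<close>

text \<open>For n = p^k m, absorption shows that n divides j times (n choose j). If p did not divide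
  the binomial coefficient, p^k would divide j, which is too small.\<close>

lemma prime_dvd_choose_prime_power_mult:
  fixes p k m j :: nat
  assumes "prime p" "0 < j" "j < p ^ k"
  shows "p dvd (p ^ k * m choose j)"
proof (rule ccontr)
  assume n: "\<not> p dvd (p ^ k * m choose j)"
  then have "coprime (p ^ k) (p ^ k * m choose j)"
    using assms(1) by (simp add: prime_imp_coprime)
  moreover have "p ^ k dvd j * (p ^ k * m choose j)"
    using times_binomial_minus1_eq[OF assms(2), of "p ^ k * m"] by simp
  ultimately have "p ^ k dvd j"
    by (simp add: coprime_dvd_mult_left_iff)
  then show False
    using assms by (auto dest: dvd_imp_le)
qed

text \<open>By Pascal's rule, neighbouring entries at the start of row p^k m - 1 add up to an entry
  divisible by p. Since the row begins with 1, none of them is divisible by p.\<close>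

lemma not_prime_dvd_choose_prime_power_mult_minus1:
  fixes p k m j :: nat
  assumes "prime p" "m > 0" "j < p ^ k"
  shows "\<not> p dvd (p ^ k * m - 1 choose j)"
  using assms(3)
proof (induction j)
  case 0
  then show ?case using assms(1) by auto
next
  case (Suc j)
  have "p ^ k * m > 0"
    using assms by (simp add: prime_gt_0_nat)
  then have "p ^ k * m choose Suc j = (p ^ k * m - 1 choose j) + (p ^ k * m - 1 choose Suc j)"
    by (metis Suc_diff_1 binomial_Suc_Suc)
  then show ?case
    using prime_dvd_choose_prime_power_mult[OF assms(1) zero_less_Suc Suc.prems, of m] Suc
    by (metis Suc_lessD dvd_add_left_iff)
qed

text \<open>Absorption at j = p^k, with the factor p^k cancelled. For m > 0 the binomial coefficient
  on the right is prime to p by the previous lemma, so p divides the left side exactly as often as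
  m.\<close>

lemma choose_prime_power:
  fixes p k m :: nat
  assumes "prime p"
  shows "p ^ k * m choose p ^ k = m * (p ^ k * m - 1 choose (p ^ k - 1))"
proof -
  have "p ^ k * (p ^ k * m choose p ^ k) = p ^ k * (m * (p ^ k * m - 1 choose (p ^ k - 1)))"
    using times_binomial_minus1_eq[of "p ^ k" "p ^ k * m"] assms by (simp add: prime_gt_0_nat)
  then show ?thesis
    using assms by (simp add: prime_gt_0_nat)
qed

text \<open>The index i = p^(l-1) alone suffices: the binomial coefficient there is p times a number
  prime to p. Working with divisibility of multiples of a replaces an expression of the greatest
  common divisor as an integer combination.\<close>

lemma dvd_mult_choose_prime_power:
  fixes p l :: nat and a :: int
  assumes p: "prime p" "l \<ge> 1"
    and a: "\<And>i. 0 < i \<Longrightarrow> i < p ^ l \<Longrightarrow> int (p ^ l) dvd a * int (p ^ l choose i)"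
  shows "int (p ^ l) dvd a * int p"
proof -
  obtain k where l: "l = Suc k" using p by (cases l) auto
  let ?u = "p ^ k * p - 1 choose (p ^ k - 1)"
  have "p ^ k < p ^ l" "0 < p ^ k"
    using p prime_gt_1_nat[of p] by (auto simp: l)
  then have "int (p ^ l) dvd a * int (p ^ k * p choose p ^ k)"
    using a[of "p ^ k"] by (simp add: l mult.commute)
  then have "int (p ^ l) dvd (a * int p) * int ?u"
    by (simp add: choose_prime_power[OF p(1)] mult.assoc)
  moreover have "coprime (int (p ^ l)) (int ?u)"
    using not_prime_dvd_choose_prime_power_mult_minus1[OF p(1), of p "p ^ k - 1" k] p(1)
      \<open>0 < p ^ k\<close> prime_gt_0_nat[OF p(1)]
    by (simp add: prime_imp_coprime)
  ultimately show ?thesis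
    by (simp add: coprime_dvd_mult_left_iff)
qed

text \<open>If p^k is the p-part of d and k > 0, the index i = p^k gives a binomial coefficient
  prime to p, so p^k divides a; letting p vary, d divides a.\<close>

lemma dvd_mult_choose_not_prime_power:
  fixes d :: nat and a :: int
  assumes d: "d > 0" "\<nexists>p l :: nat. prime p \<and> l \<ge> 1 \<and> d = p ^ l"
    and a: "\<And>i. 0 < i \<Longrightarrow> i < d \<Longrightarrow> int d dvd a * int (d choose i)"
  shows "int d dvd a"
proof (cases "a = 0")
  case False
  have "d dvd nat \<bar>a\<bar>"
  proof (rule multiplicity_le_imp_dvd)
    fix p :: nat assume p: "prime p"
    let ?k = "multiplicity p d"
    obtain m where m: "d = p ^ ?k * m" "\<not> p dvd m"
      using multiplicity_decompose'[of d p] d(1) p by (metis neq0_conv not_prime_unit)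
    have "p ^ ?k dvd nat \<bar>a\<bar>"
    proof (cases "?k = 0")
      case k: False
      \<comment> \<open>m = 1 would make d a prime power. Hence p^k < d, and i = p^k is an
        admissible index.\<close>
      then have "m \<noteq> 1" "m > 0"
        using d m p by (metis One_nat_def Suc_leI mult.right_neutral neq0_conv, metis d(1) m(1) mult_0_right neq0_conv)
      then have lt: "p ^ ?k < d" "0 < p ^ ?k"
        using m(1) p prime_gt_0_nat[of p] by (metis One_nat_def Suc_lessI n_less_m_mult_n mult.commute zero_less_power)
          (simp add: p prime_gt_0_nat)
      let ?u = "p ^ ?k * m - 1 choose (p ^ ?k - 1)"
      have "int (p ^ ?k) dvd int d"
        using m(1) by (metis dvd_triv_left of_nat_dvd_iff)
      also have "int d dvd a * int (m * ?u)"
        using a[OF lt(2,1)] choose_prime_power[OF p, of ?k m] m(1) by metis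
      finally have "int (p ^ ?k) dvd a * int (m * ?u)" .
      moreover have "coprime (int (p ^ ?k)) (int (m * ?u))"
        using not_prime_dvd_choose_prime_power_mult_minus1[OF p \<open>m > 0\<close>, of "p ^ ?k - 1" ?k] m(2) p lt(2)
        by (simp add: prime_imp_coprime del: of_nat_mult)
      ultimately have "int (p ^ ?k) dvd a"
        by (simp only: coprime_dvd_mult_left_iff)
      then show ?thesis
        by (metis dvd_abs_iff int_dvd_int_iff nat_0_le abs_ge_zero)
    qed simp
    then show "?k \<le> multiplicity p (nat \<bar>a\<bar>)"
      using False p by (intro multiplicity_geI) (auto simp: not_prime_unit)
  qed (use d in auto)
  then show ?thesis
    by (metis abs_ge_zero dvd_abs_iff int_dvd_int_iff nat_0_le)
qed simp

text \<open>In the application \<open>g\<close> is the greatest common divisor of the binomial coefficients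
  \<open>d choose i\<close> with \<open>0 < i < d\<close> if \<open>d \<ge> 2\<close>, and \<open>1\<close> if \<open>d = 1\<close>.\<close>

locale choose_gcd =
  fixes d g :: nat
  assumes d_pos: "d > 0" and g_pos: "g > 0" and g_one: "d = 1 \<Longrightarrow> g = 1"
    and g_dvd: "\<And>i. 0 < i \<Longrightarrow> i < d \<Longrightarrow> g dvd d choose i"
    and dvd_g: "\<And>a :: int. (\<And>i. 0 < i \<Longrightarrow> i < d \<Longrightarrow> int d dvd a * int (d choose i)) \<Longrightarrow> int d dvd a * int g"
begin

text \<open>The coefficients of ((x + y)^d - x^d - y^d) / g; the outer ones vanish, and for d = 1
  all of them do.\<close>

definition bcoef :: "nat \<Rightarrow> int" where
  "bcoef i = (if 0 < i \<and> i < d then int (d choose i) div int g else 0)"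

lemma g_mult_bcoef: "0 < i \<Longrightarrow> i < d \<Longrightarrow> int g * bcoef i = int (d choose i)"
  using g_dvd[of i] by (simp add: bcoef_def)

lemma bcoef_ends [simp]: "bcoef 0 = 0" "bcoef d = 0"
  by (simp_all add: bcoef_def)

text \<open>The factor g stays on the left because the ring may have torsion.\<close>

lemma hform_bcoef:
  fixes X Y :: "'r::comm_ring_1"
  shows "of_int (int g) * hform d bcoef X Y = (X + Y) ^ d - X ^ d - Y ^ d"
proof -
  have "(X + Y) ^ d = (\<Sum>i\<le>d. of_nat (d choose i) * X ^ i * Y ^ (d - i))"
    by (rule binomial_ring)
  also have "\<dots> = (\<Sum>i\<le>d. of_int (int g * bcoef i) * (X ^ i * Y ^ (d - i))
      + (if i = d then X ^ d else 0) + (if i = 0 then Y ^ d else 0))"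
  proof (rule sum.cong)
    fix i assume "i \<in> {..d}"
    then consider "i = 0" | "i = d" | "0 < i" "i < d" by force
    then show "of_nat (d choose i) * X ^ i * Y ^ (d - i) = of_int (int g * bcoef i) * (X ^ i * Y ^ (d - i))
      + (if i = d then X ^ d else 0) + (if i = 0 then Y ^ d else 0)"
      using d_pos by cases (simp_all add: g_mult_bcoef mult.assoc del: of_int_mult)
  qed simp
  also have "\<dots> = of_int (int g) * hform d bcoef X Y + X ^ d + Y ^ d"
    by (simp add: sum.distrib hform_def sum_distrib_left mult.assoc)
  finally show ?thesis by simp
qed

end

section \<open>Cocycles among integral binary forms\<close>

lemma coeff_var_power: "coeff ([:0, 1:] ^ n) k = (if k = n then 1 else (0 :: int))"
  using coeff_monom[of "1 :: int" n k] by (simp add: monom_altdef)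

lemma coeff_affine_power_1: "coeff ([:c, 1:] ^ n) (Suc 0) = int n * c ^ (n - 1)"
  using coeff_linear_poly_power[of 1 n c 1] by (cases n) simp_all

lemma of_int_mult_mring: "of_int n * p = frag_cmul n p" for p :: "'a mring"
proof -
  have nat: "of_nat m * p = frag_cmul (int m) p" for m
    by (induction m) (simp_all add: distrib_right frag_cmul_distrib)
  show ?thesis
    by (cases n rule: int_cases2) (simp_all add: nat flip: minus_frag_cmul)
qed

text \<open>The polynomial ring is free as an abelian group. This is the reason for proving the
  cocycle identities there and not in S^d(A).\<close>

lemma of_int_mult_mring_cancel:
  fixes p q :: "'a mring"
  assumes "of_int n * p = of_int n * q" "n \<noteq> 0"
  shows "p = q"
proof -
  have "frag_cmul n (p - q) = 0"
    using assms(1) by (simp add: right_diff_distrib flip: of_int_mult_mring)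
  then show ?thesis
    using assms(2) by simp
qed

context choose_gcd
begin

text \<open>After multiplication by g the form is the deviation of x^d from additivity, for which
  the three identities are immediate; then g is cancelled.\<close>

lemma hform_bcoef_mring:
  fixes X Y Z :: "'a mring"
  shows "hform d bcoef X Y + hform d bcoef (X + Y) Z = hform d bcoef Y Z + hform d bcoef X (Y + Z)"
    and "hform d bcoef X Y = hform d bcoef Y X"
    and "hform d bcoef 0 Y = 0"
proof -
  have g: "int g \<noteq> 0" using g_pos by simp
  show "hform d bcoef X Y + hform d bcoef (X + Y) Z = hform d bcoef Y Z + hform d bcoef X (Y + Z)"
    by (rule of_int_mult_mring_cancel[OF _ g]) (simp only: distrib_left hform_bcoef, simp add: add.assoc)
  show "hform d bcoef X Y = hform d bcoef Y X"
    by (rule of_int_mult_mring_cancel[OF _ g]) (simp only: hform_bcoef, simp add: add.commute)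
  show "hform d bcoef 0 Y = 0"
    by (rule of_int_mult_mring_cancel[OF _ g]) (simp only: hform_bcoef, simp add: zero_power[OF d_pos])
qed

text \<open>With A = a (d - 1), the t-coefficients of the identity at (1, c, t) give A (1 + c)^(d-1)
  = A c^(d-1) + \<Sum> a_i (d - i) c^(d-i-1). Comparing powers of c yields d a_i = A (d choose i)
  for 0 < i < d, so d divides A g, and the multiple is k = A g / d.\<close>

lemma hform_cocycle_multiple_of_bcoef:
  assumes coc: "\<And>X Y Z :: int poly. hform d a X Y + hform d a (X + Y) Z = hform d a Y Z + hform d a X (Y + Z)"
  shows "\<exists>k. \<forall>i\<le>d. a i = k * bcoef i"
proof -
  have h10: "hform d a 1 0 = (of_int (a d) :: int poly)"
  proof -
    have "hform d a 1 0 = (\<Sum>i\<le>d. if i = d then of_int (a d) else (0 :: int poly))"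
      unfolding hform_def by (intro sum.cong) auto
    then show ?thesis by simp
  qed
  have h01: "hform d a 0 1 = (of_int (a 0) :: int poly)"
  proof -
    have "hform d a 0 1 = (\<Sum>i\<le>d. if i = 0 then of_int (a 0) else (0 :: int poly))"
      unfolding hform_def by (intro sum.cong) auto
    then show ?thesis by simp
  qed
  have h00: "hform d a 0 0 = (0 :: int poly)"
    unfolding hform_def using d_pos by (intro sum.neutral) (auto simp: power_0_left)
  \<comment> \<open>The instances (1, 0, 0) and (0, 0, 1) isolate the two outer
    coefficients.\<close>
  have ad: "a d = 0" and a0: "a 0 = 0"
    using coc[of 1 0 0] coc[of 0 0 1] h10 h01 h00 by simp_all
  let ?A = "a (d - 1)"
  \<comment> \<open>The two sides of the t-coefficient as polynomials in c; they are equal because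
    they agree at every integer c.\<close>
  let ?P = "smult ?A ([:1, 1:] ^ (d - 1))"
  let ?Q = "monom ?A (d - 1) + (\<Sum>i\<le>d. monom (a i * int (d - i)) (d - i - 1))"
  have "poly ?P c = poly ?Q c" for c
  proof -
    have c1: "coeff (hform d a 1 [:c:]) 1 = 0"
      by (simp add: hform_def coeff_sum poly_const_pow of_int_poly)
    have c2: "coeff (hform d a [:e:] [:0, 1:]) 1 = ?A * e ^ (d - 1)" for e
    proof -
      have "coeff (hform d a [:e:] [:0, 1:]) 1 = (\<Sum>i\<le>d. if i = d - 1 then ?A * e ^ (d - 1) else 0)"
        unfolding hform_def coeff_sum
        by (intro sum.cong) (use d_pos in \<open>auto simp: poly_const_pow of_int_poly coeff_var_power\<close>)
      then show ?thesis by simp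
    qed
    have c3: "coeff (hform d a 1 [:c, 1:]) 1 = (\<Sum>i\<le>d. a i * int (d - i) * c ^ (d - i - 1))"
      unfolding hform_def coeff_sum
      by (intro sum.cong) (simp_all add: of_int_poly coeff_affine_power_1)
    have "coeff (hform d a 1 [:c:] + hform d a (1 + [:c:]) [:0, 1:]) 1
        = coeff (hform d a [:c:] [:0, 1:] + hform d a 1 ([:c:] + [:0, 1:])) 1"
      by (rule arg_cong[OF coc])
    moreover have "1 + [:c:] = [:1 + c:]" "[:c:] + [:0, 1:] = [:c, 1:]"
      by (simp_all add: one_pCons)
    ultimately show ?thesis
      using c1 c2 c3 by (simp add: poly_sum poly_monom)
  qed
  then have "poly ?P = poly ?Q" by (rule ext)
  then have PQ: "?P = ?Q" by (simp only: poly_eq_poly_eq_iff)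
  \<comment> \<open>Comparison at c^(d-1-i): for i > 0 the separate monomial of degree d - 1 does
    not contribute. The factor d - i is then removed by absorption.\<close>
  have da: "int d * a i = ?A * int (d choose i)" if i: "0 < i" "i < d" for i
  proof -
    have "(\<Sum>j\<le>d. coeff (monom (a j * int (d - j)) (d - j - 1)) (d - 1 - i))
        = (\<Sum>j\<le>d. if j = i then a i * int (d - i) else 0)"
      by (intro sum.cong) (use i in auto)
    then have Q: "coeff ?Q (d - 1 - i) = a i * int (d - i)"
      using i by (simp add: coeff_sum)
    have P: "coeff ?P (d - 1 - i) = ?A * int (d - 1 choose (d - 1 - i))"
      by (simp add: coeff_linear_poly_power)
    have sym: "d - 1 choose (d - 1 - i) = d - 1 choose i"
      using i by (intro binomial_symmetric[symmetric]) auto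
    have ai: "a i * int (d - i) = ?A * int (d - 1 choose i)"
      using Q[symmetric] P unfolding PQ sym by (rule trans)
    have "int (d - i) * (int d * a i) = int d * (a i * int (d - i))"
      by (simp only: ac_simps)
    also have "\<dots> = ?A * int (d * (d - 1 choose i))"
      unfolding ai by (simp only: of_nat_mult ac_simps)
    also have "d * (d - 1 choose i) = (d - i) * (d choose i)"
      by (rule binomial_absorb_comp[symmetric])
    also have "?A * int \<dots> = int (d - i) * (?A * int (d choose i))"
      by (simp only: of_nat_mult ac_simps)
    finally have "int (d - i) * (int d * a i) = int (d - i) * (?A * int (d choose i))" .
    moreover have "int (d - i) \<noteq> 0" using i by simp
    ultimately show ?thesis by (metis mult_left_cancel)
  qed
  have "int d dvd ?A * int g"
  proof (rule dvd_g)
    fix i assume "0 < i" "i < d"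
    from da[OF this, symmetric] show "int d dvd ?A * int (d choose i)" by (rule dvdI)
  qed
  then obtain k where k: "?A * int g = int d * k" ..
  have "a i = k * bcoef i" if "0 < i" "i < d" for i
  proof -
    have "int d * int g * a i = int g * (?A * int (d choose i))"
      unfolding da[OF that, symmetric] by (simp only: ac_simps)
    also have "\<dots> = ?A * int g * (int g * bcoef i)"
      unfolding g_mult_bcoef[OF that, symmetric] by (simp only: ac_simps)
    also have "\<dots> = int d * int g * (k * bcoef i)"
      unfolding k by (simp only: ac_simps)
    finally have "int d * int g * a i = int d * int g * (k * bcoef i)" .
    moreover have "int d * int g \<noteq> 0" using d_pos g_pos by simp
    ultimately show ?thesis by (metis mult_left_cancel)
  qed
  note k = this
  show ?thesis
  proof (intro exI allI impI)
    fix i assume "i \<le> d"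
    then consider "i = 0" | "i = d" | "0 < i" "i < d" by force
    then show "a i = k * bcoef i"
      by cases (simp_all only: ad a0 bcoef_ends k mult_zero_right)
  qed
qed

text \<open>Setting X = 1 and Y = t turns a_i into the coefficient of t^(d-i).\<close>

lemma hform_int_poly_inj:
  assumes "hform d a 1 [:0, 1:] = (hform d b 1 [:0, 1:] :: int poly)" "i \<le> d"
  shows "a i = b i"
proof -
  have "coeff (hform d c 1 [:0, 1:] :: int poly) (d - i) = (\<Sum>j\<le>d. if j = i then c i else 0)" for c
    unfolding hform_def coeff_sum
    by (intro sum.cong) (use assms(2) in \<open>auto simp: of_int_poly coeff_var_power\<close>)
  then have "coeff (hform d c 1 [:0, 1:] :: int poly) (d - i) = c i" for c
    using assms(2) by simp
  then show ?thesis
    using assms(1) by metis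
qed

text \<open>The value is d / g. It serves to cancel the cocycle polynomial when two multiples of it
  are compared; for d = 1 that polynomial is zero.\<close>

lemma bcoef_pos:
  assumes "d \<ge> 2"
  shows "bcoef 1 > 0"
proof -
  have "int g * bcoef 1 = int d"
    using g_mult_bcoef[of 1] assms by simp
  then show ?thesis
    using d_pos by (metis of_nat_0_le_iff of_nat_0_less_iff zero_less_mult_pos g_pos)
qed

end

section \<open>Binary forms with values in symmetric powers\<close>

lemma prod_list_update_mult:
  fixes f :: "'a \<Rightarrow> 'r::comm_monoid_mult"
  assumes "i < length xs"
  shows "prod_list (map f (xs[i := a])) = f a * prod_list (map f (take i xs @ drop (Suc i) xs))"
  using assms by (simp add: upd_conv_take_nth_drop algebra_simps)

context
  fixes d :: nat and A :: "'a monoid"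
  assumes A: "comm_group A"
begin

interpretation A: comm_group A by (fact A)
interpretation S: comm_group "Sym d A" by (rule comm_group_sym_pow[OF A])

lemmas mring_to_sym_simps = hom_add_grp_simps[OF mring_to_sym(1)[OF A] S.is_group]

lemma pol_closed: "pol d A a v w \<in> carrier (Sym d A)"
  by (simp add: pol_def mring_to_sym_simps)

lemma pol_add: "pol d A (\<lambda>i. a i + b i) v w = pol d A a v w \<otimes>\<^bsub>Sym d A\<^esub> pol d A b v w"
  by (simp add: pol_def hform_add mring_to_sym_simps)

lemma pol_uminus: "pol d A (\<lambda>i. - a i) v w = inv\<^bsub>Sym d A\<^esub> pol d A a v w"
  by (simp add: pol_def hform_uminus mring_to_sym_simps)

lemma pol_zero: "pol d A (\<lambda>i. 0) v w = \<one>\<^bsub>Sym d A\<^esub>"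
  by (simp add: pol_def hform_def mring_to_sym_simps)

text \<open>Monomials only see the elements that linear forms represent. So \<open>pol\<close> can
  be computed with any representing forms, in particular with a sum of two variables for a
  product.\<close>

lemma mring_to_sym_hform:
  assumes "linform A p v" "linform A q w"
  shows "mring_to_sym d A (hform d a p q) = pol d A a v w"
proof -
  have "v \<in> carrier A" "w \<in> carrier A"
    using assms linform_closed[OF _ A.is_group] by auto
  then have vw: "linform A (var v) v" "linform A (var w) w"
    by (auto intro: linform.var)
  show ?thesis
    unfolding pol_def hform_def
  proof (rule hom_add_grp_lincomb_cong[OF mring_to_sym(1)[OF A] S.is_group mring_to_sym(1)[OF A]])
    fix i assume "i \<in> {..d}"
    then show "mring_to_sym d A (p ^ i * q ^ (d - i)) = mring_to_sym d A (var v ^ i * var w ^ (d - i))"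
      using mring_to_sym_monomial[OF A assms] mring_to_sym_monomial[OF A vw] by simp
  qed
qed

text \<open>A homomorphism into a ring extends to monomials by multiplying the images of the
  entries, which is multilinear and symmetric. These evaluations are the means of telling elements
  of S^d(A) apart.\<close>

lemma sym_pow_eval:
  fixes \<phi> :: "'a \<Rightarrow> 'r::comm_ring_1"
  assumes "\<phi> \<in> hom A add_grp"
  obtains E where "E \<in> hom (Sym d A) add_grp"
    "\<And>a v w. v \<in> carrier A \<Longrightarrow> w \<in> carrier A \<Longrightarrow> E (pol d A a v w) = hform d a (\<phi> v) (\<phi> w)"
proof -
  have \<phi>: "\<phi> (x \<otimes>\<^bsub>A\<^esub> y) = \<phi> x + \<phi> y" if "x \<in> carrier A" "y \<in> carrier A" for x y
    using assms that by (auto simp: hom_def)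
  have 1: "prod_list (map \<phi> xs) \<in> carrier add_grp" for xs
    by simp
  have 2: "prod_list (map \<phi> (xs[i := a \<otimes>\<^bsub>A\<^esub> b]))
      = prod_list (map \<phi> (xs[i := a])) \<otimes>\<^bsub>add_grp\<^esub> prod_list (map \<phi> (xs[i := b]))"
    if "xs \<in> tuples d A" "i < d" "a \<in> carrier A" "b \<in> carrier A" for xs i a b
    using that unfolding tuples_def by (simp add: prod_list_update_mult \<phi> algebra_simps)
  have 3: "prod_list (map \<phi> (permute_list \<sigma> xs)) = prod_list (map \<phi> xs)"
    if "xs \<in> tuples d A" "\<sigma> permutes {..<d}" for xs \<sigma>
  proof -
    have "mset (map \<phi> (permute_list \<sigma> xs)) = mset (map \<phi> xs)"
      using that by (simp add: tuples_def)
    then show ?thesis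
      by (metis prod_mset_prod_list)
  qed
  obtain E where E: "E \<in> hom (Sym d A) add_grp"
    "\<And>xs. xs \<in> tuples d A \<Longrightarrow> E (symt d A xs) = prod_list (map \<phi> xs)"
    using sym_pow_universal[OF A comm_group_add_grp 1 2 3] by blast
  have "E (pol d A a v w) = hform d a (\<phi> v) (\<phi> w)" if vw: "v \<in> carrier A" "w \<in> carrier A" for a v w
  proof -
    have l: "linform A (var v) v" "linform A (var w) w"
      using vw by (auto intro: linform.var)
    have E': "E \<circ> mring_to_sym d A \<in> hom add_grp add_grp"
      by (rule hom_compose[OF mring_to_sym(1)[OF A] E(1)])
    have id: "(\<lambda>x. x) \<in> hom add_grp (add_grp :: 'r monoid)"
      by (simp add: hom_def)
    have "(E \<circ> mring_to_sym d A) (hform d a (var v) (var w)) = (\<lambda>x. x) (hform d a (\<phi> v) (\<phi> w))"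
      unfolding hform_def
    proof (rule hom_add_grp_lincomb_cong[OF E' comm_group_group[OF comm_group_add_grp] id])
      fix i assume i: "i \<in> {..d}"
      then have "replicate i v @ replicate (d - i) w \<in> tuples d A"
        using vw by (auto simp: tuples_def)
      then show "(E \<circ> mring_to_sym d A) (var v ^ i * var w ^ (d - i)) = \<phi> v ^ i * \<phi> w ^ (d - i)"
        using i mring_to_sym_monomial[OF A l] by (simp add: E(2))
    qed
    then show ?thesis
      by (simp add: pol_def)
  qed
  with E(1) show ?thesis by (rule that)
qed

text \<open>Every element of A is an integer combination of v and w, so a monomial expands to a
  binary form in them. The coefficients need not be unique.\<close>

lemma sym_pow_eq_pol:
  assumes gen: "carrier A = generate A {v, w}" and t: "t \<in> carrier (Sym d A)"
  shows "\<exists>a. t = pol d A a v w"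
proof -
  have v: "v \<in> carrier A" and w: "w \<in> carrier A"
    unfolding gen by (auto intro: generate.incl)
  define form where "form p \<longleftrightarrow> (\<exists>m n. p = of_int m * var v + of_int n * var w)" for p
  have formI: "form (of_int m * var v + of_int n * var w)" for m n
    unfolding form_def by blast
  have form0: "form 0" and formv: "form (var v)" and formw: "form (var w)"
    using formI[of 0 0] formI[of 1 0] formI[of 0 1] by simp_all
  have forma: "form (p + q)" if "form p" "form q" for p q
  proof -
    obtain m n m' n' where "p = of_int m * var v + of_int n * var w" "q = of_int m' * var v + of_int n' * var w"
      using \<open>form p\<close> \<open>form q\<close> unfolding form_def by blast
    then have "p + q = of_int (m + m') * var v + of_int (n + n') * var w"
      by (simp add: algebra_simps)
    then show ?thesis using formI by metis
  qed
  have formm: "form (- p)" if "form p" for p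
  proof -
    obtain m n where "p = of_int m * var v + of_int n * var w"
      using \<open>form p\<close> unfolding form_def by blast
    then have "- p = of_int (- m) * var v + of_int (- n) * var w"
      by (simp add: algebra_simps)
    then show ?thesis using formI by metis
  qed
  have lin: "\<exists>p. linform A p x \<and> form p" if "x \<in> generate A {v, w}" for x
    using that
  proof induction
    case one
    show ?case by (rule exI[of _ 0]) (intro conjI linform.zero form0)
  next
    case (incl h)
    then show ?case using formv formw v w linform.var by (metis insertE singletonD)
  next
    case (inv h)
    then show ?case using formm formv formw v w linform.var linform.minus by (metis insertE singletonD)
  next
    case (eng x y)
    then show ?case using forma linform.add by metis
  qed
  have sym: "\<exists>a. symt d A xs = pol d A a v w" if xs: "xs \<in> tuples d A" for xs
  proof -
    have "set xs \<subseteq> carrier A \<Longrightarrow> \<exists>ps. list_all2 (linform A) ps xs \<and> (\<forall>p\<in>set ps. form p)" for xs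
    proof (induction xs)
      case (Cons x xs)
      then obtain ps where "list_all2 (linform A) ps xs" "\<forall>p\<in>set ps. form p"
        by auto
      moreover obtain p where "linform A p x" "form p"
        using lin[of x] Cons.prems gen by auto
      ultimately show ?case
        by (intro exI[of _ "p # ps"]) simp
    qed simp
    then obtain ps where ps: "list_all2 (linform A) ps xs" "\<forall>p\<in>set ps. form p"
      using xs unfolding tuples_def by blast
    have len: "length xs = d"
      using xs by (simp add: tuples_def)
    have "\<exists>a. prod_list ps = hform (length ps) a (var v) (var w)"
      by (rule hform_prod_list) (use ps(2) in \<open>simp add: form_def\<close>)
    then obtain a where "prod_list ps = hform d a (var v) (var w)"
      using list_all2_lengthD[OF ps(1)] len by auto
    then show ?thesis
      using mring_to_sym_prod[OF A ps(1) len] by (metis pol_def)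
  qed
  have "t \<in> generate (Sym d A) (symt d A ` tuples d A)"
    using t sym_pow_generated[OF A] by blast
  then show ?thesis
  proof induction
    case one
    then show ?case using pol_zero by metis
  next
    case (incl h)
    then show ?case using sym by blast
  next
    case (inv h)
    then show ?case using sym pol_uminus by (metis imageE)
  next
    case (eng x y)
    then show ?case using pol_add by metis
  qed
qed

end

lemma sym_pow_ar_pol:
  assumes A: "comm_group A" and B: "comm_group B" and f: "f \<in> hom A B"
    and vw: "v \<in> carrier A" "w \<in> carrier A"
  shows "ar (sym_pow d) A B f (pol d A a v w) = pol d B a (f v) (f w)"
proof -
  interpret SB: comm_group "Sym d B" by (rule comm_group_sym_pow[OF B])
  have fvw: "f v \<in> carrier B" "f w \<in> carrier B"
    using f vw by (auto simp: hom_def)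
  note ar = sym_pow_ar[OF A B f, where d = d]
  have h: "ar (sym_pow d) A B f \<circ> mring_to_sym d A \<in> hom add_grp (Sym d B)"
    by (rule hom_compose[OF mring_to_sym(1)[OF A] morD[OF ar(1)]])
  have "(ar (sym_pow d) A B f \<circ> mring_to_sym d A) (hform d a (var v) (var w))
      = mring_to_sym d B (hform d a (var (f v)) (var (f w)))"
    unfolding hform_def
  proof (rule hom_add_grp_lincomb_cong[OF h SB.is_group mring_to_sym(1)[OF B]])
    fix i assume i: "i \<in> {..d}"
    then have "replicate i v @ replicate (d - i) w \<in> tuples d A"
      using vw by (auto simp: tuples_def)
    moreover have "mring_to_sym d A (var v ^ i * var w ^ (d - i)) = symt d A (replicate i v @ replicate (d - i) w)"
      using i vw by (intro mring_to_sym_monomial A) (auto intro: linform.var)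
    moreover have "mring_to_sym d B (var (f v) ^ i * var (f w) ^ (d - i))
        = symt d B (replicate i (f v) @ replicate (d - i) (f w))"
      using i fvw by (intro mring_to_sym_monomial B) (auto intro: linform.var)
    ultimately show "(ar (sym_pow d) A B f \<circ> mring_to_sym d A) (var v ^ i * var w ^ (d - i)) =
       mring_to_sym d B (var (f v) ^ i * var (f w) ^ (d - i))"
      by (simp add: ar(2))
  qed
  then show ?thesis
    by (simp add: pol_def)
qed

text \<open>The element c v^d; the second argument of \<open>pol\<close> enters only with exponent
  0.\<close>

definition pw :: "nat \<Rightarrow> 'a monoid \<Rightarrow> int \<Rightarrow> 'a \<Rightarrow> ('a list \<Rightarrow>\<^sub>0 int) set set" where
  "pw d A c v = pol d A (\<lambda>i. if i = d then c else 0) v v"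

lemma hform_pw: "hform d (\<lambda>i. if i = d then c else 0) X Y = of_int c * X ^ d"
proof -
  have "hform d (\<lambda>i. if i = d then c else 0) X Y = (\<Sum>i\<le>d. if i = d then of_int c * X ^ d else 0)"
    unfolding hform_def by (intro sum.cong) auto
  then show ?thesis by simp
qed

context choose_gcd
begin

text \<open>The element k ((v + w)^d - v^d - w^d) / g of S^d(A), where the division has been carried
  out on the coefficients.\<close>

definition cocyc :: "'a monoid \<Rightarrow> int \<Rightarrow> 'a \<Rightarrow> 'a \<Rightarrow> ('a list \<Rightarrow>\<^sub>0 int) set set" where
  "cocyc A k v w = pol d A (\<lambda>i. k * bcoef i) v w"

context
  fixes A :: "'a monoid"
  assumes A: "comm_group A"
begin

interpretation A: comm_group A by (fact A)
interpretation S: comm_group "Sym d A" by (rule comm_group_sym_pow[OF A])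

lemma cocyc_closed: "cocyc A k v w \<in> carrier (Sym d A)"
  unfolding cocyc_def by (rule pol_closed[OF A])

lemma pw_closed: "pw d A c v \<in> carrier (Sym d A)"
  unfolding pw_def by (rule pol_closed[OF A])

lemma cocyc_linform:
  assumes "linform A p v" "linform A q w"
  shows "cocyc A k v w = mring_to_sym d A (of_int k * hform d bcoef p q)"
  unfolding cocyc_def hform_scale[symmetric] by (rule mring_to_sym_hform[OF A assms, symmetric])

lemma cocyc_add: "cocyc A (k + l) v w = cocyc A k v w \<otimes>\<^bsub>Sym d A\<^esub> cocyc A l v w"
  unfolding cocyc_def distrib_right by (rule pol_add[OF A])

lemma cocyc_zero: "cocyc A 0 v w = \<one>\<^bsub>Sym d A\<^esub>"
  unfolding cocyc_def using pol_zero[OF A] by simp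

text \<open>All four terms are computed from the variables of v, w and u, where the polynomial
  identity is available.\<close>

lemma cocyc_assoc:
  assumes "v \<in> carrier A" "w \<in> carrier A" "u \<in> carrier A"
  shows "cocyc A k v w \<otimes>\<^bsub>Sym d A\<^esub> cocyc A k (v \<otimes>\<^bsub>A\<^esub> w) u
    = cocyc A k w u \<otimes>\<^bsub>Sym d A\<^esub> cocyc A k v (w \<otimes>\<^bsub>A\<^esub> u)"
proof -
  note l = linform.var[OF assms(1)] linform.var[OF assms(2)] linform.var[OF assms(3)]
  show ?thesis
    unfolding cocyc_linform[OF l(1) l(2)] cocyc_linform[OF l(2) l(3)]
      cocyc_linform[OF linform.add[OF l(1) l(2)] l(3)] cocyc_linform[OF l(1) linform.add[OF l(2) l(3)]]
    unfolding mring_to_sym_simps(1)[OF A, symmetric] distrib_left[symmetric] hform_bcoef_mring(1) ..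
qed

lemma cocyc_comm:
  assumes "v \<in> carrier A" "w \<in> carrier A"
  shows "cocyc A k v w = cocyc A k w v"
  using cocyc_linform[OF linform.var[OF assms(1)] linform.var[OF assms(2)]]
    cocyc_linform[OF linform.var[OF assms(2)] linform.var[OF assms(1)]]
    hform_bcoef_mring(2)[of "var v" "var w"] by simp

lemma cocyc_one:
  assumes "w \<in> carrier A"
  shows "cocyc A k \<one>\<^bsub>A\<^esub> w = \<one>\<^bsub>Sym d A\<^esub>"
  using cocyc_linform[OF linform.zero linform.var[OF assms]]
  by (simp add: hform_bcoef_mring(3) mring_to_sym_simps[OF A])

text \<open>The deviation of c x^d from additivity is c g times the cocycle polynomial, so the
  multiple k can matter only modulo g.\<close>

lemma pw_mult:
  assumes "v \<in> carrier A" "w \<in> carrier A"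
  shows "pw d A c (v \<otimes>\<^bsub>A\<^esub> w)
    = pw d A c v \<otimes>\<^bsub>Sym d A\<^esub> pw d A c w \<otimes>\<^bsub>Sym d A\<^esub> cocyc A (c * int g) v w"
proof -
  note l = linform.var[OF assms(1)] linform.var[OF assms(2)]
  have p: "pw d A c x = mring_to_sym d A (of_int c * p ^ d)" if "linform A p x" for p x
    unfolding pw_def mring_to_sym_hform[OF A that that, symmetric] hform_pw ..
  have "of_int c * (var v + var w) ^ d
      = of_int c * var v ^ d + of_int c * var w ^ d + of_int (c * int g) * hform d bcoef (var v) (var w)"
    unfolding of_int_mult mult.assoc hform_bcoef by (simp add: algebra_simps)
  then show ?thesis
    unfolding p[OF l(1)] p[OF l(2)] p[OF linform.add[OF l]] cocyc_linform[OF l]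
    by (simp only: mring_to_sym_simps[OF A])
qed

text \<open>The case of two equal generators: a binary form in v and v collapses to a multiple of
  v^d.\<close>

lemma sym_pow_eq_pw:
  assumes gen: "carrier A = generate A {v}" and t: "t \<in> carrier (Sym d A)"
  shows "\<exists>c. t = pw d A c v"
proof -
  obtain a where "t = pol d A a v v"
    using sym_pow_eq_pol[OF A _ t, of v v] gen by auto
  also have "\<dots> = mring_to_sym d A (of_int (\<Sum>i\<le>d. a i) * var v ^ d)"
    unfolding pol_def hform_def by (simp add: sum_distrib_right flip: power_add)
  finally show ?thesis
    by (metis hform_pw pol_def pw_def)
qed

end

lemma cocyc_nat:
  assumes "comm_group A" "comm_group B" "f \<in> hom A B" "v \<in> carrier A" "w \<in> carrier A"
  shows "ar (sym_pow d) A B f (cocyc A k v w) = cocyc B k (f v) (f w)"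
  unfolding cocyc_def by (rule sym_pow_ar_pol[OF assms])

lemma pw_nat:
  assumes "comm_group A" "comm_group B" "f \<in> hom A B" "v \<in> carrier A"
  shows "ar (sym_pow d) A B f (pw d A k v) = pw d B k (f v)"
  unfolding pw_def by (rule sym_pow_ar_pol[OF assms assms(4)])

end

section \<open>Free groups\<close>

text \<open>Serves to copy a group into another type along an injection: free groups into the type
  of objects, middle terms of extensions into the type prescribed in \<open>Ext1\<close>.\<close>

definition transp :: "('a \<Rightarrow> 'b) \<Rightarrow> 'a monoid \<Rightarrow> 'b monoid" where
  "transp f G = \<lparr>carrier = f ` carrier G,
     monoid.mult = (\<lambda>x y. f (inv_into (carrier G) f x \<otimes>\<^bsub>G\<^esub> inv_into (carrier G) f y)), one = f \<one>\<^bsub>G\<^esub>\<rparr>"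

lemma transp_simps [simp]: "carrier (transp f G) = f ` carrier G" "\<one>\<^bsub>transp f G\<^esub> = f \<one>\<^bsub>G\<^esub>"
  by (simp_all add: transp_def)

lemma transp_mult:
  "inj_on f (carrier G) \<Longrightarrow> x \<in> carrier G \<Longrightarrow> y \<in> carrier G \<Longrightarrow> f x \<otimes>\<^bsub>transp f G\<^esub> f y = f (x \<otimes>\<^bsub>G\<^esub> y)"
  by (simp add: transp_def)

lemma group_transp:
  assumes "group G" "inj_on f (carrier G)"
  shows "group (transp f G)"
proof -
  interpret group G by fact
  have "\<exists>y\<in>carrier G. f y \<otimes>\<^bsub>transp f G\<^esub> f x = f \<one>\<^bsub>G\<^esub>" if "x \<in> carrier G" for x
    using that assms by (intro bexI[of _ "inv\<^bsub>G\<^esub> x"]) (auto simp: transp_mult)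
  then show ?thesis
    using assms by (intro groupI) (auto simp: transp_mult m_assoc)
qed

lemma comm_group_transp:
  assumes "comm_group G" "inj_on f (carrier G)"
  shows "comm_group (transp f G)"
proof -
  interpret comm_group G by fact
  show ?thesis
    using assms by (intro group.group_comm_groupI group_transp) (auto simp: transp_mult m_comm is_group)
qed

lemma transp_iso: "inj_on f (carrier G) \<Longrightarrow> f \<in> iso G (transp f G)"
  by (auto simp: iso_def hom_def bij_betw_def transp_mult)

section \<open>Words and the universal property of a free basis\<close>

lemma word_val_Nil [simp]: "word_val G [] = \<one>\<^bsub>G\<^esub>"
  by (simp add: word_val_def)

lemma word_val_Cons [simp]:
  "word_val G ((b, s) # w) = (if s then b else inv\<^bsub>G\<^esub> b) \<otimes>\<^bsub>G\<^esub> word_val G w"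
  by (simp add: word_val_def)

context
  fixes G :: "'x monoid"
  assumes G: "group G"
begin

interpretation group G by (rule G)

lemma word_val_closed: "fst ` set w \<subseteq> carrier G \<Longrightarrow> word_val G w \<in> carrier G"
  by (induction w) (auto split: prod.splits)

lemma word_val_append:
  "fst ` set u \<subseteq> carrier G \<Longrightarrow> fst ` set v \<subseteq> carrier G \<Longrightarrow>
    word_val G (u @ v) = word_val G u \<otimes>\<^bsub>G\<^esub> word_val G v"
proof (induction u)
  case (Cons x u)
  then show ?case
    by (cases x) (auto simp: m_assoc word_val_closed)
qed (simp add: word_val_closed)

lemma word_val_inverse:
  "fst ` set w \<subseteq> carrier G \<Longrightarrow> word_val G (rev (map (apsnd Not) w)) = inv\<^bsub>G\<^esub> (word_val G w)"
proof (induction w)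
  case (Cons x w)
  obtain b s where x: "x = (b, s)" by force
  have w: "fst ` set (rev (map (apsnd Not) w)) \<subseteq> carrier G" and b: "b \<in> carrier G"
    using Cons.prems by (auto simp: x)
  have "fst ` set [(b, \<not> s)] \<subseteq> carrier G" using b by simp
  from word_val_append[OF w this] show ?case
    using Cons b by (auto simp: x inv_mult_group word_val_closed)
qed simp

lemma generate_eq_word_vals:
  assumes "B \<subseteq> carrier G"
  shows "generate G B = word_val G ` {w. fst ` set w \<subseteq> B}"
proof
  show "generate G B \<subseteq> word_val G ` {w. fst ` set w \<subseteq> B}"
  proof
    fix x assume "x \<in> generate G B"
    then show "x \<in> word_val G ` {w. fst ` set w \<subseteq> B}"
    proof induction
      case one
      then show ?case by (intro image_eqI[of _ _ "[]"]) auto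
    next
      case (incl h)
      then show ?case using assms by (intro image_eqI[of _ _ "[(h, True)]"]) auto
    next
      case (inv h)
      then show ?case using assms by (intro image_eqI[of _ _ "[(h, False)]"]) auto
    next
      case (eng x y)
      then obtain u v where "x = word_val G u" "y = word_val G v" "fst ` set u \<subseteq> B" "fst ` set v \<subseteq> B"
        by auto
      then show ?case
        using assms word_val_append[of u v] by (intro image_eqI[of _ _ "u @ v"]) auto
    qed
  qed
  have "word_val G w \<in> generate G B" if "fst ` set w \<subseteq> B" for w
    using that by (induction w) (auto intro!: generate.eng intro: generate.one generate.incl generate.inv split: prod.splits)
  then show "word_val G ` {w. fst ` set w \<subseteq> B} \<subseteq> generate G B" by blast
qed

lemma hom_eq_on_generate:
  assumes "group H" "\<phi> \<in> hom G H" "\<psi> \<in> hom G H" "B \<subseteq> carrier G" "\<And>b. b \<in> B \<Longrightarrow> \<phi> b = \<psi> b"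
    "x \<in> generate G B"
  shows "\<phi> x = \<psi> x"
  using assms(6)
proof induction
  interpret \<phi>: group_hom G H \<phi> using assms by (intro group_homI) auto
  interpret \<psi>: group_hom G H \<psi> using assms by (intro group_homI) auto
  {
    case one
    show ?case by simp
  next
    case (incl h)
    then show ?case using assms by simp
  next
    case (inv h)
    then show ?case using assms by auto
  next
    case (eng x y)
    then show ?case using generate_in_carrier[OF assms(4)] by simp
  }
qed

end

lemma not_successively_split: "\<not> successively P xs \<Longrightarrow> \<exists>u x y v. xs = u @ x # y # v \<and> \<not> P x y"
proof (induction P xs rule: successively.induct)
  case (3 P x y xs)
  show ?case
  proof (cases "P x y")
    case True
    then obtain u x' y' v where "y # xs = u @ x' # y' # v" "\<not> P x' y'"
      using 3 by auto
    then show ?thesis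
      by (intro exI[of _ "x # u"]) auto
  next
    case False
    then show ?thesis by (intro exI[of _ "[]"]) auto
  qed
qed auto

lemma fst_apsnd: "fst ` set (rev (map (apsnd f) w)) = fst ` set w"
  by (simp add: image_image)

lemma fst_apfst: "fst ` set (map (apfst h) w) = h ` fst ` set w"
  by (simp add: image_image)

context
  fixes G :: "'x monoid" and B :: "'x set" and H :: "'y monoid" and h :: "'x \<Rightarrow> 'y"
  assumes G: "group G" and B: "free_basis G B" and H: "group H" and h: "h ` B \<subseteq> carrier H"
begin

interpretation G: group G by (rule G)
interpretation H: group H by (rule H)

text \<open>A nonempty word with value 1 is not reduced, so it contains two adjacent inverse
  letters. Deleting them changes neither the value in G nor the value of the image in H, and the
  word gets shorter.\<close>

lemma free_basis_relation:
  assumes "fst ` set w \<subseteq> B" "word_val G w = \<one>\<^bsub>G\<^esub>"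
  shows "word_val H (map (apfst h) w) = \<one>\<^bsub>H\<^esub>"
  using assms
proof (induction "length w" arbitrary: w rule: less_induct)
  case less
  show ?case
  proof (cases "w = []")
    case False
    then have "\<not> reduced_word w"
      using B less.prems unfolding free_basis_def by blast
    then obtain u x y v where w: "w = u @ x # y # v"
        and "\<not> (case x of (a, s) \<Rightarrow> \<lambda>(b, t). \<not> (a = b \<and> s \<noteq> t)) y"
      unfolding reduced_word_def using not_successively_split by blast
    then obtain a s where x: "x = (a, s)" and y: "y = (a, \<not> s)"
      by (auto split: prod.splits)
    have BG: "B \<subseteq> carrier G"
      using B by (simp add: free_basis_def)
    have uv: "fst ` set u \<subseteq> B" "fst ` set v \<subseteq> B" "a \<in> B"
      using less.prems by (auto simp: w x)
    then have uvG: "fst ` set u \<subseteq> carrier G" "fst ` set v \<subseteq> carrier G" "a \<in> carrier G"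
      using BG by auto
    have uvH: "fst ` set (map (apfst h) u) \<subseteq> carrier H" "fst ` set (map (apfst h) v) \<subseteq> carrier H" "h a \<in> carrier H"
      using uv h unfolding fst_apfst by blast+
    have "word_val G (x # y # v) = word_val G v"
      using uvG word_val_closed[OF G uvG(2)] by (cases s) (simp_all add: x y flip: G.m_assoc)
    moreover have xyG: "fst ` set (x # y # v) \<subseteq> carrier G"
      using uvG by (auto simp: x y)
    ultimately have "word_val G (u @ v) = \<one>\<^bsub>G\<^esub>"
      using less.prems(2) word_val_append[OF G uvG(1,2)] word_val_append[OF G uvG(1) xyG] by (simp add: w)
    then have IH: "word_val H (map (apfst h) (u @ v)) = \<one>\<^bsub>H\<^esub>"
      using uv by (intro less.hyps) (auto simp: w)
    have "word_val H (map (apfst h) (x # y # v)) = word_val H (map (apfst h) v)"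
      using uvH word_val_closed[OF H uvH(2)] by (cases s) (simp_all add: x y flip: H.m_assoc)
    moreover have "fst ` set (map (apfst h) (x # y # v)) \<subseteq> carrier H"
      using uvH by (auto simp: x y)
    ultimately show ?thesis
      using IH word_val_append[OF H uvH(1,2)] word_val_append[OF H uvH(1)] by (simp add: w)
  qed simp
qed

text \<open>Two words u and v with the same value in G give the relation u v^(-1), which also holds
  in H by the previous lemma. Hence the value in H depends only on the element of G.\<close>

lemma free_basis_extend: "\<exists>\<phi>\<in>mor G H. \<forall>b\<in>B. \<phi> b = h b"
proof -
  have BG: "B \<subseteq> carrier G" and gen: "carrier G = word_val G ` {w. fst ` set w \<subseteq> B}"
    using B generate_eq_word_vals[OF G, of B] by (auto simp: free_basis_def)
  have clG: "fst ` set w \<subseteq> carrier G" if "fst ` set w \<subseteq> B" for w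
    using that BG by blast
  have clH: "fst ` set (map (apfst h) w) \<subseteq> carrier H" if "fst ` set w \<subseteq> B" for w
    using that h unfolding fst_apfst by blast
  have eq: "word_val H (map (apfst h) u) = word_val H (map (apfst h) v)"
    if uv: "fst ` set u \<subseteq> B" "fst ` set v \<subseteq> B" "word_val G u = word_val G v" for u v
  proof -
    let ?v = "rev (map (apsnd Not) v)"
    have v: "fst ` set ?v \<subseteq> B"
      using uv by auto
    have "word_val G (u @ ?v) = \<one>\<^bsub>G\<^esub>"
      using word_val_append[OF G clG[OF uv(1)] clG[OF v]] word_val_inverse[OF G clG[OF uv(2)]] uv
        word_val_closed[OF G clG[OF uv(2)]] by simp
    then have "word_val H (map (apfst h) (u @ ?v)) = \<one>\<^bsub>H\<^esub>"
      using uv v by (intro free_basis_relation) auto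
    moreover have "map (apfst h) (u @ ?v) = map (apfst h) u @ rev (map (apsnd Not) (map (apfst h) v))"
      by (simp add: rev_map)
    moreover have "fst ` set (rev (map (apsnd Not) (map (apfst h) v))) \<subseteq> carrier H"
      using clH[OF uv(2)] unfolding fst_apsnd .
    ultimately have "word_val H (map (apfst h) u) \<otimes>\<^bsub>H\<^esub> inv\<^bsub>H\<^esub> word_val H (map (apfst h) v) = \<one>\<^bsub>H\<^esub>"
      using uv clH by (metis word_val_append[OF H] word_val_inverse[OF H])
    then show ?thesis
      using uv clH word_val_closed[OF H] by (metis H.inv_closed H.inv_inv H.inv_equality)
  qed
  define \<phi> where "\<phi> = (\<lambda>x\<in>carrier G. word_val H (map (apfst h) (SOME w. fst ` set w \<subseteq> B \<and> word_val G w = x)))"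
  have \<phi>: "\<phi> (word_val G w) = word_val H (map (apfst h) w)" if w: "fst ` set w \<subseteq> B" for w
  proof -
    let ?v = "SOME v. fst ` set v \<subseteq> B \<and> word_val G v = word_val G w"
    have "fst ` set ?v \<subseteq> B \<and> word_val G ?v = word_val G w"
      by (rule someI[of _ w]) (use w in simp)
    then show ?thesis
      unfolding \<phi>_def using eq[of ?v w] w word_val_closed[OF G clG[OF w]] by simp
  qed
  have "\<phi> \<in> hom G H"
  proof (rule homI)
    show "\<phi> x \<in> carrier H" if "x \<in> carrier G" for x
      using that gen \<phi> word_val_closed[OF H clH] by auto
    show "\<phi> (x \<otimes>\<^bsub>G\<^esub> y) = \<phi> x \<otimes>\<^bsub>H\<^esub> \<phi> y" if "x \<in> carrier G" "y \<in> carrier G" for x y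
    proof -
      obtain u v where uv: "fst ` set u \<subseteq> B" "x = word_val G u" "fst ` set v \<subseteq> B" "y = word_val G v"
        using \<open>x \<in> carrier G\<close> \<open>y \<in> carrier G\<close> unfolding gen by blast
      have "\<phi> (word_val G (u @ v)) = word_val H (map (apfst h) (u @ v))"
        using uv by (intro \<phi>) auto
      then show ?thesis
        using uv \<phi> word_val_append[OF H clH clH] word_val_append[OF G clG clG] by simp
    qed
  qed
  moreover have "\<phi> b = h b" if "b \<in> B" for b
    using \<phi>[of "[(b, True)]"] that BG h by (simp add: subset_iff image_subset_iff)
  moreover have "\<phi> \<in> extensional (carrier G)"
    by (simp add: \<phi>_def)
  ultimately show ?thesis
    unfolding mor_def by blast
qed

end


section \<open>A free group of permutations of the reduced words\<close>

definition letter_step :: "'b \<times> bool \<Rightarrow> ('b \<times> bool) list \<Rightarrow> ('b \<times> bool) list" where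
  "letter_step c w = (if w \<noteq> [] \<and> hd w = apsnd Not c then tl w else c # w)"

definition reduced_words :: "'b set \<Rightarrow> ('b \<times> bool) list set" where
  "reduced_words K = {w. reduced_word w \<and> fst ` set w \<subseteq> K}"

lemma letter_step_closed:
  assumes "fst c \<in> K" "w \<in> reduced_words K"
  shows "letter_step c w \<in> reduced_words K"
  using assms by (cases w; cases c)
    (auto simp: letter_step_def reduced_words_def reduced_word_def successively_Cons split: prod.splits)

lemma letter_step_inverse:
  assumes "w \<in> reduced_words K"
  shows "letter_step c (letter_step (apsnd Not c) w) = w"
proof (cases w)
  case Nil
  then show ?thesis by (cases c) (simp add: letter_step_def)
next
  case (Cons x v)
  show ?thesis
    using assms Cons by (cases c; cases x; cases v)
      (auto simp: letter_step_def reduced_words_def reduced_word_def split: prod.splits)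
qed

lemma letter_step_reduced:
  assumes "c # w \<in> reduced_words K"
  shows "letter_step c w = c # w"
  using assms by (cases w; cases c)
    (auto simp: letter_step_def reduced_words_def reduced_word_def successively_Cons split: prod.splits)

text \<open>The free group is realised by permutations of the reduced words: a letter acts by left
  multiplication, and a reduced word sends the empty word to itself.\<close>

definition letter_perm :: "'b set \<Rightarrow> 'b \<times> bool \<Rightarrow> ('b \<times> bool) list \<Rightarrow> ('b \<times> bool) list" where
  "letter_perm K c = restrict (letter_step c) (reduced_words K)"

lemma letter_perm_Bij:
  assumes "fst c \<in> K"
  shows "letter_perm K c \<in> Bij (reduced_words K)"
proof -
  obtain a s where c: "c = (a, s)" by force
  note inv = letter_step_inverse[of _ K "(a, s)"] letter_step_inverse[of _ K "(a, \<not> s)"]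
  note cl = letter_step_closed[of "(a, s)" K] letter_step_closed[of "(a, \<not> s)" K]
  have "bij_betw (letter_step c) (reduced_words K) (reduced_words K)"
    by (rule bij_betw_byWitness[where f' = "letter_step (a, \<not> s)"])
      (use assms inv cl in \<open>auto simp: c\<close>)
  then show ?thesis
    by (simp add: Bij_def letter_perm_def cong: bij_betw_cong)
qed

lemma inv_letter_perm:
  assumes "a \<in> K"
  shows "inv\<^bsub>BijGroup (reduced_words K)\<^esub> letter_perm K (a, s) = letter_perm K (a, \<not> s)"
proof (rule group.inv_equality[OF group_BijGroup])
  let ?W = "reduced_words K"
  have c: "letter_perm K (a, s) \<in> Bij ?W" "letter_perm K (a, \<not> s) \<in> Bij ?W"
    using assms by (auto intro!: letter_perm_Bij)
  then show "letter_perm K (a, s) \<in> carrier (BijGroup ?W)" "letter_perm K (a, \<not> s) \<in> carrier (BijGroup ?W)"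
    by (simp_all add: BijGroup_def)
  have "compose ?W (letter_perm K (a, \<not> s)) (letter_perm K (a, s)) = (\<lambda>x\<in>?W. x)"
    using assms letter_step_inverse[of _ K "(a, \<not> s)"] letter_step_closed[of "(a, s)" K]
    by (auto simp: compose_def letter_perm_def fun_eq_iff)
  then show "letter_perm K (a, \<not> s) \<otimes>\<^bsub>BijGroup ?W\<^esub> letter_perm K (a, s) = \<one>\<^bsub>BijGroup ?W\<^esub>"
    using c by (simp add: BijGroup_def)
qed

lemma BijGroup_mult_apply:
  "g \<in> Bij S \<Longrightarrow> f \<in> Bij S \<Longrightarrow> x \<in> S \<Longrightarrow> (g \<otimes>\<^bsub>BijGroup S\<^esub> f) x = g (f x)"
  by (simp add: BijGroup_def compose_eq)

text \<open>A reduced word acts on the empty word letter by letter without cancellation. It can thus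
  be recovered from its value, and this is freeness.\<close>

lemma word_val_letter_perm:
  assumes "w \<in> reduced_words K"
  shows "word_val (BijGroup (reduced_words K)) (map (apfst (\<lambda>a. letter_perm K (a, True))) w) [] = w"
  using assms
proof (induction w)
  case Nil
  then show ?case by (simp add: BijGroup_def)
next
  case (Cons c w)
  let ?P = "BijGroup (reduced_words K)" and ?\<beta> = "\<lambda>a. letter_perm K (a, True)"
  obtain a s where c: "c = (a, s)" by force
  have w: "w \<in> reduced_words K" and a: "a \<in> K"
    using Cons.prems by (auto simp: c reduced_words_def reduced_word_def successively_Cons)
  have "fst ` set (map (apfst ?\<beta>) w) \<subseteq> carrier ?P"
    using w letter_perm_Bij[of "(_, True)" K] unfolding fst_apfst by (auto simp: reduced_words_def BijGroup_def)
  then have v: "word_val ?P (map (apfst ?\<beta>) w) \<in> Bij (reduced_words K)"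
    using word_val_closed[OF group_BijGroup] unfolding BijGroup_def partial_object.simps by blast
  have e: "[] \<in> reduced_words K"
    by (simp add: reduced_words_def reduced_word_def)
  have "(if s then ?\<beta> a else inv\<^bsub>?P\<^esub> ?\<beta> a) = letter_perm K c"
    using inv_letter_perm[of a K True] a by (simp add: c)
  then have "word_val ?P (map (apfst ?\<beta>) (c # w)) []
      = (letter_perm K c \<otimes>\<^bsub>?P\<^esub> word_val ?P (map (apfst ?\<beta>) w)) []"
    by (simp add: c)
  also have "\<dots> = letter_perm K c (word_val ?P (map (apfst ?\<beta>) w) [])"
    using a by (intro BijGroup_mult_apply letter_perm_Bij v e) (simp add: c)
  also have "\<dots> = c # w"
    unfolding Cons.IH[OF w] using w letter_step_reduced[OF Cons.prems] by (simp add: letter_perm_def)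
  finally show ?case .
qed


lemma ex_inj_on_countable:
  fixes A :: "'a set"
  assumes "countable A" "infinite (UNIV :: 'x set)"
  shows "\<exists>f :: 'a \<Rightarrow> 'x. inj_on f A"
proof -
  obtain u :: "nat \<Rightarrow> 'x" where "inj u"
    using assms(2) infinite_countable_subset by blast
  then have "inj_on (u \<circ> to_nat_on A) A"
    using assms(1) by (intro comp_inj_on inj_on_to_nat_on) (auto intro: inj_on_subset)
  then show ?thesis by blast
qed

text \<open>The letters generate a countable group of permutations, which is copied into the given
  infinite type. The indices are natural numbers, so that free generators can be called 0, 1,
  2.\<close>

lemma ex_free_basis:
  assumes "infinite (UNIV :: 'x set)" "finite K"
  shows "\<exists>(G :: 'x monoid) (b :: nat \<Rightarrow> 'x). G \<in> gr \<and> inj_on b K \<and> free_basis G (b ` K)"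
proof -
  let ?P = "BijGroup (reduced_words K)" and ?\<beta> = "\<lambda>a. letter_perm K (a, True)"
  interpret P: group ?P by (rule group_BijGroup)
  define H where "H = generate ?P (?\<beta> ` K)"
  let ?G = "?P\<lparr>carrier := H\<rparr>"
  have \<beta>K: "?\<beta> ` K \<subseteq> carrier ?P"
    using letter_perm_Bij[of "(_, True)" K] by (auto simp: BijGroup_def)
  have H: "subgroup H ?P"
    unfolding H_def by (rule P.generate_is_subgroup[OF \<beta>K])
  have G: "group ?G"
    by (rule subgroup.subgroup_is_group[OF H P.is_group])
  interpret G: group ?G by (rule G)
  have \<beta>H: "?\<beta> ` K \<subseteq> H"
    unfolding H_def by (auto intro: generate.incl)
  have genG: "generate ?G (?\<beta> ` K) = H"
    using P.generate_consistent[OF \<beta>H H] by (simp add: H_def)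
  have wv: "word_val ?G w = word_val ?P w" if "fst ` set w \<subseteq> ?\<beta> ` K" for w
    using that
  proof (induction w)
    case (Cons x w)
    then have "fst x \<in> H" using \<beta>H by auto
    then show ?case
      using Cons P.m_inv_consistent[OF H] by (cases x) auto
  qed simp
  have e: "[] \<in> reduced_words K"
    by (simp add: reduced_words_def reduced_word_def)
  have "inj_on ?\<beta> K"
  proof (rule inj_onI)
    fix a a' assume "?\<beta> a = ?\<beta> a'"
    then have "?\<beta> a [] = ?\<beta> a' []" by simp
    then show "a = a'"
      using e by (simp add: letter_perm_def letter_step_def)
  qed
  have "countable H"
    unfolding H_def using assms(2) by (intro countable_generate) (simp add: countable_finite)
  then obtain f :: "_ \<Rightarrow> 'x" where f: "inj_on f H"
    using ex_inj_on_countable[OF _ assms(1)] by blast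
  let ?T = "transp f ?G" and ?b = "\<lambda>a. f (?\<beta> a)"
  have T: "group ?T"
    using f by (intro group_transp G) simp
  have fhom: "f \<in> hom ?G ?T"
    using transp_iso[of f ?G] f by (simp add: iso_def)
  interpret f: group_hom ?G ?T f
    by (rule group_homI[OF G T fhom])
  have bK: "?b ` K = f ` ?\<beta> ` K"
    by (simp add: image_image)
  have gen: "generate ?T (?b ` K) = carrier ?T"
    unfolding bK using f.generate_img[of "?\<beta> ` K"] \<beta>H genG by simp
  have wvT: "word_val ?T (map (apfst ?b) w) = f (word_val ?P (map (apfst ?\<beta>) w))" if "fst ` set w \<subseteq> K" for w
    using that
  proof (induction w)
    case (Cons x w)
    obtain a s where x: "x = (a, s)" by force
    have a: "?\<beta> a \<in> carrier ?G"
      using Cons.prems \<beta>H by (auto simp: x)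
    have w: "fst ` set (map (apfst ?\<beta>) w) \<subseteq> ?\<beta> ` K"
      using Cons.prems unfolding fst_apfst by auto
    have wc: "word_val ?G (map (apfst ?\<beta>) w) \<in> carrier ?G"
      using w \<beta>H by (intro word_val_closed[OF G]) auto
    have xw: "fst ` set (map (apfst ?\<beta>) (x # w)) \<subseteq> ?\<beta> ` K"
      using Cons.prems unfolding fst_apfst by auto
    have "f (word_val ?G (map (apfst ?\<beta>) (x # w)))
        = (if s then ?b a else inv\<^bsub>?T\<^esub> ?b a) \<otimes>\<^bsub>?T\<^esub> f (word_val ?G (map (apfst ?\<beta>) w))"
      using f.hom_mult[OF a wc] f.hom_mult[OF G.inv_closed[OF a] wc] f.hom_inv[OF a] by (simp add: x)
    moreover have "word_val ?T (map (apfst ?b) (x # w))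
        = (if s then ?b a else inv\<^bsub>?T\<^esub> ?b a) \<otimes>\<^bsub>?T\<^esub> f (word_val ?G (map (apfst ?\<beta>) w))"
      using Cons unfolding wv[OF w] by (simp add: x)
    ultimately show ?case
      unfolding wv[OF xw] by simp
  qed simp
  have "word_val ?T w \<noteq> \<one>\<^bsub>?T\<^esub>" if w: "w \<noteq> []" "fst ` set w \<subseteq> ?b ` K" "reduced_word w" for w
  proof -
    \<comment> \<open>A word in the basis of the copy is pulled back to a word over K, which is
      again reduced.\<close>
    let ?i = "inv_into K ?b"
    have "apfst ?b (apfst ?i c) = c" if "c \<in> set w" for c
      using w(2) that f_inv_into_f[of "fst c" ?b K] by (cases c) auto
    then have "map (apfst ?b \<circ> apfst ?i) w = w"
      by (intro map_idI) simp
    moreover have "fst ` set (map (apfst ?i) w) \<subseteq> K"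
      unfolding fst_apfst using w(2) inv_into_into[of _ ?b K] by blast
    ultimately obtain v where wv': "w = map (apfst ?b) v" and vK: "fst ` set v \<subseteq> K"
      by (metis map_map)
    have "reduced_word v"
      using w(3) unfolding wv' reduced_word_def successively_map
      by (rule successively_mono) (auto split: prod.splits)
    then have v: "v \<in> reduced_words K"
      using vK by (simp add: reduced_words_def)
    show ?thesis
    proof
      assume "word_val ?T w = \<one>\<^bsub>?T\<^esub>"
      then have eq: "f (word_val ?P (map (apfst ?\<beta>) v)) = f \<one>\<^bsub>?P\<^esub>"
        using wvT[OF vK] by (simp add: wv')
      have sub: "fst ` set (map (apfst ?\<beta>) v) \<subseteq> ?\<beta> ` K"
        using vK unfolding fst_apfst by blast
      then have "fst ` set (map (apfst ?\<beta>) v) \<subseteq> carrier ?G"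
        using \<beta>H by simp
      then have "word_val ?P (map (apfst ?\<beta>) v) \<in> H"
        using word_val_closed[OF G] wv[OF sub] by fastforce
      then have "word_val ?P (map (apfst ?\<beta>) v) = \<one>\<^bsub>?P\<^esub>"
        using f eq subgroup.one_closed[OF H] by (simp only: inj_on_eq_iff)
      \<comment> \<open>Both permutations are evaluated at the empty word.\<close>
      then have "v = \<one>\<^bsub>?P\<^esub> []"
        using word_val_letter_perm[OF v] by simp
      then show False
        using w(1) e by (simp add: BijGroup_def wv')
    qed
  qed
  then have fb: "free_basis ?T (?b ` K)"
    using \<beta>H gen by (auto simp: free_basis_def)
  moreover have "inj_on ?b K"
    using comp_inj_on[OF \<open>inj_on ?\<beta> K\<close> inj_on_subset[OF f \<beta>H]] by (simp add: o_def)
  moreover have "?T \<in> gr"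
    using T gen fb assms(2) \<beta>H unfolding gr_def
    by (auto intro!: exI[of _ "?b ` K"])
  ultimately show ?thesis
    by (intro exI[of _ ?T] exI[of _ ?b] conjI)
qed

section \<open>Functors and extensions\<close>

lemma ab_functorD:
  assumes "ab_functor C F" "G \<in> C"
  shows "comm_group (ob F G)" "group (ob F G)"
    and "H \<in> C \<Longrightarrow> f \<in> mor G H \<Longrightarrow> ar F G H f \<in> mor (ob F G) (ob F H)"
    and "x \<in> carrier (ob F G) \<Longrightarrow> ar F G G (\<lambda>x\<in>carrier G. x) x = x"
    and "H \<in> C \<Longrightarrow> K \<in> C \<Longrightarrow> f \<in> mor G H \<Longrightarrow> h \<in> mor H K \<Longrightarrow> x \<in> carrier (ob F G) \<Longrightarrow>
      ar F G K (compose (carrier G) h f) x = ar F H K h (ar F G H f x)"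
  using assms by (auto simp: ab_functor_def comm_group_def compose_eq)

text \<open>Arrows are extensional functions, so the functor laws need to be checked only at
  elements.\<close>

lemma ab_functorI:
  assumes "\<And>G. G \<in> C \<Longrightarrow> comm_group (ob F G)"
    and "\<And>G H f. G \<in> C \<Longrightarrow> H \<in> C \<Longrightarrow> f \<in> mor G H \<Longrightarrow> ar F G H f \<in> mor (ob F G) (ob F H)"
    and "\<And>G. G \<in> C \<Longrightarrow> group G"
    and "\<And>G x. G \<in> C \<Longrightarrow> x \<in> carrier (ob F G) \<Longrightarrow> ar F G G (\<lambda>x\<in>carrier G. x) x = x"
    and "\<And>G H K f h x. G \<in> C \<Longrightarrow> H \<in> C \<Longrightarrow> K \<in> C \<Longrightarrow> f \<in> mor G H \<Longrightarrow> h \<in> mor H K \<Longrightarrow>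
      x \<in> carrier (ob F G) \<Longrightarrow> ar F G K (compose (carrier G) h f) x = ar F H K h (ar F G H f x)"
  shows "ab_functor C F"
  unfolding ab_functor_def
proof (intro conjI ballI)
  fix G assume G: "G \<in> C"
  show "ar F G G (\<lambda>x\<in>carrier G. x) = (\<lambda>x\<in>carrier (ob F G). x)"
  proof (rule extensionalityI[of _ "carrier (ob F G)"])
    have "(\<lambda>x\<in>carrier G. x) \<in> mor G G"
      using assms(3)[OF G] by (auto simp: mor_def hom_def group.is_monoid monoid.m_closed)
    then show "ar F G G (\<lambda>x\<in>carrier G. x) \<in> extensional (carrier (ob F G))"
      using assms(2)[OF G G] by (simp add: mor_def)
  qed (use assms(4)[OF G] in auto)
next
  fix G H K f h assume *: "G \<in> C" "H \<in> C" "K \<in> C" "f \<in> mor G H" "h \<in> mor H K"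
  show "ar F G K (compose (carrier G) h f) = compose (carrier (ob F G)) (ar F H K h) (ar F G H f)"
  proof (rule extensionalityI[of _ "carrier (ob F G)"])
    have "compose (carrier G) h f \<in> mor G K"
      using group.hom_compose[OF assms(3)[OF *(1)] morD[OF *(4)] morD[OF *(5)]] by (simp add: mor_def)
    then show "ar F G K (compose (carrier G) h f) \<in> extensional (carrier (ob F G))"
      using assms(2)[OF *(1,3)] by (simp add: mor_def)
  qed (use assms(5)[OF *] in \<open>auto simp: compose_eq\<close>)
qed (use assms in auto)

lemma nat_transD:
  assumes "nat_trans C F F' \<eta>" "G \<in> C"
  shows "\<eta> G \<in> mor (ob F G) (ob F' G)"
    and "H \<in> C \<Longrightarrow> f \<in> mor G H \<Longrightarrow> x \<in> carrier (ob F G) \<Longrightarrow>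
      \<eta> H (ar F G H f x) = ar F' G H f (\<eta> G x)"
proof -
  show "\<eta> G \<in> mor (ob F G) (ob F' G)"
    using assms by (simp add: nat_trans_def)
  assume "H \<in> C" "f \<in> mor G H" and x: "x \<in> carrier (ob F G)"
  then have "compose (carrier (ob F G)) (\<eta> H) (ar F G H f) =
        compose (carrier (ob F G)) (ar F' G H f) (\<eta> G)"
    using assms by (simp add: nat_trans_def)
  then show "\<eta> H (ar F G H f x) = ar F' G H f (\<eta> G x)"
    using x by (metis compose_eq)
qed

lemma nat_transI:
  assumes "\<And>G. G \<in> C \<Longrightarrow> \<eta> G \<in> mor (ob F G) (ob F' G)"
    and "\<And>G H f x. G \<in> C \<Longrightarrow> H \<in> C \<Longrightarrow> f \<in> mor G H \<Longrightarrow> x \<in> carrier (ob F G) \<Longrightarrow>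
      \<eta> H (ar F G H f x) = ar F' G H f (\<eta> G x)"
  shows "nat_trans C F F' \<eta>"
  using assms by (auto simp: nat_trans_def compose_def fun_eq_iff)

lemma is_extnD:
  assumes "is_extn C Q F X" "G \<in> C"
  shows "comm_group (ob (mid X) G)"
    and "incl X G \<in> mor (ob F G) (ob (mid X) G)"
    and "inj_on (incl X G) (carrier (ob F G))"
    and "proj X G \<in> mor (ob (mid X) G) (ob Q G)"
    and "proj X G ` carrier (ob (mid X) G) = carrier (ob Q G)"
    and "a \<in> carrier (ob F G) \<Longrightarrow> proj X G (incl X G a) = \<one>\<^bsub>ob Q G\<^esub>"
    and "x \<in> carrier (ob (mid X) G) \<Longrightarrow> proj X G x = \<one>\<^bsub>ob Q G\<^esub> \<Longrightarrow> \<exists>a\<in>carrier (ob F G). x = incl X G a"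
    and "H \<in> C \<Longrightarrow> f \<in> mor G H \<Longrightarrow> ar (mid X) G H f \<in> mor (ob (mid X) G) (ob (mid X) H)"
    and "H \<in> C \<Longrightarrow> f \<in> mor G H \<Longrightarrow> a \<in> carrier (ob F G) \<Longrightarrow>
      ar (mid X) G H f (incl X G a) = incl X H (ar F G H f a)"
    and "H \<in> C \<Longrightarrow> f \<in> mor G H \<Longrightarrow> x \<in> carrier (ob (mid X) G) \<Longrightarrow>
      proj X H (ar (mid X) G H f x) = ar Q G H f (proj X G x)"
proof -
  have n: "ab_functor C (mid X)" "nat_trans C F (mid X) (incl X)" "nat_trans C (mid X) Q (proj X)"
    and k: "incl X G \<in> mon (ob F G) (ob (mid X) G)"
      "incl X G ` carrier (ob F G) = kernel (ob (mid X) G) (ob Q G) (proj X G)"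
      "proj X G \<in> epi (ob (mid X) G) (ob Q G)"
    using assms by (auto simp: is_extn_def)
  show "comm_group (ob (mid X) G)"
    and "incl X G \<in> mor (ob F G) (ob (mid X) G)"
    and "proj X G \<in> mor (ob (mid X) G) (ob Q G)"
    and "H \<in> C \<Longrightarrow> f \<in> mor G H \<Longrightarrow> ar (mid X) G H f \<in> mor (ob (mid X) G) (ob (mid X) H)"
    and "H \<in> C \<Longrightarrow> f \<in> mor G H \<Longrightarrow> a \<in> carrier (ob F G) \<Longrightarrow>
      ar (mid X) G H f (incl X G a) = incl X H (ar F G H f a)"
    and "H \<in> C \<Longrightarrow> f \<in> mor G H \<Longrightarrow> x \<in> carrier (ob (mid X) G) \<Longrightarrow>
      proj X H (ar (mid X) G H f x) = ar Q G H f (proj X G x)"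
    using n assms(2) by (auto simp: ab_functorD nat_transD)
  show "inj_on (incl X G) (carrier (ob F G))" "proj X G ` carrier (ob (mid X) G) = carrier (ob Q G)"
    using k by (auto simp: mon_def epi_def)
  show "a \<in> carrier (ob F G) \<Longrightarrow> proj X G (incl X G a) = \<one>\<^bsub>ob Q G\<^esub>"
    "x \<in> carrier (ob (mid X) G) \<Longrightarrow> proj X G x = \<one>\<^bsub>ob Q G\<^esub> \<Longrightarrow> \<exists>a\<in>carrier (ob F G). x = incl X G a"
    using k(2) by (auto simp: kernel_def set_eq_iff image_iff)
qed

section \<open>Equivalence of extensions\<close>

lemma iso_compose:
  assumes "group G" "h \<in> iso G H" "i \<in> iso H K"
  shows "compose (carrier G) i h \<in> iso G K"
  using assms group.hom_compose[of G h H i K] bij_betw_compose[of h "carrier G" "carrier H" i "carrier K"]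
  by (simp add: iso_def)

lemma extn_equivD:
  assumes "extn_equiv C Q F X Y"
  obtains \<eta> where "nat_trans C (mid X) (mid Y) \<eta>" "\<And>G. G \<in> C \<Longrightarrow> \<eta> G \<in> iso (ob (mid X) G) (ob (mid Y) G)"
    "\<And>G a. G \<in> C \<Longrightarrow> a \<in> carrier (ob F G) \<Longrightarrow> \<eta> G (incl X G a) = incl Y G a"
    "\<And>G x. G \<in> C \<Longrightarrow> x \<in> carrier (ob (mid X) G) \<Longrightarrow> proj Y G (\<eta> G x) = proj X G x"
  using assms unfolding extn_equiv_def by blast

lemma extn_equiv_refl:
  assumes "is_extn C Q F X" shows "extn_equiv C Q F X X"
  unfolding extn_equiv_def
proof (intro exI conjI ballI)
  let ?\<eta> = "\<lambda>G. \<lambda>x\<in>carrier (ob (mid X) G). x"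
  note X = is_extnD[OF assms]
  show "nat_trans C (mid X) (mid X) ?\<eta>"
  proof (rule nat_transI)
    show "?\<eta> G \<in> mor (ob (mid X) G) (ob (mid X) G)" if "G \<in> C" for G
      using comm_group_group[OF X(1)[OF that]] by (auto simp: mor_def hom_def group.is_monoid monoid.m_closed)
  qed (use mor_closed[OF X(8)] in auto)
  fix G assume G: "G \<in> C"
  show "?\<eta> G \<in> iso (ob (mid X) G) (ob (mid X) G)"
    using comm_group_group[OF X(1)[OF G]]
    by (auto simp: iso_def hom_def group.is_monoid monoid.m_closed bij_betw_def inj_on_def)
  show "?\<eta> G (incl X G a) = incl X G a" if "a \<in> carrier (ob F G)" for a
    using mor_closed[OF X(2)[OF G] that] by simp
qed simp

lemma extn_equiv_trans:
  assumes XY: "extn_equiv C Q F X Y" and YZ: "extn_equiv C Q F Y Z" and X: "is_extn C Q F X"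
  shows "extn_equiv C Q F X Z"
proof -
  obtain \<eta> where e: "nat_trans C (mid X) (mid Y) \<eta>" "\<And>G. G \<in> C \<Longrightarrow> \<eta> G \<in> iso (ob (mid X) G) (ob (mid Y) G)"
    "\<And>G a. G \<in> C \<Longrightarrow> a \<in> carrier (ob F G) \<Longrightarrow> \<eta> G (incl X G a) = incl Y G a"
    "\<And>G x. G \<in> C \<Longrightarrow> x \<in> carrier (ob (mid X) G) \<Longrightarrow> proj Y G (\<eta> G x) = proj X G x"
    by (rule extn_equivD[OF XY]) blast
  obtain \<theta> where t: "nat_trans C (mid Y) (mid Z) \<theta>" "\<And>G. G \<in> C \<Longrightarrow> \<theta> G \<in> iso (ob (mid Y) G) (ob (mid Z) G)"
    "\<And>G a. G \<in> C \<Longrightarrow> a \<in> carrier (ob F G) \<Longrightarrow> \<theta> G (incl Y G a) = incl Z G a"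
    "\<And>G x. G \<in> C \<Longrightarrow> x \<in> carrier (ob (mid Y) G) \<Longrightarrow> proj Z G (\<theta> G x) = proj Y G x"
    by (rule extn_equivD[OF YZ]) blast
  let ?\<eta> = "\<lambda>G. compose (carrier (ob (mid X) G)) (\<theta> G) (\<eta> G)"
  note X = is_extnD[OF X]
  show ?thesis
    unfolding extn_equiv_def
  proof (intro exI conjI ballI)
    show "nat_trans C (mid X) (mid Z) ?\<eta>"
    proof (rule nat_transI)
      show "?\<eta> G \<in> mor (ob (mid X) G) (ob (mid Z) G)" if G: "G \<in> C" for G
        using group.hom_compose[OF comm_group_group[OF X(1)[OF G]] morD[OF nat_transD(1)[OF e(1) G]] morD[OF nat_transD(1)[OF t(1) G]]]
        by (simp add: mor_def)
      show "?\<eta> H (ar (mid X) G H f x) = ar (mid Z) G H f (?\<eta> G x)"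
        if "G \<in> C" "H \<in> C" "f \<in> mor G H" "x \<in> carrier (ob (mid X) G)" for G H f x
        using that mor_closed[OF X(8)[OF that(1-3)] that(4)] nat_transD(2)[OF e(1)] nat_transD(2)[OF t(1)]
          mor_closed[OF nat_transD(1)[OF e(1)]] by (simp add: compose_eq)
    qed
    fix G assume G: "G \<in> C"
    show "?\<eta> G \<in> iso (ob (mid X) G) (ob (mid Z) G)"
      by (rule iso_compose[OF comm_group_group[OF X(1)[OF G]] e(2)[OF G] t(2)[OF G]])
    show "?\<eta> G (incl X G a) = incl Z G a" if "a \<in> carrier (ob F G)" for a
      using that G e(3) t(3) mor_closed[OF X(2)[OF G] that] by (simp add: compose_eq)
    show "proj Z G (?\<eta> G x) = proj X G x" if "x \<in> carrier (ob (mid X) G)" for x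
      using that G e(4) t(4) mor_closed[OF nat_transD(1)[OF e(1)]] by (simp add: compose_eq)
  qed
qed

text \<open>Only X and Y are assumed to be extensions: in the applications Z is a Baer sum or the
  split extension, for which \<open>is_extn\<close> is never established. Inverting the equivalence
  with Z objectwise is again natural.\<close>

lemma extn_equiv_cancel_right:
  assumes XZ: "extn_equiv C Q F X Z" and YZ: "extn_equiv C Q F Y Z" and X: "is_extn C Q F X" and Y: "is_extn C Q F Y"
  shows "extn_equiv C Q F X Y"
proof -
  obtain \<eta> where e: "nat_trans C (mid X) (mid Z) \<eta>" "\<And>G. G \<in> C \<Longrightarrow> \<eta> G \<in> iso (ob (mid X) G) (ob (mid Z) G)"
    "\<And>G a. G \<in> C \<Longrightarrow> a \<in> carrier (ob F G) \<Longrightarrow> \<eta> G (incl X G a) = incl Z G a"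
    "\<And>G x. G \<in> C \<Longrightarrow> x \<in> carrier (ob (mid X) G) \<Longrightarrow> proj Z G (\<eta> G x) = proj X G x"
    by (rule extn_equivD[OF XZ]) blast
  obtain \<theta> where t: "nat_trans C (mid Y) (mid Z) \<theta>" "\<And>G. G \<in> C \<Longrightarrow> \<theta> G \<in> iso (ob (mid Y) G) (ob (mid Z) G)"
    "\<And>G a. G \<in> C \<Longrightarrow> a \<in> carrier (ob F G) \<Longrightarrow> \<theta> G (incl Y G a) = incl Z G a"
    "\<And>G x. G \<in> C \<Longrightarrow> x \<in> carrier (ob (mid Y) G) \<Longrightarrow> proj Z G (\<theta> G x) = proj Y G x"
    by (rule extn_equivD[OF YZ]) blast
  let ?i = "\<lambda>G. inv_into (carrier (ob (mid Y) G)) (\<theta> G)"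
  let ?\<eta> = "\<lambda>G. compose (carrier (ob (mid X) G)) (?i G) (\<eta> G)"
  note X = is_extnD[OF X] and Y = is_extnD[OF Y]
  have bij: "bij_betw (\<theta> G) (carrier (ob (mid Y) G)) (carrier (ob (mid Z) G))" if "G \<in> C" for G
    using t(2)[OF that] by (simp add: iso_def)
  have i: "?i G \<in> iso (ob (mid Z) G) (ob (mid Y) G)" if "G \<in> C" for G
    using group.iso_set_sym[OF comm_group_group[OF Y(1)[OF that]] t(2)[OF that]] .
  have i1: "?i G (\<theta> G y) = y" if "G \<in> C" "y \<in> carrier (ob (mid Y) G)" for G y
    using bij[OF that(1)] that(2) by (simp add: bij_betw_def)
  have i2: "?i G z \<in> carrier (ob (mid Y) G) \<and> \<theta> G (?i G z) = z" if "G \<in> C" "z \<in> carrier (ob (mid Z) G)" for G z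
    using bij[OF that(1)] that(2) by (metis bij_betw_def f_inv_into_f inv_into_into)
  have ec: "\<eta> G x \<in> carrier (ob (mid Z) G)" if "G \<in> C" "x \<in> carrier (ob (mid X) G)" for G x
    using mor_closed[OF nat_transD(1)[OF e(1) that(1)] that(2)] .
  show ?thesis
    unfolding extn_equiv_def
  proof (intro exI conjI ballI)
    show iso: "?\<eta> G \<in> iso (ob (mid X) G) (ob (mid Y) G)" if G: "G \<in> C" for G
      by (rule iso_compose[OF comm_group_group[OF X(1)[OF G]] e(2)[OF G] i[OF G]])
    show "nat_trans C (mid X) (mid Y) ?\<eta>"
    proof (rule nat_transI)
      show "?\<eta> G \<in> mor (ob (mid X) G) (ob (mid Y) G)" if G: "G \<in> C" for G
        using iso[OF G] by (simp add: mor_def iso_def)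
      show "?\<eta> H (ar (mid X) G H f x) = ar (mid Y) G H f (?\<eta> G x)"
        if *: "G \<in> C" "H \<in> C" "f \<in> mor G H" "x \<in> carrier (ob (mid X) G)" for G H f x
      proof -
        let ?y = "?i G (\<eta> G x)"
        have y: "?y \<in> carrier (ob (mid Y) G)" "\<theta> G ?y = \<eta> G x"
          using i2[OF *(1) ec[OF *(1,4)]] by auto
        have "\<eta> H (ar (mid X) G H f x) = \<theta> H (ar (mid Y) G H f ?y)"
          using nat_transD(2)[OF e(1) *(1-4)] nat_transD(2)[OF t(1) *(1-3) y(1)] y(2) by simp
        then have "?i H (\<eta> H (ar (mid X) G H f x)) = ar (mid Y) G H f ?y"
          using i1[OF *(2) mor_closed[OF Y(8)[OF *(1-3)] y(1)]] by simp
        then show ?thesis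
          using *(4) mor_closed[OF X(8)[OF *(1-3)] *(4)] by (simp add: compose_eq)
      qed
    qed
    fix G assume G: "G \<in> C"
    show "?\<eta> G (incl X G a) = incl Y G a" if a: "a \<in> carrier (ob F G)" for a
      using e(3)[OF G a] t(3)[OF G a, symmetric] mor_closed[OF X(2)[OF G] a] i1[OF G mor_closed[OF Y(2)[OF G] a]]
      by (simp add: compose_eq)
    show "proj Y G (?\<eta> G x) = proj X G x" if x: "x \<in> carrier (ob (mid X) G)" for x
      using x e(4)[OF G x] t(4)[OF G] i2[OF G ec[OF G x]] by (metis compose_eq)
  qed
qed

lemma extn_equiv_sym:
  assumes "extn_equiv C Q F X Y" "is_extn C Q F X" "is_extn C Q F Y"
  shows "extn_equiv C Q F Y X"
  using extn_equiv_cancel_right[OF extn_equiv_refl[OF assms(3)] assms(1,3,2)] .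

section \<open>Extensions of the abelianization by its symmetric powers\<close>

lemma gr_group: "G \<in> gr \<Longrightarrow> group G"
  by (simp add: gr_def)

definition ab_cls :: "'x monoid \<Rightarrow> 'x \<Rightarrow> 'x set" where
  "ab_cls G g = derived G (carrier G) #>\<^bsub>G\<^esub> g"

abbreviation Ab :: "'x monoid \<Rightarrow> 'x set monoid" where
  "Ab G \<equiv> ob abelianization G"

lemma ob_abelianization: "Ab G = G Mod derived G (carrier G)"
  by (simp add: abelianization_def)

lemma derived_hom_image:
  assumes "group G" "group H" "f \<in> hom G H"
  shows "f ` derived G (carrier G) \<subseteq> derived H (carrier H)"
proof -
  interpret f: group_hom G H f by (rule group_homI[OF assms])
  have "f ` derived G (carrier G) = derived H (f ` carrier G)"
    using f.derived_img[of "carrier G"] by simp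
  also have "\<dots> \<subseteq> derived H (carrier H)"
    using f.hom_closed by (intro group.mono_derived[OF assms(2)]) auto
  finally show ?thesis .
qed

context
  fixes G :: "'x monoid"
  assumes G: "group G"
begin

lemma derived_carrier_normal: "derived G (carrier G) \<lhd> G"
  using group.derived_is_normal[OF G group.normal_self[OF G]] .

lemma comm_group_abelianization: "comm_group (Ab G)"
  unfolding ob_abelianization by (rule group.derived_quot_is_comm_group[OF G])

lemma ab_cls_hom: "ab_cls G \<in> hom G (Ab G)"
  unfolding ob_abelianization ab_cls_def using normal.r_coset_hom_Mod[OF derived_carrier_normal] .

lemma carrier_abelianization: "carrier (Ab G) = ab_cls G ` carrier G"
  by (simp add: ob_abelianization carrier_FactGroup ab_cls_def)

lemma ab_cls_closed: "g \<in> carrier G \<Longrightarrow> ab_cls G g \<in> carrier (Ab G)"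
  by (simp add: carrier_abelianization)

lemma ab_cls_mult:
  "g \<in> carrier G \<Longrightarrow> h \<in> carrier G \<Longrightarrow> ab_cls G (g \<otimes>\<^bsub>G\<^esub> h) = ab_cls G g \<otimes>\<^bsub>Ab G\<^esub> ab_cls G h"
  using ab_cls_hom by (auto simp: hom_def)

lemma ab_cls_one: "ab_cls G \<one>\<^bsub>G\<^esub> = \<one>\<^bsub>Ab G\<^esub>"
  using hom_one[OF ab_cls_hom G comm_group_group[OF comm_group_abelianization]] .

lemma generate_ab_cls:
  assumes "B \<subseteq> carrier G" "generate G B = carrier G"
  shows "carrier (Ab G) = generate (Ab G) (ab_cls G ` B)"
  using group_hom.generate_img[OF group_homI[OF G comm_group_group[OF comm_group_abelianization] ab_cls_hom] assms(1)]
    assms(2) carrier_abelianization by simp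

lemma ab_universal:
  assumes "comm_group A" "\<phi> \<in> hom G A"
  obtains \<psi> where "\<psi> \<in> hom (Ab G) A" "\<And>g. g \<in> carrier G \<Longrightarrow> \<psi> (ab_cls G g) = \<phi> g"
proof -
  interpret \<phi>: group_hom G A \<phi>
    using assms G by (intro group_homI) (auto simp: comm_group_def)
  have "\<phi> ` derived G (carrier G) \<subseteq> {\<one>\<^bsub>A\<^esub>}"
    using derived_hom_image[OF G comm_group_group[OF assms(1)] assms(2)] comm_group.derived_eq_singleton[OF assms(1)]
    by blast
  then have "derived G (carrier G) \<subseteq> kernel G A \<phi>"
    using group.derived_in_carrier[OF G subset_refl] by (auto simp: kernel_def)
  from \<phi>.FactGroup_universal_kernel[OF derived_carrier_normal this]
  show ?thesis
    using that unfolding ob_abelianization ab_cls_def by blast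
qed

end

lemma ar_abelianization:
  assumes "group G" "group H" "f \<in> mor G H"
  shows "ar abelianization G H f \<in> mor (Ab G) (Ab H)"
    and "g \<in> carrier G \<Longrightarrow> ar abelianization G H f (ab_cls G g) = ab_cls H (f g)"
proof -
  note * = derived_carrier_normal[OF assms(1)] derived_carrier_normal[OF assms(2)] morD[OF assms(3)]
    derived_hom_image[OF assms(1,2) morD[OF assms(3)]]
  show "ar abelianization G H f \<in> mor (Ab G) (Ab H)"
    using quot_map_mor[OF *] by (simp add: abelianization_def)
  show "g \<in> carrier G \<Longrightarrow> ar abelianization G H f (ab_cls G g) = ab_cls H (f g)"
    using quot_map_coset[OF *] by (simp add: abelianization_def ab_cls_def)
qed

lemma ab_functor_abelianization: "ab_functor gr abelianization"
proof (rule ab_functorI)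
  show "ar abelianization G G (\<lambda>x\<in>carrier G. x) x = x"
    if G: "G \<in> gr" and x: "x \<in> carrier (Ab G)" for G :: "'x monoid" and x
  proof -
    have i: "(\<lambda>x\<in>carrier G. x) \<in> mor G G"
      using gr_group[OF G] by (auto simp: mor_def hom_def group.is_monoid monoid.m_closed)
    show ?thesis
      using x gr_group[OF G] ar_abelianization(2)[OF _ _ i] by (auto simp: carrier_abelianization)
  qed
  show "ar abelianization G K (compose (carrier G) h f) x = ar abelianization H K h (ar abelianization G H f x)"
    if *: "G \<in> gr" "H \<in> gr" "K \<in> gr" "f \<in> mor G H" "h \<in> mor H K" and x: "x \<in> carrier (Ab G)"
    for G H K :: "'x monoid" and f h x
  proof -
    note gp = gr_group[OF *(1)] gr_group[OF *(2)] gr_group[OF *(3)]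
    have c: "compose (carrier G) h f \<in> mor G K"
      using group.hom_compose[OF gp(1) morD[OF *(4)] morD[OF *(5)]] by (simp add: mor_def)
    obtain g where g: "g \<in> carrier G" "x = ab_cls G g"
      using x gp(1) by (auto simp: carrier_abelianization)
    show ?thesis
      using g mor_closed[OF *(4) g(1)] ar_abelianization(2)[OF gp(1,3) c] ar_abelianization(2)[OF gp(1,2) *(4)]
        ar_abelianization(2)[OF gp(2,3) *(5)] by (simp add: compose_eq)
  qed
qed (auto simp: gr_group comm_group_abelianization ar_abelianization)

lemma ab_functor_sym_pow_comp:
  assumes "ab_functor C F" "\<And>G. G \<in> C \<Longrightarrow> group G"
  shows "ab_functor C (fctr_comp (sym_pow d) F)"
proof (rule ab_functorI)
  note F = ab_functorD[OF assms(1)]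
  show "comm_group (ob (fctr_comp (sym_pow d) F) G)" if "G \<in> C" for G
    using comm_group_sym_pow[OF F(1)[OF that]] by (simp add: fctr_comp_def)
  show "ar (fctr_comp (sym_pow d) F) G H f \<in> mor (ob (fctr_comp (sym_pow d) F) G) (ob (fctr_comp (sym_pow d) F) H)"
    if "G \<in> C" "H \<in> C" "f \<in> mor G H" for G H f
    using sym_pow_ar(1)[OF F(1)[OF that(1)] F(1)[OF that(2)] morD[OF F(3)[OF that]]] by (simp add: fctr_comp_def)
  show "ar (fctr_comp (sym_pow d) F) G G (\<lambda>x\<in>carrier G. x) x = x"
    if "G \<in> C" "x \<in> carrier (ob (fctr_comp (sym_pow d) F) G)" for G x
  proof -
    have "ar F G G (\<lambda>x\<in>carrier G. x) = (\<lambda>x\<in>carrier (ob F G). x)"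
      using assms(1) that(1) by (simp add: ab_functor_def)
    then show ?thesis
      using that sym_pow_id[OF F(1)[OF that(1)]] by (simp add: fctr_comp_def)
  qed
  show "ar (fctr_comp (sym_pow d) F) G K (compose (carrier G) h f) x =
      ar (fctr_comp (sym_pow d) F) H K h (ar (fctr_comp (sym_pow d) F) G H f x)"
    if "G \<in> C" "H \<in> C" "K \<in> C" "f \<in> mor G H" "h \<in> mor H K" "x \<in> carrier (ob (fctr_comp (sym_pow d) F) G)" for G H K f h x
  proof -
    have "ar F G K (compose (carrier G) h f) = compose (carrier (ob F G)) (ar F H K h) (ar F G H f)"
      using assms(1) that by (simp add: ab_functor_def)
    then show ?thesis
      using that sym_pow_comp[OF F(1)[OF that(1)] F(1)[OF that(2)] F(1)[OF that(3)] morD[OF F(3)[OF that(1,2,4)]] morD[OF F(3)[OF that(2,3,5)]]]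
      by (simp add: fctr_comp_def compose_eq)
  qed
qed (rule assms(2))

section \<open>The twisted extensions\<close>

type_synonym ('x, 'e) ab_extn = "('x, ('x set list \<Rightarrow>\<^sub>0 int) set set, 'e, 'x set) extn"

context choose_gcd
begin

abbreviation sym_ab :: "('x, ('x set list \<Rightarrow>\<^sub>0 int) set set) fctr" where
  "sym_ab \<equiv> fctr_comp (sym_pow d) abelianization"

abbreviation "SymAb \<equiv> ob sym_ab"
abbreviation "is_ab_extn \<equiv> is_extn gr abelianization sym_ab"
abbreviation "ab_extn_equiv \<equiv> extn_equiv gr abelianization sym_ab"

lemma sym_ab_simps:
  "SymAb G = Sym d (Ab G)"
  "ar sym_ab G H f = ar (sym_pow d) (Ab G) (Ab H) (ar abelianization G H f)"
  by (simp_all add: fctr_comp_def)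

lemmas ab = ab_functorD[OF ab_functor_abelianization]

lemma ab_functor_sym_ab: "ab_functor gr sym_ab"
  by (rule ab_functor_sym_pow_comp[OF ab_functor_abelianization gr_group])

lemmas sym_ab = ab_functorD[OF ab_functor_sym_ab]

definition twist_ob :: "int \<Rightarrow> 'a monoid \<Rightarrow> (('a list \<Rightarrow>\<^sub>0 int) set set \<times> 'a) monoid" where
  "twist_ob k A = \<lparr>carrier = carrier (Sym d A) \<times> carrier A,
     monoid.mult = (\<lambda>(a, v) (b, w). (a \<otimes>\<^bsub>Sym d A\<^esub> b \<otimes>\<^bsub>Sym d A\<^esub> cocyc A k v w, v \<otimes>\<^bsub>A\<^esub> w)),
     one = (\<one>\<^bsub>Sym d A\<^esub>, \<one>\<^bsub>A\<^esub>)\<rparr>"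

lemma twist_ob_simps [simp]:
  "carrier (twist_ob k A) = carrier (Sym d A) \<times> carrier A"
  "(a, v) \<otimes>\<^bsub>twist_ob k A\<^esub> (b, w) = (a \<otimes>\<^bsub>Sym d A\<^esub> b \<otimes>\<^bsub>Sym d A\<^esub> cocyc A k v w, v \<otimes>\<^bsub>A\<^esub> w)"
  "\<one>\<^bsub>twist_ob k A\<^esub> = (\<one>\<^bsub>Sym d A\<^esub>, \<one>\<^bsub>A\<^esub>)"
  by (simp_all add: twist_ob_def)

text \<open>Associativity is the cocycle identity, commutativity the symmetry of the cocycle, and
  the unit law its normalisation \<open>cocyc_one\<close>.\<close>

lemma comm_group_twist_ob:
  assumes A: "comm_group A"
  shows "comm_group (twist_ob k A)"
proof -
  interpret A: comm_group A by (fact A)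
  interpret S: comm_group "Sym d A" by (rule comm_group_sym_pow[OF A])
  note c = cocyc_closed[OF A, of k]
  show ?thesis
  proof (rule comm_groupI)
    fix x y z assume xyz: "x \<in> carrier (twist_ob k A)" "y \<in> carrier (twist_ob k A)" "z \<in> carrier (twist_ob k A)"
    obtain a v where x: "x = (a, v)" "a \<in> carrier (Sym d A)" "v \<in> carrier A"
      using xyz(1) by auto
    obtain b w where y: "y = (b, w)" "b \<in> carrier (Sym d A)" "w \<in> carrier A"
      using xyz(2) by auto
    obtain e u where z: "z = (e, u)" "e \<in> carrier (Sym d A)" "u \<in> carrier A"
      using xyz(3) by auto
    show "x \<otimes>\<^bsub>twist_ob k A\<^esub> y \<in> carrier (twist_ob k A)"
      using x y c by simp
    show "x \<otimes>\<^bsub>twist_ob k A\<^esub> y = y \<otimes>\<^bsub>twist_ob k A\<^esub> x"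
      using x y c cocyc_comm[OF A x(3) y(3)] by (simp add: A.m_comm S.m_comm)
    have "a \<otimes>\<^bsub>Sym d A\<^esub> b \<otimes>\<^bsub>Sym d A\<^esub> e
          \<otimes>\<^bsub>Sym d A\<^esub> (cocyc A k v w \<otimes>\<^bsub>Sym d A\<^esub> cocyc A k (v \<otimes>\<^bsub>A\<^esub> w) u)
        = a \<otimes>\<^bsub>Sym d A\<^esub> b \<otimes>\<^bsub>Sym d A\<^esub> e
          \<otimes>\<^bsub>Sym d A\<^esub> (cocyc A k w u \<otimes>\<^bsub>Sym d A\<^esub> cocyc A k v (w \<otimes>\<^bsub>A\<^esub> u))"
      using cocyc_assoc[OF A x(3) y(3) z(3)] by simp
    then show "x \<otimes>\<^bsub>twist_ob k A\<^esub> y \<otimes>\<^bsub>twist_ob k A\<^esub> z = x \<otimes>\<^bsub>twist_ob k A\<^esub> (y \<otimes>\<^bsub>twist_ob k A\<^esub> z)"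
      using x y z c by (simp add: S.m_ac A.m_assoc)
    show "\<one>\<^bsub>twist_ob k A\<^esub> \<otimes>\<^bsub>twist_ob k A\<^esub> x = x"
      using x cocyc_one[OF A x(3)] by simp
    \<comment> \<open>The first component of the inverse also has to cancel the cocycle at the pair
      of the inverse of v and v.\<close>
    show "\<exists>y\<in>carrier (twist_ob k A). y \<otimes>\<^bsub>twist_ob k A\<^esub> x = \<one>\<^bsub>twist_ob k A\<^esub>"
      using x c
      by (intro bexI[of _ "(inv\<^bsub>Sym d A\<^esub> (a \<otimes>\<^bsub>Sym d A\<^esub> cocyc A k (inv\<^bsub>A\<^esub> v) v), inv\<^bsub>A\<^esub> v)"])
        (simp_all add: S.m_assoc)
  qed simp
qed

definition twist :: "int \<Rightarrow> ('x, ('x set list \<Rightarrow>\<^sub>0 int) set set \<times> 'x set) ab_extn" where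
  "twist k =
     \<lparr>mid = \<lparr>ob = (\<lambda>G. twist_ob k (Ab G)),
             ar = (\<lambda>G H f. \<lambda>(a, v)\<in>carrier (twist_ob k (Ab G)).
                     (ar sym_ab G H f a, ar abelianization G H f v))\<rparr>,
      incl = (\<lambda>G. \<lambda>a\<in>carrier (SymAb G). (a, \<one>\<^bsub>Ab G\<^esub>)),
      proj = (\<lambda>G. \<lambda>(a, v)\<in>carrier (twist_ob k (Ab G)). v)\<rparr>"

lemma twist_simps [simp]:
  "ob (mid (twist k)) G = twist_ob k (Ab G)"
  "a \<in> carrier (SymAb G) \<Longrightarrow> v \<in> carrier (Ab G) \<Longrightarrow>
    ar (mid (twist k)) G H f (a, v) = (ar sym_ab G H f a, ar abelianization G H f v)"
  "a \<in> carrier (SymAb G) \<Longrightarrow> incl (twist k) G a = (a, \<one>\<^bsub>Ab G\<^esub>)"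
  "a \<in> carrier (SymAb G) \<Longrightarrow> v \<in> carrier (Ab G) \<Longrightarrow> proj (twist k) G (a, v) = v"
  by (simp_all add: twist_def sym_ab_simps)

lemma cocyc_sym_ab:
  assumes "G \<in> gr" "H \<in> gr" "f \<in> mor G H" "v \<in> carrier (Ab G)" "w \<in> carrier (Ab G)"
  shows "ar sym_ab G H f (cocyc (Ab G) k v w)
    = cocyc (Ab H) k (ar abelianization G H f v) (ar abelianization G H f w)"
  unfolding sym_ab_simps
  by (rule cocyc_nat[OF ab(1)[OF assms(1)] ab(1)[OF assms(2)] morD[OF ab(3)[OF assms(1-3)]] assms(4,5)])

text \<open>Arrows act componentwise; they respect the twisted addition because the cocycle is
  natural.\<close>

lemma is_extn_twist: "is_extn (gr :: 'x monoid set) abelianization sym_ab (twist k)"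
  unfolding is_extn_def
proof (intro conjI ballI)
  note [simp] = sym_ab_simps(1)
  have c: "cocyc (Ab G) l v w \<in> carrier (Sym d (Ab G))"
    if "G \<in> gr" for G :: "'x monoid" and l v w
    by (rule cocyc_closed[OF ab(1)[OF that]])
  note armor = mor_closed[OF ab(3)] mor_closed[OF sym_ab(3)[unfolded sym_ab_simps(1)]]
  show "ab_functor gr (mid (twist k :: ('x, _, _, _) extn))"
  proof (rule ab_functorI)
    show "comm_group (ob (mid (twist k)) G)" if "G \<in> gr" for G :: "'x monoid"
      using comm_group_twist_ob[OF ab(1)[OF that]] by simp
    show "ar (mid (twist k)) G H f \<in> mor (ob (mid (twist k)) G) (ob (mid (twist k)) H)"
      if *: "G \<in> gr" "H \<in> gr" "f \<in> mor G H" for G H :: "'x monoid" and f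
    proof -
      have "ar (mid (twist k)) G H f \<in> hom (ob (mid (twist k)) G) (ob (mid (twist k)) H)"
      proof (rule homI)
        fix x y assume xy: "x \<in> carrier (ob (mid (twist k)) G)" "y \<in> carrier (ob (mid (twist k)) G)"
        obtain a v where x: "x = (a, v)" "a \<in> carrier (Sym d (Ab G))" "v \<in> carrier (Ab G)"
          using xy(1) by auto
        obtain b w where y: "y = (b, w)" "b \<in> carrier (Sym d (Ab G))" "w \<in> carrier (Ab G)"
          using xy(2) by auto
        interpret S: comm_group "Sym d (Ab G)" by (rule comm_group_sym_pow[OF ab(1)[OF *(1)]])
        interpret A: comm_group "Ab G" by (rule ab(1)[OF *(1)])
        show "ar (mid (twist k)) G H f (x \<otimes>\<^bsub>ob (mid (twist k)) G\<^esub> y)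
            = ar (mid (twist k)) G H f x \<otimes>\<^bsub>ob (mid (twist k)) H\<^esub> ar (mid (twist k)) G H f y"
          using x y c[OF *(1)] cocyc_sym_ab[OF *] mor_mult[OF ab(3)[OF *]]
            mor_mult[OF sym_ab(3)[OF *, unfolded sym_ab_simps(1)]]
          by simp
      qed (use armor[OF *] in auto)
      then show ?thesis
        by (simp add: mor_def twist_def)
    qed
    show "ar (mid (twist k)) G G (\<lambda>x\<in>carrier G. x) x = x"
      if "G \<in> gr" "x \<in> carrier (ob (mid (twist k)) G)" for G :: "'x monoid" and x
      using that ab(4)[OF that(1)] sym_ab(4)[OF that(1)] by auto
    show "ar (mid (twist k)) G K (compose (carrier G) h f) x = ar (mid (twist k)) H K h (ar (mid (twist k)) G H f x)"
      if "G \<in> gr" "H \<in> gr" "K \<in> gr" "f \<in> mor G H" "h \<in> mor H K" "x \<in> carrier (ob (mid (twist k)) G)"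
      for G H K :: "'x monoid" and f h x
      using that ab(5)[OF that(1-5)] sym_ab(5)[OF that(1-5)] armor[OF that(1,2,4)] by auto
  qed (rule gr_group)
  have inc: "incl (twist k) G \<in> mor (SymAb G) (ob (mid (twist k)) G)" if G: "G \<in> gr" for G :: "'x monoid"
  proof -
    interpret S: comm_group "Sym d (Ab G)" by (rule comm_group_sym_pow[OF ab(1)[OF G]])
    interpret A: comm_group "Ab G" by (rule ab(1)[OF G])
    have "incl (twist k) G \<in> hom (SymAb G) (ob (mid (twist k)) G)"
      by (rule homI) (simp_all add: cocyc_one[OF ab(1)[OF G]])
    then show ?thesis by (simp add: mor_def twist_def)
  qed
  have pro: "proj (twist k) G \<in> mor (ob (mid (twist k)) G) (Ab G)" if G: "G \<in> gr" for G :: "'x monoid"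
  proof -
    interpret S: comm_group "Sym d (Ab G)" by (rule comm_group_sym_pow[OF ab(1)[OF G]])
    interpret A: comm_group "Ab G" by (rule ab(1)[OF G])
    have "proj (twist k) G \<in> hom (ob (mid (twist k)) G) (Ab G)"
      by (rule homI) (use c[OF G] in auto)
    then show ?thesis by (simp add: mor_def twist_def)
  qed
  show "nat_trans gr sym_ab (mid (twist k)) (incl (twist k) :: 'x monoid \<Rightarrow> _)"
  proof (rule nat_transI[OF inc])
    show "incl (twist k) H (ar sym_ab G H f x) = ar (mid (twist k)) G H f (incl (twist k) G x)"
      if *: "G \<in> gr" "H \<in> gr" "f \<in> mor G H" "x \<in> carrier (SymAb G)" for G H :: "'x monoid" and f x
      using * armor[OF *(1-3)] mor_one[OF ab(3)[OF *(1-3)] ab(2)[OF *(1)] ab(2)[OF *(2)]]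
        monoid.one_closed[OF group.is_monoid[OF ab(2)[OF *(1)]]] by simp
  qed
  show "nat_trans gr (mid (twist k)) abelianization (proj (twist k) :: 'x monoid \<Rightarrow> _)"
  proof (rule nat_transI[OF pro])
    show "proj (twist k) H (ar (mid (twist k)) G H f x) = ar abelianization G H f (proj (twist k) G x)"
      if *: "G \<in> gr" "H \<in> gr" "f \<in> mor G H" "x \<in> carrier (ob (mid (twist k)) G)" for G H :: "'x monoid" and f x
      using *(4) armor[OF *(1-3)] by auto
  qed
  fix G :: "'x monoid" assume G: "G \<in> gr"
  interpret S: comm_group "Sym d (Ab G)" by (rule comm_group_sym_pow[OF ab(1)[OF G]])
  interpret A: comm_group "Ab G" by (rule ab(1)[OF G])
  show "incl (twist k) G \<in> mon (SymAb G) (ob (mid (twist k)) G)"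
    using morD[OF inc[OF G]] by (auto simp: mon_def inj_on_def)
  show "incl (twist k) G ` carrier (SymAb G) = kernel (ob (mid (twist k)) G) (Ab G) (proj (twist k) G)"
    by (force simp: kernel_def image_iff)
  have "v \<in> proj (twist k) G ` carrier (ob (mid (twist k)) G)" if "v \<in> carrier (Ab G)" for v
    using that by (intro image_eqI[of _ _ "(\<one>\<^bsub>Sym d (Ab G)\<^esub>, v)"]) simp_all
  then show "proj (twist k) G \<in> epi (ob (mid (twist k)) G) (Ab G)"
    using pro[OF G] mor_closed[OF pro[OF G]] by (auto simp: epi_def morD)
qed

end

section \<open>Natural sections and their invariants\<close>

lemma free_basis_extend_indexed:
  assumes "group G" "free_basis G (b ` K)" "inj_on b K" "group H" "\<And>i. i \<in> K \<Longrightarrow> c i \<in> carrier H"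
  shows "\<exists>\<phi>\<in>mor G H. \<forall>i\<in>K. \<phi> (b i) = c i"
proof -
  have "(c \<circ> inv_into K b) ` (b ` K) \<subseteq> carrier H"
    using assms(3,5) by auto
  from free_basis_extend[OF assms(1,2,4) this] show ?thesis
    using assms(3) by auto
qed

lemma mor_eq_on_generate:
  assumes "group G" "group H" "generate G B = carrier G" "B \<subseteq> carrier G"
    and "\<phi> \<in> mor G H" "\<psi> \<in> mor G H" "\<And>b. b \<in> B \<Longrightarrow> \<phi> b = \<psi> b"
  shows "\<phi> = \<psi>"
  using mor_ext[OF assms(5,6)] hom_eq_on_generate[OF assms(1,2) morD[OF assms(5)] morD[OF assms(6)] assms(4,7)]
    assms(3) by blast

lemma mor_compose: "group G \<Longrightarrow> f \<in> mor G H \<Longrightarrow> h \<in> mor H K \<Longrightarrow> compose (carrier G) h f \<in> mor G K"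
  using group.hom_compose[of G f H h K] by (simp add: mor_def)

context choose_gcd
begin

text \<open>An extension has invariant \<open>k\<close> if it admits a natural set-theoretic section whose cocycle is
  \<open>k\<close> times the polynomial \<open>((v + w)^d - v^d - w^d) / g\<close>.\<close>

definition sect :: "int \<Rightarrow> ('x, 'e) ab_extn \<Rightarrow> ('x monoid \<Rightarrow> 'x set \<Rightarrow> 'e) \<Rightarrow> bool" where
  "sect k X s \<longleftrightarrow>
     (\<forall>G\<in>gr. \<forall>v\<in>carrier (Ab G).
        s G v \<in> carrier (ob (mid X) G) \<and> proj X G (s G v) = v \<and>
        (\<forall>w\<in>carrier (Ab G).
          s G v \<otimes>\<^bsub>ob (mid X) G\<^esub> s G w =
            s G (v \<otimes>\<^bsub>Ab G\<^esub> w) \<otimes>\<^bsub>ob (mid X) G\<^esub> incl X G (cocyc (Ab G) k v w)) \<and>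
        (\<forall>H\<in>gr. \<forall>f\<in>mor G H. ar (mid X) G H f (s G v) = s H (ar abelianization G H f v)))"

lemma sectD:
  assumes "sect k X s" "G \<in> gr" "v \<in> carrier (Ab G)"
  shows "s G v \<in> carrier (ob (mid X) G)" "proj X G (s G v) = v"
    and "w \<in> carrier (Ab G) \<Longrightarrow> s G v \<otimes>\<^bsub>ob (mid X) G\<^esub> s G w =
            s G (v \<otimes>\<^bsub>Ab G\<^esub> w) \<otimes>\<^bsub>ob (mid X) G\<^esub> incl X G (cocyc (Ab G) k v w)"
    and "H \<in> gr \<Longrightarrow> f \<in> mor G H \<Longrightarrow> ar (mid X) G H f (s G v) = s H (ar abelianization G H f v)"
  using assms by (auto simp: sect_def)

lemma cocyc_sym_ab_closed: "G \<in> gr \<Longrightarrow> cocyc (Ab G) k v w \<in> carrier (SymAb G)"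
  unfolding sym_ab_simps by (rule cocyc_closed[OF ab(1)])

lemma pw_sym_ab_closed: "G \<in> gr \<Longrightarrow> pw d (Ab G) c v \<in> carrier (SymAb G)"
  unfolding sym_ab_simps by (rule pw_closed[OF ab(1)])

lemma sect_twist: "sect k (twist k) (\<lambda>G v. (\<one>\<^bsub>SymAb G\<^esub>, v))"
  unfolding sect_def
proof (intro ballI conjI)
  fix G :: "'x monoid" and v assume G: "G \<in> gr" and v: "v \<in> carrier (Ab G)"
  interpret S: comm_group "SymAb G" by (rule sym_ab(1)[OF G])
  interpret A: comm_group "Ab G" by (rule ab(1)[OF G])
  note c = cocyc_sym_ab_closed[OF G]
  show "(\<one>\<^bsub>SymAb G\<^esub>, v) \<in> carrier (ob (mid (twist k)) G)"
    using v S.one_closed by (simp add: sym_ab_simps)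
  show "proj (twist k) G (\<one>\<^bsub>SymAb G\<^esub>, v) = v"
    using v S.one_closed by simp
  show "(\<one>\<^bsub>SymAb G\<^esub>, v) \<otimes>\<^bsub>ob (mid (twist k)) G\<^esub> (\<one>\<^bsub>SymAb G\<^esub>, w) =
     (\<one>\<^bsub>SymAb G\<^esub>, v \<otimes>\<^bsub>Ab G\<^esub> w) \<otimes>\<^bsub>ob (mid (twist k)) G\<^esub>
       incl (twist k) G (cocyc (Ab G) k v w)"
    if w: "w \<in> carrier (Ab G)" for w
  proof -
    have "cocyc (Ab G) k (v \<otimes>\<^bsub>Ab G\<^esub> w) \<one>\<^bsub>Ab G\<^esub> = \<one>\<^bsub>SymAb G\<^esub>"
      unfolding sym_ab_simps cocyc_comm[OF ab(1)[OF G] A.m_closed[OF v w] A.one_closed]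
      by (rule cocyc_one[OF ab(1)[OF G] A.m_closed[OF v w]])
    then show ?thesis
      using v w c[of k v w] S.one_closed S.m_closed S.l_one S.r_one by (simp add: sym_ab_simps(1)[symmetric])
  qed
  show "ar (mid (twist k)) G H f (\<one>\<^bsub>SymAb G\<^esub>, v) = (\<one>\<^bsub>SymAb H\<^esub>, ar abelianization G H f v)"
    if "H \<in> gr" "f \<in> mor G H" for H :: "'x monoid" and f
    using v S.one_closed mor_one[OF sym_ab(3)[OF G that] sym_ab(2)[OF G] sym_ab(2)[OF that(1)]] by simp
qed

lemma sect_extn_equiv:
  fixes X :: "('x, 'e) ab_extn"
  assumes eq: "ab_extn_equiv X Y" and X: "is_ab_extn X"
    and s: "sect k X s"
  shows "\<exists>s'. sect k Y s'"
proof -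
  obtain \<eta> where e: "nat_trans gr (mid X) (mid Y) \<eta>" "\<And>G. G \<in> gr \<Longrightarrow> \<eta> G \<in> iso (ob (mid X) G) (ob (mid Y) G)"
    "\<And>G a. G \<in> gr \<Longrightarrow> a \<in> carrier (SymAb G) \<Longrightarrow> \<eta> G (incl X G a) = incl Y G a"
    "\<And>G x. G \<in> gr \<Longrightarrow> x \<in> carrier (ob (mid X) G) \<Longrightarrow> proj Y G (\<eta> G x) = proj X G x"
    by (rule extn_equivD[OF eq]) blast
  have "sect k Y (\<lambda>G v. \<eta> G (s G v))"
    unfolding sect_def
  proof (intro ballI conjI)
    fix G :: "'x monoid" and v assume G: "G \<in> gr" and v: "v \<in> carrier (Ab G)"
    interpret A: comm_group "Ab G" by (rule ab(1)[OF G])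
    note h = nat_transD(1)[OF e(1) G] and sG = sectD[OF s G]
    show "\<eta> G (s G v) \<in> carrier (ob (mid Y) G)"
      by (rule mor_closed[OF h sG(1)[OF v]])
    show "proj Y G (\<eta> G (s G v)) = v"
      using e(4)[OF G sG(1)[OF v]] sG(2)[OF v] by simp
    show "\<eta> G (s G v) \<otimes>\<^bsub>ob (mid Y) G\<^esub> \<eta> G (s G w) =
       \<eta> G (s G (v \<otimes>\<^bsub>Ab G\<^esub> w)) \<otimes>\<^bsub>ob (mid Y) G\<^esub> incl Y G (cocyc (Ab G) k v w)"
      if w: "w \<in> carrier (Ab G)" for w
    proof -
      let ?c = "cocyc (Ab G) k v w"
      have "incl X G ?c \<in> carrier (ob (mid X) G)"
        by (rule mor_closed[OF is_extnD(2)[OF X G] cocyc_sym_ab_closed[OF G]])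
      then have "\<eta> G (s G (v \<otimes>\<^bsub>Ab G\<^esub> w) \<otimes>\<^bsub>ob (mid X) G\<^esub> incl X G ?c)
          = \<eta> G (s G (v \<otimes>\<^bsub>Ab G\<^esub> w)) \<otimes>\<^bsub>ob (mid Y) G\<^esub> incl Y G ?c"
        using mor_mult[OF h sG(1)] v w e(3)[OF G cocyc_sym_ab_closed[OF G]] by simp
      then show ?thesis
        using sG(3)[OF v w] mor_mult[OF h sG(1)[OF v] sG(1)[OF w]] by simp
    qed
    show "ar (mid Y) G H f (\<eta> G (s G v)) = \<eta> H (s H (ar abelianization G H f v))" if "H \<in> gr" "f \<in> mor G H" for H f
      using nat_transD(2)[OF e(1) G that sG(1)[OF v]] sG(4)[OF v that] by simp
  qed
  then show ?thesis by blast
qed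

text \<open>The cocycle vanishes at the unit, so the value of the section there is
  idempotent.\<close>

lemma sect_one:
  assumes X: "is_ab_extn X" and s: "sect k X s" and G: "G \<in> gr"
  shows "s G \<one>\<^bsub>Ab G\<^esub> = \<one>\<^bsub>ob (mid X) G\<^esub>"
proof -
  note Xf = is_extnD[OF X]
  interpret A: comm_group "Ab G" by (rule ab(1)[OF G])
  interpret E: comm_group "ob (mid X) G" by (rule Xf(1)[OF G])
  have "cocyc (Ab G) k \<one>\<^bsub>Ab G\<^esub> \<one>\<^bsub>Ab G\<^esub> = \<one>\<^bsub>SymAb G\<^esub>"
    using cocyc_one[OF ab(1)[OF G]] by (simp add: sym_ab_simps)
  moreover have "incl X G \<one>\<^bsub>SymAb G\<^esub> = \<one>\<^bsub>ob (mid X) G\<^esub>"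
    using mor_one[OF Xf(2)[OF G] sym_ab(2)[OF G] E.is_group] .
  ultimately show ?thesis
    using sectD(3)[OF s G A.one_closed A.one_closed] sectD(1)[OF s G A.one_closed] by simp
qed

text \<open>The equivalence sends (a, v) to the product of \<open>incl X G a\<close> and
  \<open>s G v\<close>. The multiplication rule of the section is exactly what makes the twisted
  addition correspond to the group law of the middle term.\<close>

lemma sect_imp_extn_equiv_twist:
  fixes X :: "('x, 'e) ab_extn"
  assumes X: "is_ab_extn X" and s: "sect k X s"
  shows "ab_extn_equiv (twist k) X"
proof -
  note Xf = is_extnD[OF X]
  define \<eta> where "\<eta> G = (\<lambda>(a, v)\<in>carrier (twist_ob k (Ab G)). incl X G a \<otimes>\<^bsub>ob (mid X) G\<^esub> s G v)" for G
  have \<eta>: "\<eta> G (a, v) = incl X G a \<otimes>\<^bsub>ob (mid X) G\<^esub> s G v"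
    if "a \<in> carrier (SymAb G)" "v \<in> carrier (Ab G)" for G a v
    using that by (simp add: \<eta>_def sym_ab_simps)
  have isoG: "\<eta> G \<in> iso (ob (mid (twist k)) G) (ob (mid X) G)" if G: "G \<in> gr" for G
  proof -
    let ?T = "ob (mid (twist k)) G" and ?E = "ob (mid X) G" and ?A = "Ab G" and ?S = "SymAb G"
    interpret S: comm_group "?S" by (rule sym_ab(1)[OF G])
    interpret A: comm_group "?A" by (rule ab(1)[OF G])
    interpret E: comm_group "?E" by (rule Xf(1)[OF G])
    note inc = mor_closed[OF Xf(2)[OF G]] mor_mult[OF Xf(2)[OF G]]
    note pro = mor_mult[OF Xf(4)[OF G]] Xf(6)[OF G]
    note sG = sectD[OF s G]
    note c = cocyc_sym_ab_closed[OF G]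
    have "\<eta> G \<in> hom ?T ?E"
    proof (rule homI)
      fix x assume "x \<in> carrier ?T"
      then obtain a v where "x = (a, v)" "a \<in> carrier ?S" "v \<in> carrier ?A"
        by (auto simp: sym_ab_simps)
      then show "\<eta> G x \<in> carrier ?E"
        using \<eta> inc sG by simp
    next
      fix x y assume "x \<in> carrier ?T" "y \<in> carrier ?T"
      then obtain a v b w where x: "x = (a, v)" "a \<in> carrier ?S" "v \<in> carrier ?A"
        and y: "y = (b, w)" "b \<in> carrier ?S" "w \<in> carrier ?A"
        by (auto simp: sym_ab_simps)
      let ?c = "cocyc ?A k v w"
      have "\<eta> G (x \<otimes>\<^bsub>?T\<^esub> y)
          = incl X G (a \<otimes>\<^bsub>?S\<^esub> b \<otimes>\<^bsub>?S\<^esub> ?c) \<otimes>\<^bsub>?E\<^esub> s G (v \<otimes>\<^bsub>?A\<^esub> w)"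
        using x y c[of k v w] \<eta>[of "a \<otimes>\<^bsub>?S\<^esub> b \<otimes>\<^bsub>?S\<^esub> ?c" G "v \<otimes>\<^bsub>?A\<^esub> w"]
        by (simp add: sym_ab_simps(1)[symmetric])
      also have "\<dots> = incl X G a \<otimes>\<^bsub>?E\<^esub> incl X G b \<otimes>\<^bsub>?E\<^esub> (s G v \<otimes>\<^bsub>?E\<^esub> s G w)"
        using x y c[of k v w] sG(3)[OF x(3) y(3)] sG(1)[of "v \<otimes>\<^bsub>?A\<^esub> w"] inc(1)[OF c[of k v w]]
          inc(1)[OF x(2)] inc(1)[OF y(2)]
        by (simp add: inc(2) E.m_ac)
      also have "\<dots> = \<eta> G x \<otimes>\<^bsub>?E\<^esub> \<eta> G y"
        using x y \<eta> sG(1) inc(1) by (simp add: E.m_ac)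
      finally show "\<eta> G (x \<otimes>\<^bsub>?T\<^esub> y) = \<eta> G x \<otimes>\<^bsub>?E\<^esub> \<eta> G y" .
    qed
    moreover have "inj_on (\<eta> G) (carrier ?T)"
    proof (rule inj_onI)
      fix x y assume "x \<in> carrier ?T" "y \<in> carrier ?T" and eq: "\<eta> G x = \<eta> G y"
      then obtain a v b w where x: "x = (a, v)" "a \<in> carrier ?S" "v \<in> carrier ?A"
        and y: "y = (b, w)" "b \<in> carrier ?S" "w \<in> carrier ?A"
        by (auto simp: sym_ab_simps)
      have eq: "incl X G a \<otimes>\<^bsub>?E\<^esub> s G v = incl X G b \<otimes>\<^bsub>?E\<^esub> s G w"
        using eq x y \<eta> by simp
      have "proj X G (incl X G a \<otimes>\<^bsub>?E\<^esub> s G v) = v" "proj X G (incl X G b \<otimes>\<^bsub>?E\<^esub> s G w) = w"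
        using x y inc sG pro by simp_all
      with eq have "v = w" by simp
      then have "incl X G a = incl X G b"
        using eq x y inc sG by simp
      then have "a = b"
        using Xf(3)[OF G] x(2) y(2) by (simp add: inj_on_eq_iff)
      with \<open>v = w\<close> show "x = y" using x y by simp
    qed
    moreover have "carrier ?E \<subseteq> \<eta> G ` carrier ?T"
    proof
      fix x assume x: "x \<in> carrier ?E"
      let ?v = "proj X G x"
      have v: "?v \<in> carrier ?A"
        using mor_closed[OF Xf(4)[OF G] x] .
      \<comment> \<open>Dividing x by the section over its projection leaves an element of the
        kernel, which supplies the first coordinate.\<close>
      let ?y = "x \<otimes>\<^bsub>?E\<^esub> inv\<^bsub>?E\<^esub> s G ?v"
      have y: "?y \<in> carrier ?E"
        using x sG(1)[OF v] by simp
      have "proj X G ?y = \<one>\<^bsub>?A\<^esub>"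
        using x v sG(1,2)[OF v] pro(1) mor_inv[OF Xf(4)[OF G] E.is_group A.is_group] by simp
      then obtain a where a: "a \<in> carrier ?S" "?y = incl X G a"
        using Xf(7)[OF G y] by blast
      have "\<eta> G (a, ?v) = x"
        using \<eta>[OF a(1) v] x sG(1)[OF v] by (simp add: a(2)[symmetric] E.m_assoc)
      then show "x \<in> \<eta> G ` carrier ?T"
        using a(1) v by (intro image_eqI[of _ _ "(a, ?v)"]) (simp_all add: sym_ab_simps)
    qed
    moreover have "\<eta> G ` carrier ?T \<subseteq> carrier ?E"
      using calculation(1) by (auto simp: hom_def)
    ultimately show ?thesis
      by (auto simp: iso_def bij_betw_def)
  qed
  show ?thesis
    unfolding extn_equiv_def
  proof (intro exI conjI ballI)
    show "nat_trans gr (mid (twist k)) (mid X) \<eta>"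
    proof (rule nat_transI)
      show "\<eta> G \<in> mor (ob (mid (twist k)) G) (ob (mid X) G)" if "G \<in> gr" for G
        using isoG[OF that] by (simp add: mor_def iso_def \<eta>_def)
      show "\<eta> H (ar (mid (twist k)) G H f x) = ar (mid X) G H f (\<eta> G x)"
        if *: "G \<in> gr" "H \<in> gr" "f \<in> mor G H" "x \<in> carrier (ob (mid (twist k)) G)" for G H f x
      proof -
        obtain a v where x: "x = (a, v)" "a \<in> carrier (SymAb G)" "v \<in> carrier (Ab G)"
          using *(4) by (auto simp: sym_ab_simps)
        show ?thesis
          using x \<eta> mor_closed[OF ab(3)[OF *(1-3)] x(3)] mor_closed[OF sym_ab(3)[OF *(1-3)] x(2)]
            mor_mult[OF Xf(8)[OF *(1-3)]] mor_closed[OF Xf(2)[OF *(1)]] sectD[OF s *(1)] Xf(9)[OF *(1-3)] *(2,3)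
          by simp
      qed
    qed
    fix G :: "'x monoid" assume G: "G \<in> gr"
    show "\<eta> G \<in> iso (ob (mid (twist k)) G) (ob (mid X) G)" by (rule isoG[OF G])
    interpret A: comm_group "Ab G" by (rule ab(1)[OF G])
    interpret E: comm_group "ob (mid X) G" by (rule Xf(1)[OF G])
    note inc = mor_closed[OF Xf(2)[OF G]]
    note sG = sectD[OF s G]
    show "\<eta> G (incl (twist k) G a) = incl X G a" if "a \<in> carrier (SymAb G)" for a
      using that \<eta>[OF that A.one_closed] inc[OF that] by (simp add: sect_one[OF X s G])
    show "proj X G (\<eta> G x) = proj (twist k) G x" if "x \<in> carrier (ob (mid (twist k)) G)" for x
    proof -
      obtain a v where x: "x = (a, v)" "a \<in> carrier (SymAb G)" "v \<in> carrier (Ab G)"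
        using \<open>x \<in> _\<close> by (auto simp: sym_ab_simps)
      then show ?thesis
        using \<eta> mor_mult[OF Xf(4)[OF G]] inc sG Xf(6)[OF G] by simp
    qed
  qed
qed

text \<open>Changing the section by c v^d changes its cocycle by the coboundary of c v^d, which is c
  g times the cocycle polynomial by \<open>pw_mult\<close>.\<close>

lemma sect_shift:
  fixes X :: "('x, 'e) ab_extn"
  assumes X: "is_ab_extn X" and s: "sect k X s"
  shows "sect (k - c * int g) X (\<lambda>G v. s G v \<otimes>\<^bsub>ob (mid X) G\<^esub> incl X G (pw d (Ab G) c v))"
    (is "sect _ _ ?s")
  unfolding sect_def
proof (intro ballI conjI)
  note Xf = is_extnD[OF X]
  fix G :: "'x monoid" and v assume G: "G \<in> gr" and v: "v \<in> carrier (Ab G)"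
  let ?A = "Ab G" and ?S = "SymAb G" and ?E = "ob (mid X) G"
  interpret S: comm_group ?S by (rule sym_ab(1)[OF G])
  interpret A: comm_group ?A by (rule ab(1)[OF G])
  interpret E: comm_group ?E by (rule Xf(1)[OF G])
  note inc = mor_closed[OF Xf(2)[OF G]] mor_mult[OF Xf(2)[OF G]]
  note sG = sectD[OF s G]
  note p = pw_sym_ab_closed[OF G, of c] and co = cocyc_sym_ab_closed[OF G]
  show "?s G v \<in> carrier ?E"
    using sG(1)[OF v] inc(1)[OF p] by simp
  show "proj X G (?s G v) = v"
    using sG(1,2)[OF v] inc(1)[OF p] mor_mult[OF Xf(4)[OF G]] Xf(6)[OF G p] v by simp
  show "?s G v \<otimes>\<^bsub>?E\<^esub> ?s G w = ?s G (v \<otimes>\<^bsub>?A\<^esub> w) \<otimes>\<^bsub>?E\<^esub> incl X G (cocyc ?A (k - c * int g) v w)"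
    if w: "w \<in> carrier ?A" for w
  proof -
    have "cocyc ?A k v w = cocyc ?A (c * int g) v w \<otimes>\<^bsub>?S\<^esub> cocyc ?A (k - c * int g) v w"
      using cocyc_add[OF ab(1)[OF G], of "c * int g" "k - c * int g" v w] by (simp add: sym_ab_simps)
    moreover have "pw d ?A c (v \<otimes>\<^bsub>?A\<^esub> w) = pw d ?A c v \<otimes>\<^bsub>?S\<^esub> pw d ?A c w \<otimes>\<^bsub>?S\<^esub> cocyc ?A (c * int g) v w"
      using pw_mult[OF ab(1)[OF G] v w] by (simp add: sym_ab_simps)
    ultimately have "cocyc ?A k v w \<otimes>\<^bsub>?S\<^esub> (pw d ?A c v \<otimes>\<^bsub>?S\<^esub> pw d ?A c w)
        = pw d ?A c (v \<otimes>\<^bsub>?A\<^esub> w) \<otimes>\<^bsub>?S\<^esub> cocyc ?A (k - c * int g) v w"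
      using p co by (simp add: S.m_ac)
    then have "incl X G (cocyc ?A k v w) \<otimes>\<^bsub>?E\<^esub> (incl X G (pw d ?A c v) \<otimes>\<^bsub>?E\<^esub> incl X G (pw d ?A c w))
        = incl X G (pw d ?A c (v \<otimes>\<^bsub>?A\<^esub> w)) \<otimes>\<^bsub>?E\<^esub> incl X G (cocyc ?A (k - c * int g) v w)"
      using p co by (simp flip: inc(2))
    moreover have "?s G v \<otimes>\<^bsub>?E\<^esub> ?s G w = (s G v \<otimes>\<^bsub>?E\<^esub> s G w) \<otimes>\<^bsub>?E\<^esub> (incl X G (pw d ?A c v) \<otimes>\<^bsub>?E\<^esub> incl X G (pw d ?A c w))"
      using sG(1)[OF v] sG(1)[OF w] inc(1)[OF p] by (simp add: E.m_ac)
    ultimately show ?thesis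
      using sG(1)[of "v \<otimes>\<^bsub>?A\<^esub> w"] sG(3)[OF v w] v w inc(1)[OF p] inc(1)[OF co] by (simp add: E.m_assoc)
  qed
  show "ar (mid X) G H f (?s G v) = ?s H (ar abelianization G H f v)" if H: "H \<in> gr" and f: "f \<in> mor G H" for H f
  proof -
    have "ar sym_ab G H f (pw d ?A c v) = pw d (Ab H) c (ar abelianization G H f v)"
      unfolding sym_ab_simps by (rule pw_nat[OF ab(1)[OF G] ab(1)[OF H] morD[OF ab(3)[OF G H f]] v])
    then show ?thesis
      using mor_mult[OF Xf(8)[OF G H f] sG(1)[OF v] inc(1)[OF p]] sG(4)[OF v H f] Xf(9)[OF G H f p] by simp
  qed
qed

end

section \<open>The invariant of an extension\<close>

lemma (in comm_group) mult_div_cancel: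
  "x \<in> carrier G \<Longrightarrow> y \<in> carrier G \<Longrightarrow> x \<otimes> (y \<otimes> inv x) = y"
  by (metis inv_closed m_lcomm r_inv r_one)

text \<open>The free generators may be sent to arbitrary ring elements, and a binary form in S^d of
  the abelianization is then evaluated accordingly. Equations in S^d thereby become polynomial
  identities.\<close>

lemma sym_pow_ab_eval:
  fixes c :: "nat \<Rightarrow> 'r::comm_ring_1"
  assumes G: "group G" and b: "free_basis G (b ` K)" "inj_on b K"
  obtains E \<psi> where "E \<in> hom (Sym d (Ab G)) add_grp"
    "\<psi> \<in> hom (Ab G) add_grp" "\<And>i. i \<in> K \<Longrightarrow> \<psi> (ab_cls G (b i)) = c i"
    "\<And>a v w. v \<in> carrier (Ab G) \<Longrightarrow> w \<in> carrier (Ab G) \<Longrightarrow>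
       E (pol d (Ab G) a v w) = hform d a (\<psi> v) (\<psi> w)"
proof -
  have "\<exists>\<phi>\<in>mor G add_grp. \<forall>i\<in>K. \<phi> (b i) = c i"
    by (rule free_basis_extend_indexed[OF G b comm_group_group[OF comm_group_add_grp]]) simp
  then obtain \<phi> where \<phi>: "\<phi> \<in> mor G add_grp" "\<And>i. i \<in> K \<Longrightarrow> \<phi> (b i) = c i"
    by blast
  obtain \<psi> where \<psi>: "\<psi> \<in> hom (Ab G) add_grp" "\<And>g. g \<in> carrier G \<Longrightarrow> \<psi> (ab_cls G g) = \<phi> g"
    using ab_universal[OF G comm_group_add_grp morD[OF \<phi>(1)]] by blast
  have "\<psi> (ab_cls G (b i)) = c i" if "i \<in> K" for i
    using \<psi>(2)[of "b i"] \<phi>(2) that b(1) by (auto simp: free_basis_def)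
  moreover obtain E where "E \<in> hom (Sym d (Ab G)) add_grp"
    "\<And>a v w. v \<in> carrier (Ab G) \<Longrightarrow> w \<in> carrier (Ab G) \<Longrightarrow>
       E (pol d (Ab G) a v w) = hform d a (\<psi> v) (\<psi> w)"
    using sym_pow_eval[OF comm_group_abelianization[OF G] \<psi>(1)] by blast
  ultimately show ?thesis
    using that \<psi>(1) by blast
qed

context choose_gcd
begin

text \<open>After a shift by a multiple of g, the two sections agree on the generator of the
  infinite cyclic group, hence everywhere by naturality. Their cocycles are then equal, and the
  multiple is read off on two free generators.\<close>

lemma sect_unique:
  fixes X :: "('x, 'e) ab_extn"
  assumes X: "is_ab_extn X" and s: "sect k X s" and s': "sect k' X s'"
    and inf: "infinite (UNIV :: 'x set)"
  shows "int g dvd k - k'"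
proof (cases "d = 1")
  \<comment> \<open>Here the cocycle polynomial is zero and says nothing about k, but g = 1.\<close>
  case True
  then show ?thesis using g_one by simp
next
  case False
  then have d2: "d \<ge> 2" using d_pos by simp
  note Xf = is_extnD[OF X]
  obtain G1 :: "'x monoid" and b1 where G1: "G1 \<in> gr" and b1: "inj_on b1 {0::nat}" "free_basis G1 (b1 ` {0})"
    using ex_free_basis[OF inf, of "{0}"] by auto
  note gp1 = gr_group[OF G1]
  let ?x = "b1 0" and ?A1 = "Ab G1" and ?E1 = "ob (mid X) G1"
  have x: "?x \<in> carrier G1" and gen1: "generate G1 {?x} = carrier G1"
    using b1(2) by (auto simp: free_basis_def)
  have v0: "ab_cls G1 ?x \<in> carrier ?A1"
    using ab_cls_closed[OF gp1 x] .
  have genA1: "carrier ?A1 = generate ?A1 {ab_cls G1 ?x}"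
    using generate_ab_cls[OF gp1 _ gen1] x by simp
  interpret E1: comm_group ?E1 by (rule Xf(1)[OF G1])
  interpret A1: comm_group ?A1 by (rule ab(1)[OF G1])
  \<comment> \<open>Over the generator the two sections differ by an element of the kernel, which
    has the form c x^d.\<close>
  let ?y = "s' G1 (ab_cls G1 ?x) \<otimes>\<^bsub>?E1\<^esub> inv\<^bsub>?E1\<^esub> s G1 (ab_cls G1 ?x)"
  note sv = sectD[OF s G1 v0] and sv' = sectD[OF s' G1 v0]
  have y: "?y \<in> carrier ?E1"
    using sv(1) sv'(1) by simp
  have "proj X G1 ?y = \<one>\<^bsub>?A1\<^esub>"
    using sv(1,2) sv'(1,2) mor_mult[OF Xf(4)[OF G1]] mor_inv[OF Xf(4)[OF G1] E1.is_group A1.is_group] v0 by simp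
  then obtain t where t: "t \<in> carrier (SymAb G1)" "?y = incl X G1 t"
    using Xf(7)[OF G1 y] by blast
  obtain c where c: "t = pw d ?A1 c (ab_cls G1 ?x)"
    using sym_pow_eq_pw[OF ab(1)[OF G1] genA1] t(1) by (auto simp: sym_ab_simps)
  define s'' where "s'' G v = s G v \<otimes>\<^bsub>ob (mid X) G\<^esub> incl X G (pw d (Ab G) c v)" for G v
  have s'': "sect (k - c * int g) X s''"
    unfolding s''_def by (rule sect_shift[OF X s])
  have eq1: "s'' G1 (ab_cls G1 ?x) = s' G1 (ab_cls G1 ?x)"
    unfolding s''_def c[symmetric] t(2)[symmetric] by (rule E1.mult_div_cancel[OF sv(1) sv'(1)])
  \<comment> \<open>Every class is the image of the class of the free generator, so agreement there
    propagates.\<close>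
  have eq: "s'' G v = s' G v" if G: "G \<in> gr" and v: "v \<in> carrier (Ab G)" for G v
  proof -
    obtain g where g: "g \<in> carrier G" "v = ab_cls G g"
      using v carrier_abelianization[OF gr_group[OF G]] by auto
    obtain \<phi> where \<phi>: "\<phi> \<in> mor G1 G" "\<phi> ?x = g"
      using free_basis_extend_indexed[OF gp1 b1(2,1) gr_group[OF G], of "\<lambda>_. g"] g by auto
    have "ar abelianization G1 G \<phi> (ab_cls G1 ?x) = v"
      using ar_abelianization(2)[OF gp1 gr_group[OF G] \<phi>(1) x] \<phi>(2) g(2) by simp
    then show ?thesis
      using sectD(4)[OF s'' G1 v0 G \<phi>(1)] sectD(4)[OF s' G1 v0 G \<phi>(1)] eq1 by simp
  qed
  obtain G2 :: "'x monoid" and b2 where G2: "G2 \<in> gr" and b2: "inj_on b2 {0::nat, 1}" "free_basis G2 (b2 ` {0, 1})"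
    using ex_free_basis[OF inf, of "{0, 1}"] by auto
  note gp2 = gr_group[OF G2]
  let ?A2 = "Ab G2" and ?E2 = "ob (mid X) G2"
  let ?v = "ab_cls G2 (b2 0)" and ?w = "ab_cls G2 (b2 1)"
  have v: "?v \<in> carrier ?A2" and w: "?w \<in> carrier ?A2"
    using b2(2) by (auto simp: free_basis_def intro!: ab_cls_closed[OF gp2])
  interpret E2: comm_group ?E2 by (rule Xf(1)[OF G2])
  interpret A2: comm_group ?A2 by (rule ab(1)[OF G2])
  note vw = A2.m_closed[OF v w]
  have "s' G2 (?v \<otimes>\<^bsub>?A2\<^esub> ?w) \<otimes>\<^bsub>?E2\<^esub> incl X G2 (cocyc ?A2 (k - c * int g) ?v ?w)
      = s' G2 (?v \<otimes>\<^bsub>?A2\<^esub> ?w) \<otimes>\<^bsub>?E2\<^esub> incl X G2 (cocyc ?A2 k' ?v ?w)"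
    using sectD(3)[OF s'' G2 v w] sectD(3)[OF s' G2 v w] eq[OF G2 v] eq[OF G2 w] eq[OF G2 vw] by simp
  then have "incl X G2 (cocyc ?A2 (k - c * int g) ?v ?w) = incl X G2 (cocyc ?A2 k' ?v ?w)"
    using sectD(1)[OF s' G2 vw] mor_closed[OF Xf(2)[OF G2] cocyc_sym_ab_closed[OF G2]] by simp
  then have co: "cocyc ?A2 (k - c * int g) ?v ?w = cocyc ?A2 k' ?v ?w"
    by (rule inj_onD[OF Xf(3)[OF G2] _ cocyc_sym_ab_closed[OF G2] cocyc_sym_ab_closed[OF G2]])
  \<comment> \<open>Evaluating the two free generators at 1 and t makes the coefficients
    visible.\<close>
  obtain E \<psi> where E: "E \<in> hom (Sym d ?A2) add_grp" "\<psi> \<in> hom ?A2 add_grp"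
    "\<And>i. i \<in> {0, 1} \<Longrightarrow> \<psi> (ab_cls G2 (b2 i)) = (if i = 0 then 1 else [:0, 1:] :: int poly)"
    "\<And>a v w. v \<in> carrier ?A2 \<Longrightarrow> w \<in> carrier ?A2 \<Longrightarrow> E (pol d ?A2 a v w) = hform d a (\<psi> v) (\<psi> w)"
    using sym_pow_ab_eval[OF gp2 b2(2,1), of d "\<lambda>i. if i = 0 then 1 else [:0, 1:] :: int poly"] by blast
  have "hform d (\<lambda>i. (k - c * int g) * bcoef i) 1 [:0, 1:] = (hform d (\<lambda>i. k' * bcoef i) 1 [:0, 1:] :: int poly)"
    using arg_cong[OF co, of E] E(3)[of 0] E(3)[of 1] unfolding cocyc_def E(4)[OF v w] by simp
  from hform_int_poly_inj[OF this, of 1] have "(k - c * int g) * bcoef 1 = k' * bcoef 1"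
    using d2 by simp
  then have "k - k' = c * int g"
    using bcoef_pos[OF d2] by simp
  then show ?thesis by simp
qed

text \<open>The section is first built on group elements, as \<sigma>. Only after its defect of
  additivity is known to be a multiple of the cocycle polynomial can \<sigma> be shown to depend on
  classes alone: symmetry and normalisation of the cocycle are needed for that.\<close>

lemma sect_exists:
  fixes X :: "('x, 'e) ab_extn"
  assumes X: "is_ab_extn X" and inf: "infinite (UNIV :: 'x set)"
  shows "\<exists>k s. sect k X s"
proof -
  note [simp del] = One_nat_def
  note Xf = is_extnD[OF X]
  obtain G1 :: "'x monoid" and b1 where G1: "G1 \<in> gr" and b1: "inj_on b1 {0::nat}" "free_basis G1 (b1 ` {0})"
    using ex_free_basis[OF inf, of "{0}"] by auto
  note gp1 = gr_group[OF G1]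
  let ?x = "b1 0" and ?A1 = "Ab G1" and ?E1 = "ob (mid X) G1"
  have x: "?x \<in> carrier G1" and gen1: "generate G1 {?x} = carrier G1"
    using b1(2) by (auto simp: free_basis_def)
  have v0: "ab_cls G1 ?x \<in> carrier ?A1"
    using ab_cls_closed[OF gp1 x] .
  obtain e where e: "e \<in> carrier ?E1" "proj X G1 e = ab_cls G1 ?x"
    using Xf(5)[OF G1] v0 by (metis imageE)
  define \<phi> where "\<phi> G h = (SOME f. f \<in> mor G1 G \<and> f ?x = h)" for G :: "'x monoid" and h
  have \<phi>: "\<phi> G h \<in> mor G1 G" "\<phi> G h ?x = h" if "G \<in> gr" "h \<in> carrier G" for G h
  proof -
    have "\<exists>f. f \<in> mor G1 G \<and> f ?x = h"
      using free_basis_extend_indexed[OF gp1 b1(2,1) gr_group[OF that(1)], of "\<lambda>_. h"] that by auto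
    from someI_ex[OF this] show "\<phi> G h \<in> mor G1 G" "\<phi> G h ?x = h"
      unfolding \<phi>_def by auto
  qed
  \<comment> \<open>A morphism from the infinite cyclic group is determined by the image of the
    generator; this makes \<sigma> natural.\<close>
  have \<phi>_comp: "compose (carrier G1) f (\<phi> G h) = \<phi> H (f h)"
    if *: "G \<in> gr" "H \<in> gr" "f \<in> mor G H" "h \<in> carrier G" for G H f h
  proof (rule mor_eq_on_generate[OF gp1 gr_group[OF *(2)] gen1])
    show "compose (carrier G1) f (\<phi> G h) \<in> mor G1 H"
      using mor_compose[OF gp1 \<phi>(1)[OF *(1,4)] *(3)] .
    show "\<phi> H (f h) \<in> mor G1 H"
      using \<phi>(1)[OF *(2) mor_closed[OF *(3,4)]] .
  qed (use x \<phi>(2)[OF *(1,4)] \<phi>(2)[OF *(2) mor_closed[OF *(3,4)]] in \<open>auto simp: compose_eq\<close>)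
  define \<sigma> where "\<sigma> G h = ar (mid X) G1 G (\<phi> G h) e" for G h
  have \<sigma>_closed: "\<sigma> G h \<in> carrier (ob (mid X) G)" if "G \<in> gr" "h \<in> carrier G" for G h
    unfolding \<sigma>_def using mor_closed[OF Xf(8)[OF G1 that(1) \<phi>(1)[OF that]] e(1)] .
  have \<sigma>_proj: "proj X G (\<sigma> G h) = ab_cls G h" if "G \<in> gr" "h \<in> carrier G" for G h
    unfolding \<sigma>_def using Xf(10)[OF G1 that(1) \<phi>(1)[OF that] e(1)] e(2)
      ar_abelianization(2)[OF gp1 gr_group[OF that(1)] \<phi>(1)[OF that] x] \<phi>(2)[OF that] by simp
  have \<sigma>_nat: "ar (mid X) G H f (\<sigma> G h) = \<sigma> H (f h)"
    if *: "G \<in> gr" "H \<in> gr" "f \<in> mor G H" "h \<in> carrier G" for G H f h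
  proof -
    have "ab_functor gr (mid X)" using X by (simp add: is_extn_def)
    from ab_functorD(5)[OF this G1 *(1,2) \<phi>(1)[OF *(1,4)] *(3) e(1)]
    show ?thesis
      unfolding \<sigma>_def \<phi>_comp[OF *, symmetric] by simp
  qed
  obtain G2 :: "'x monoid" and b2 where G2: "G2 \<in> gr" and b2: "inj_on b2 {0::nat, 1}" "free_basis G2 (b2 ` {0, 1})"
    using ex_free_basis[OF inf, of "{0, 1}"] by auto
  note gp2 = gr_group[OF G2]
  let ?A2 = "Ab G2" and ?E2 = "ob (mid X) G2"
  let ?v = "ab_cls G2 (b2 0)" and ?w = "ab_cls G2 (b2 1)"
  have b2c: "b2 0 \<in> carrier G2" "b2 1 \<in> carrier G2" and gen2: "generate G2 {b2 0, b2 1} = carrier G2"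
    using b2(2) by (auto simp: free_basis_def)
  interpret G2: group G2 by (rule gp2)
  interpret E2: comm_group ?E2 by (rule Xf(1)[OF G2])
  interpret A2: comm_group ?A2 by (rule ab(1)[OF G2])
  have v: "?v \<in> carrier ?A2" and w: "?w \<in> carrier ?A2"
    using b2c by (auto intro!: ab_cls_closed[OF gp2])
  let ?xy = "b2 0 \<otimes>\<^bsub>G2\<^esub> b2 1"
  have xy: "?xy \<in> carrier G2" using b2c by simp
  \<comment> \<open>The defect of additivity at two free generators. It lies in the kernel, hence it
    is a binary form in their classes.\<close>
  let ?z = "\<sigma> G2 (b2 0) \<otimes>\<^bsub>?E2\<^esub> \<sigma> G2 (b2 1) \<otimes>\<^bsub>?E2\<^esub> inv\<^bsub>?E2\<^esub> \<sigma> G2 ?xy"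
  note \<sigma>2 = \<sigma>_closed[OF G2 b2c(1)] \<sigma>_closed[OF G2 b2c(2)] \<sigma>_closed[OF G2 xy]
  have z: "?z \<in> carrier ?E2"
    using \<sigma>2 by simp
  have "proj X G2 ?z = \<one>\<^bsub>?A2\<^esub>"
    using \<sigma>2 \<sigma>_proj[OF G2] b2c xy mor_mult[OF Xf(4)[OF G2]] mor_inv[OF Xf(4)[OF G2] E2.is_group A2.is_group]
      ab_cls_mult[OF gp2 b2c] v w by simp
  then obtain t where t: "t \<in> carrier (SymAb G2)" "?z = incl X G2 t"
    using Xf(7)[OF G2 z] by blast
  have "carrier ?A2 = generate ?A2 {?v, ?w}"
    using generate_ab_cls[OF gp2 _ gen2] b2c by simp
  then obtain a where a: "t = pol d ?A2 a ?v ?w"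
    using sym_pow_eq_pol[OF ab(1)[OF G2], of ?v ?w t d] t(1) unfolding sym_ab_simps by blast
  have rel2: "\<sigma> G2 (b2 0) \<otimes>\<^bsub>?E2\<^esub> \<sigma> G2 (b2 1) = \<sigma> G2 ?xy \<otimes>\<^bsub>?E2\<^esub> incl X G2 (pol d ?A2 a ?v ?w)"
    unfolding a[symmetric] t(2)[symmetric] using E2.mult_div_cancel[OF \<sigma>2(3) E2.m_closed[OF \<sigma>2(1,2)]] by simp
  have polc: "pol d ?A2 a ?v ?w \<in> carrier (SymAb G2)"
    using t(1) a by simp
  have polG: "pol d (Ab G) a' v w \<in> carrier (SymAb G)" if "G \<in> gr" for G a' v w
    unfolding sym_ab_simps by (rule pol_closed[OF ab(1)[OF that]])
  \<comment> \<open>The pair of free generators is universal: the morphism that sends it to h and h'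
    carries the relation along.\<close>
  have rel: "\<sigma> G h \<otimes>\<^bsub>ob (mid X) G\<^esub> \<sigma> G h'
      = \<sigma> G (h \<otimes>\<^bsub>G\<^esub> h') \<otimes>\<^bsub>ob (mid X) G\<^esub> incl X G (pol d (Ab G) a (ab_cls G h) (ab_cls G h'))"
    if G: "G \<in> gr" and h: "h \<in> carrier G" "h' \<in> carrier G" for G h h'
  proof -
    have "\<exists>f\<in>mor G2 G. \<forall>i\<in>{0, 1}. f (b2 i) = (if i = 0 then h else h')"
      by (rule free_basis_extend_indexed[OF gp2 b2(2,1) gr_group[OF G]]) (use h in simp)
    then obtain f where f: "f \<in> mor G2 G" "f (b2 0) = h" "f (b2 1) = h'"
      by auto
    have n: "ar (mid X) G2 G f (\<sigma> G2 u) = \<sigma> G (f u)" if "u \<in> carrier G2" for u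
      by (rule \<sigma>_nat[OF G2 G f(1) that])
    have p: "ar sym_ab G2 G f (pol d ?A2 a ?v ?w) = pol d (Ab G) a (ab_cls G h) (ab_cls G h')"
      unfolding sym_ab_simps sym_pow_ar_pol[OF ab(1)[OF G2] ab(1)[OF G] morD[OF ab(3)[OF G2 G f(1)]] v w]
      by (simp add: ar_abelianization(2)[OF gp2 gr_group[OF G] f(1)] b2c f(2,3))
    have "ar (mid X) G2 G f (\<sigma> G2 (b2 0) \<otimes>\<^bsub>?E2\<^esub> \<sigma> G2 (b2 1)) = \<sigma> G h \<otimes>\<^bsub>ob (mid X) G\<^esub> \<sigma> G h'"
      using mor_mult[OF Xf(8)[OF G2 G f(1)] \<sigma>2(1,2)] n b2c f(2,3) by simp
    moreover have "ar (mid X) G2 G f (\<sigma> G2 ?xy \<otimes>\<^bsub>?E2\<^esub> incl X G2 (pol d ?A2 a ?v ?w))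
       = \<sigma> G (h \<otimes>\<^bsub>G\<^esub> h') \<otimes>\<^bsub>ob (mid X) G\<^esub> incl X G (pol d (Ab G) a (ab_cls G h) (ab_cls G h'))"
      using mor_mult[OF Xf(8)[OF G2 G f(1)] \<sigma>2(3) mor_closed[OF Xf(2)[OF G2] polc]] n[OF xy]
        mor_mult[OF f(1) b2c] f(2,3) Xf(9)[OF G2 G f(1) polc] p by simp
    ultimately show ?thesis
      using rel2 by simp
  qed
  have "\<exists>k. \<forall>i\<le>d. a i = k * bcoef i"
  proof (rule hform_cocycle_multiple_of_bcoef)
    fix X' Y Z :: "int poly"
    obtain G3 :: "'x monoid" and b3 where G3: "G3 \<in> gr" and b3: "inj_on b3 {0::nat, 1, 2}" "free_basis G3 (b3 ` {0, 1, 2})"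
      using ex_free_basis[OF inf, of "{0, 1, 2}"] by auto
    note gp3 = gr_group[OF G3]
    let ?A = "Ab G3" and ?E = "ob (mid X) G3" and ?F = "SymAb G3"
    let ?a = "b3 0" and ?b = "b3 1" and ?c = "b3 2"
    interpret G: group G3 by (rule gp3)
    interpret E: comm_group ?E by (rule Xf(1)[OF G3])
    interpret S: comm_group ?F by (rule sym_ab(1)[OF G3])
    have abc: "?a \<in> carrier G3" "?b \<in> carrier G3" "?c \<in> carrier G3"
      using b3(2) by (auto simp: free_basis_def)
    let ?C = "ab_cls G3"
    let ?P = "pol d ?A a"
    have cc: "?C ?a \<in> carrier ?A" "?C ?b \<in> carrier ?A" "?C ?c \<in> carrier ?A"
      using abc by (auto intro!: ab_cls_closed[OF gp3])
    note P = polG[OF G3, of a]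
    note inc = mor_closed[OF Xf(2)[OF G3] P] mor_mult[OF Xf(2)[OF G3]]
    note \<sigma>3 = \<sigma>_closed[OF G3]
    \<comment> \<open>The product of the three values is computed with both bracketings, and
      injectivity of the inclusion gives an equation in the symmetric power.\<close>
    let ?abc = "?a \<otimes>\<^bsub>G3\<^esub> ?b \<otimes>\<^bsub>G3\<^esub> ?c"
    have "\<sigma> G3 ?a \<otimes>\<^bsub>?E\<^esub> \<sigma> G3 ?b \<otimes>\<^bsub>?E\<^esub> \<sigma> G3 ?c
        = \<sigma> G3 (?a \<otimes>\<^bsub>G3\<^esub> ?b) \<otimes>\<^bsub>?E\<^esub> \<sigma> G3 ?c \<otimes>\<^bsub>?E\<^esub> incl X G3 (?P (?C ?a) (?C ?b))"
      using rel[OF G3 abc(1,2)] abc \<sigma>3 inc by (simp add: E.m_ac)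
    also have "\<dots> = \<sigma> G3 ?abc \<otimes>\<^bsub>?E\<^esub> incl X G3 (?P (?C ?a) (?C ?b) \<otimes>\<^bsub>?F\<^esub> ?P (?C (?a \<otimes>\<^bsub>G3\<^esub> ?b)) (?C ?c))"
      using rel[OF G3 G.m_closed[OF abc(1,2)] abc(3)] abc \<sigma>3 inc P by (simp add: E.m_ac)
    finally have 1: "\<sigma> G3 ?a \<otimes>\<^bsub>?E\<^esub> \<sigma> G3 ?b \<otimes>\<^bsub>?E\<^esub> \<sigma> G3 ?c = \<dots>" .
    have "\<sigma> G3 ?a \<otimes>\<^bsub>?E\<^esub> \<sigma> G3 ?b \<otimes>\<^bsub>?E\<^esub> \<sigma> G3 ?c
        = \<sigma> G3 ?a \<otimes>\<^bsub>?E\<^esub> \<sigma> G3 (?b \<otimes>\<^bsub>G3\<^esub> ?c) \<otimes>\<^bsub>?E\<^esub> incl X G3 (?P (?C ?b) (?C ?c))"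
      using rel[OF G3 abc(2,3)] abc \<sigma>3 inc by (simp add: E.m_assoc)
    also have "\<dots> = \<sigma> G3 ?abc \<otimes>\<^bsub>?E\<^esub> incl X G3 (?P (?C ?b) (?C ?c) \<otimes>\<^bsub>?F\<^esub> ?P (?C ?a) (?C (?b \<otimes>\<^bsub>G3\<^esub> ?c)))"
      using rel[OF G3 abc(1) G.m_closed[OF abc(2,3)]] abc \<sigma>3 inc P by (simp add: E.m_ac G.m_assoc)
    finally have "incl X G3 (?P (?C ?a) (?C ?b) \<otimes>\<^bsub>?F\<^esub> ?P (?C (?a \<otimes>\<^bsub>G3\<^esub> ?b)) (?C ?c))
        = incl X G3 (?P (?C ?b) (?C ?c) \<otimes>\<^bsub>?F\<^esub> ?P (?C ?a) (?C (?b \<otimes>\<^bsub>G3\<^esub> ?c)))"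
      unfolding 1 using \<sigma>3[of ?abc] abc mor_closed[OF Xf(2)[OF G3]] P by simp
    then have eq: "?P (?C ?a) (?C ?b) \<otimes>\<^bsub>?F\<^esub> ?P (?C ?a \<otimes>\<^bsub>?A\<^esub> ?C ?b) (?C ?c)
        = ?P (?C ?b) (?C ?c) \<otimes>\<^bsub>?F\<^esub> ?P (?C ?a) (?C ?b \<otimes>\<^bsub>?A\<^esub> ?C ?c)"
      using inj_onD[OF Xf(3)[OF G3]] P S.m_closed ab_cls_mult[OF gp3] abc by metis
    \<comment> \<open>Evaluation at the given polynomials turns this equation into the required
      cocycle identity.\<close>
    obtain E \<psi> where E: "E \<in> hom (Sym d ?A) add_grp" "\<psi> \<in> hom ?A add_grp"
      "\<And>i. i \<in> {0, 1, 2} \<Longrightarrow> \<psi> (ab_cls G3 (b3 i)) = (if i = 0 then X' else if i = 1 then Y else Z)"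
      "\<And>a v w. v \<in> carrier ?A \<Longrightarrow> w \<in> carrier ?A \<Longrightarrow> E (pol d ?A a v w) = hform d a (\<psi> v) (\<psi> w)"
      using sym_pow_ab_eval[OF gp3 b3(2,1), of d "\<lambda>i. if i = 0 then X' else if i = 1 then Y else Z"] by blast
    have Em: "E (p \<otimes>\<^bsub>?F\<^esub> q) = E p + E q" if "p \<in> carrier ?F" "q \<in> carrier ?F" for p q
      using E(1) that by (auto simp: hom_def sym_ab_simps)
    have \<psi>m: "\<psi> (p \<otimes>\<^bsub>?A\<^esub> q) = \<psi> p + \<psi> q" if "p \<in> carrier ?A" "q \<in> carrier ?A" for p q
      using E(2) that by (auto simp: hom_def)
    interpret A: comm_group ?A by (rule ab(1)[OF G3])
    show "hform d a X' Y + hform d a (X' + Y) Z = hform d a Y Z + hform d a X' (Y + Z)"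
      using arg_cong[OF eq, of E] E(3)[of 0] E(3)[of 1] E(3)[of 2] cc P by (simp add: Em E(4) \<psi>m)
  qed
  then obtain k where k: "\<And>i. i \<le> d \<Longrightarrow> a i = k * bcoef i"
    by blast
  have pol_k: "pol d A a v w = cocyc A k v w" for A :: "'x set monoid" and v w
    unfolding cocyc_def pol_def using hform_cong[of d a "\<lambda>i. k * bcoef i"] k by metis
  note rel = rel[unfolded pol_k]
  \<comment> \<open>Normalisation makes \<sigma> multiplicative as soon as the first factor has
    trivial class. Symmetry of the cocycle and commutativity of the middle term make \<sigma> blind
    to the order of two factors. So \<sigma> is trivial on commutators, hence on the derived
    subgroup.\<close>
  have fact: "\<sigma> G h = \<sigma> G h'" if G: "G \<in> gr" and h: "h \<in> carrier G" "h' \<in> carrier G" "ab_cls G h = ab_cls G h'" for G h h'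
  proof -
    let ?A = "Ab G" and ?E = "ob (mid X) G" and ?F = "SymAb G" and ?C = "ab_cls G"
    note gp = gr_group[OF G]
    interpret G: group G by (rule gp)
    interpret E: comm_group ?E by (rule Xf(1)[OF G])
    interpret A: comm_group ?A by (rule ab(1)[OF G])
    note C = ab_cls_closed[OF gp]
    note \<sigma>c = \<sigma>_closed[OF G]
    have i1: "incl X G \<one>\<^bsub>?F\<^esub> = \<one>\<^bsub>?E\<^esub>"
      using mor_one[OF Xf(2)[OF G] sym_ab(2)[OF G] E.is_group] .
    have triv: "\<sigma> G u \<otimes>\<^bsub>?E\<^esub> \<sigma> G u' = \<sigma> G (u \<otimes>\<^bsub>G\<^esub> u')"
      if u: "u \<in> carrier G" "u' \<in> carrier G" "?C u = \<one>\<^bsub>?A\<^esub>" for u u'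
    proof -
      have "cocyc ?A k (?C u) (?C u') = \<one>\<^bsub>?F\<^esub>"
        using cocyc_one[OF ab(1)[OF G] C[OF u(2)]] u(3) by (simp add: sym_ab_simps)
      then show ?thesis
        using rel[OF G u(1,2)] i1 \<sigma>c u by simp
    qed
    have comm: "\<sigma> G (u \<otimes>\<^bsub>G\<^esub> u') = \<sigma> G (u' \<otimes>\<^bsub>G\<^esub> u)" if u: "u \<in> carrier G" "u' \<in> carrier G" for u u'
    proof -
      let ?c = "incl X G (cocyc ?A k (?C u) (?C u'))"
      have "?c \<in> carrier ?E"
        by (rule mor_closed[OF Xf(2)[OF G] cocyc_sym_ab_closed[OF G]])
      moreover have "\<sigma> G (u \<otimes>\<^bsub>G\<^esub> u') \<otimes>\<^bsub>?E\<^esub> ?c = \<sigma> G (u' \<otimes>\<^bsub>G\<^esub> u) \<otimes>\<^bsub>?E\<^esub> ?c"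
        using rel[OF G u] rel[OF G u(2,1)] E.m_comm[OF \<sigma>c[OF u(1)] \<sigma>c[OF u(2)]]
          cocyc_comm[OF ab(1)[OF G] C[OF u(1)] C[OF u(2)]] by simp
      ultimately show ?thesis
        using \<sigma>c u by simp
    qed
    have C1: "?C \<one>\<^bsub>G\<^esub> = \<one>\<^bsub>?A\<^esub>"
      by (rule ab_cls_one[OF gp])
    have \<sigma>1: "\<sigma> G \<one>\<^bsub>G\<^esub> = \<one>\<^bsub>?E\<^esub>"
      using triv[OF G.one_closed G.one_closed C1] \<sigma>c[OF G.one_closed] by simp
    \<comment> \<open>The condition on the class is included so that \<open>triv\<close> applies to
      the members, which makes this set a subgroup.\<close>
    let ?N = "{u \<in> carrier G. ?C u = \<one>\<^bsub>?A\<^esub> \<and> \<sigma> G u = \<one>\<^bsub>?E\<^esub>}"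
    have Cinv: "?C (inv\<^bsub>G\<^esub> u) = inv\<^bsub>?A\<^esub> ?C u" if "u \<in> carrier G" for u
      using group_hom.hom_inv[OF group_homI[OF gp A.is_group ab_cls_hom[OF gp]] that] .
    have N: "subgroup ?N G"
    proof (rule G.subgroupI)
      show "?N \<noteq> {}" using C1 \<sigma>1 by auto
      show "inv\<^bsub>G\<^esub> u \<in> ?N" if "u \<in> ?N" for u
        using that Cinv[of u] triv[of u "inv\<^bsub>G\<^esub> u"] \<sigma>1 \<sigma>c[of "inv\<^bsub>G\<^esub> u"] by auto
      show "u \<otimes>\<^bsub>G\<^esub> u' \<in> ?N" if "u \<in> ?N" "u' \<in> ?N" for u u'
        using that triv[of u u'] ab_cls_mult[OF gp] by auto
    qed auto
    have "derived G (carrier G) \<subseteq> ?N"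
      unfolding derived_def
    proof (rule G.generate_subgroup_incl[OF _ N], rule subsetI)
      fix q assume "q \<in> (\<Union>h1\<in>carrier G. \<Union>h2\<in>carrier G. {h1 \<otimes>\<^bsub>G\<^esub> h2 \<otimes>\<^bsub>G\<^esub> inv\<^bsub>G\<^esub> h1 \<otimes>\<^bsub>G\<^esub> inv\<^bsub>G\<^esub> h2})"
      then obtain p r where pr: "p \<in> carrier G" "r \<in> carrier G" "q = p \<otimes>\<^bsub>G\<^esub> r \<otimes>\<^bsub>G\<^esub> inv\<^bsub>G\<^esub> p \<otimes>\<^bsub>G\<^esub> inv\<^bsub>G\<^esub> r"
        by auto
      have q: "q \<in> carrier G" using pr by simp
      have Cq: "?C q = \<one>\<^bsub>?A\<^esub>"
        using pr(1,2) C unfolding pr(3)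
        by (simp add: ab_cls_mult[OF gp] Cinv A.m_assoc A.mult_div_cancel)
      have "inv\<^bsub>G\<^esub> r \<otimes>\<^bsub>G\<^esub> (r \<otimes>\<^bsub>G\<^esub> p) = p"
        using pr(1,2) by (simp flip: G.m_assoc)
      \<comment> \<open>For the commutator q of p and r, multiplication by q exchanges r p and p r,
        which have the same value under \<sigma>.\<close>
      then have "q \<otimes>\<^bsub>G\<^esub> (r \<otimes>\<^bsub>G\<^esub> p) = p \<otimes>\<^bsub>G\<^esub> r"
        using pr by (simp add: G.m_assoc)
      then have "\<sigma> G q \<otimes>\<^bsub>?E\<^esub> \<sigma> G (r \<otimes>\<^bsub>G\<^esub> p) = \<sigma> G (r \<otimes>\<^bsub>G\<^esub> p)"
        using triv[OF q G.m_closed[OF pr(2,1)] Cq] comm[OF pr(1,2)] by simp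
      then have "\<sigma> G q = \<one>\<^bsub>?E\<^esub>"
        using \<sigma>c[OF q] \<sigma>c[OF G.m_closed[OF pr(2,1)]] by simp
      then show "q \<in> ?N" using q Cq by simp
    qed
    moreover have "h \<in> derived G (carrier G) #>\<^bsub>G\<^esub> h'"
      using h G.rcos_self[OF h(1) normal_imp_subgroup[OF derived_carrier_normal[OF gp]]] unfolding ab_cls_def by simp
    then obtain n where n: "n \<in> derived G (carrier G)" "h = n \<otimes>\<^bsub>G\<^esub> h'"
      by (auto simp: r_coset_def)
    ultimately have "n \<in> ?N" by blast
    then show ?thesis
      using triv[of n h'] h(2) \<sigma>c[OF h(2)] n(2) by simp
  qed
  \<comment> \<open>By \<open>fact\<close> the chosen representative does not matter.\<close>
  define s where "s G v = \<sigma> G (SOME h. h \<in> carrier G \<and> ab_cls G h = v)" for G v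
  have s_cls: "s G (ab_cls G h) = \<sigma> G h" if "G \<in> gr" "h \<in> carrier G" for G h
  proof -
    let ?h = "SOME h'. h' \<in> carrier G \<and> ab_cls G h' = ab_cls G h"
    have "?h \<in> carrier G \<and> ab_cls G ?h = ab_cls G h"
      by (rule someI[of _ h]) (use that in simp)
    then show ?thesis
      unfolding s_def using fact[OF that(1)] that(2) by blast
  qed
  have "sect k X s"
    unfolding sect_def
  proof (intro ballI conjI)
    fix G :: "'x monoid" and v assume G: "G \<in> gr" and v: "v \<in> carrier (Ab G)"
    note gp = gr_group[OF G]
    obtain h where h: "h \<in> carrier G" "v = ab_cls G h"
      using v carrier_abelianization[OF gp] by auto
    show "s G v \<in> carrier (ob (mid X) G)" "proj X G (s G v) = v"
      using h s_cls[OF G] \<sigma>_closed[OF G] \<sigma>_proj[OF G] by simp_all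
    show "s G v \<otimes>\<^bsub>ob (mid X) G\<^esub> s G w =
        s G (v \<otimes>\<^bsub>Ab G\<^esub> w) \<otimes>\<^bsub>ob (mid X) G\<^esub> incl X G (cocyc (Ab G) k v w)"
      if w: "w \<in> carrier (Ab G)" for w
    proof -
      obtain h' where h': "h' \<in> carrier G" "w = ab_cls G h'"
        using w carrier_abelianization[OF gp] by auto
      show ?thesis
        using rel[OF G h(1) h'(1)] s_cls[OF G] h h' monoid.m_closed[OF group.is_monoid[OF gp]]
        by (simp flip: ab_cls_mult[OF gp])
    qed
    show "ar (mid X) G H f (s G v) = s H (ar abelianization G H f v)" if "H \<in> gr" "f \<in> mor G H" for H f
      using h s_cls[OF G] s_cls[OF that(1)] \<sigma>_nat[OF G that h(1)] mor_closed[OF that(2) h(1)]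
        ar_abelianization(2)[OF gp gr_group[OF that(1)] that(2) h(1)] by simp
  qed
  then show ?thesis by blast
qed

end

section \<open>The group of extensions\<close>

text \<open>Explicit extensions have middle terms in a type of their own. Objectwise injections into
  the given infinite type, which exist by countability, carry over the group structure and all
  maps.\<close>

lemma transport_extn:
  fixes X :: "('x, 'f, 'a, 'q) extn"
  assumes X: "is_extn C Q F X" and C: "\<And>G. G \<in> C \<Longrightarrow> group G" and F: "ab_functor C F"
    and count: "\<And>G. G \<in> C \<Longrightarrow> countable (carrier (ob (mid X) G))" and inf: "infinite (UNIV :: 'e set)"
  shows "\<exists>Y :: ('x, 'f, 'e, 'q) extn. is_extn C Q F Y \<and> extn_equiv C Q F X Y"
proof -
  note Xf = is_extnD[OF X]
  have "\<exists>f :: 'a \<Rightarrow> 'e. inj_on f (carrier (ob (mid X) G))" if "G \<in> C" for G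
    using ex_inj_on_countable[OF count[OF that] inf] .
  then obtain \<iota> :: "'x monoid \<Rightarrow> 'a \<Rightarrow> 'e" where inj: "\<And>G. G \<in> C \<Longrightarrow> inj_on (\<iota> G) (carrier (ob (mid X) G))"
    by metis
  let ?j = "\<lambda>G. inv_into (carrier (ob (mid X) G)) (\<iota> G)"
  have j: "?j G (\<iota> G x) = x" if "G \<in> C" "x \<in> carrier (ob (mid X) G)" for G x
    using inj[OF that(1)] that(2) by simp
  define Y :: "('x, 'f, 'e, 'q) extn" where "Y =
    \<lparr>mid = \<lparr>ob = (\<lambda>G. transp (\<iota> G) (ob (mid X) G)),
            ar = (\<lambda>G H f. \<lambda>y\<in>\<iota> G ` carrier (ob (mid X) G). \<iota> H (ar (mid X) G H f (?j G y)))\<rparr>,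
     incl = (\<lambda>G. \<lambda>a\<in>carrier (ob F G). \<iota> G (incl X G a)),
     proj = (\<lambda>G. \<lambda>y\<in>\<iota> G ` carrier (ob (mid X) G). proj X G (?j G y))\<rparr>"
  have Yob: "ob (mid Y) G = transp (\<iota> G) (ob (mid X) G)" for G
    by (simp add: Y_def)
  have Yar: "ar (mid Y) G H f (\<iota> G x) = \<iota> H (ar (mid X) G H f x)" if "G \<in> C" "x \<in> carrier (ob (mid X) G)" for G H f x
    using that by (simp add: Y_def j)
  have Yincl: "incl Y G a = \<iota> G (incl X G a)" if "a \<in> carrier (ob F G)" for G a
    using that by (simp add: Y_def)
  have Yproj: "proj Y G (\<iota> G x) = proj X G x" if "G \<in> C" "x \<in> carrier (ob (mid X) G)" for G x
    using that by (simp add: Y_def j)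
  have tm: "\<iota> G x \<otimes>\<^bsub>ob (mid Y) G\<^esub> \<iota> G y = \<iota> G (x \<otimes>\<^bsub>ob (mid X) G\<^esub> y)"
    if "G \<in> C" "x \<in> carrier (ob (mid X) G)" "y \<in> carrier (ob (mid X) G)" for G x y
    unfolding Yob using transp_mult[OF inj[OF that(1)] that(2,3)] .
  have mX: "x \<otimes>\<^bsub>ob (mid X) G\<^esub> y \<in> carrier (ob (mid X) G)"
    if "G \<in> C" "x \<in> carrier (ob (mid X) G)" "y \<in> carrier (ob (mid X) G)" for G x y
    using that monoid.m_closed[OF group.is_monoid[OF comm_group_group[OF Xf(1)[OF that(1)]]]] by blast
  have iso: "(\<lambda>x\<in>carrier (ob (mid X) G). \<iota> G x) \<in> iso (ob (mid X) G) (ob (mid Y) G)" if G: "G \<in> C" for G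
  proof -
    have "(\<lambda>x\<in>carrier (ob (mid X) G). \<iota> G x) \<in> hom (ob (mid X) G) (ob (mid Y) G)"
      by (rule homI) (simp_all add: Yob[of G] tm[OF G, unfolded Yob] mX[OF G])
    then show ?thesis
      using inj[OF G] by (simp add: iso_def bij_betw_def Yob inj_on_def)
  qed
  have func: "ab_functor C (mid Y)"
  proof (rule ab_functorI)
    show "comm_group (ob (mid Y) G)" if "G \<in> C" for G
      unfolding Yob by (rule comm_group_transp[OF Xf(1)[OF that] inj[OF that]])
    show "ar (mid Y) G H f \<in> mor (ob (mid Y) G) (ob (mid Y) H)" if *: "G \<in> C" "H \<in> C" "f \<in> mor G H" for G H f
    proof -
      note a = Xf(8)[OF *]
      have "ar (mid Y) G H f \<in> hom (ob (mid Y) G) (ob (mid Y) H)"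
      proof (rule homI)
        fix x assume "x \<in> carrier (ob (mid Y) G)"
        then show "ar (mid Y) G H f x \<in> carrier (ob (mid Y) H)"
          using mor_closed[OF a] Yar[OF *(1)] by (auto simp: Yob)
      next
        fix x y assume "x \<in> carrier (ob (mid Y) G)" "y \<in> carrier (ob (mid Y) G)"
        then obtain x' y' where x: "x = \<iota> G x'" "x' \<in> carrier (ob (mid X) G)" and y: "y = \<iota> G y'" "y' \<in> carrier (ob (mid X) G)"
          by (auto simp: Yob)
        show "ar (mid Y) G H f (x \<otimes>\<^bsub>ob (mid Y) G\<^esub> y) = ar (mid Y) G H f x \<otimes>\<^bsub>ob (mid Y) H\<^esub> ar (mid Y) G H f y"
          unfolding x(1) y(1) using x(2) y(2) mor_closed[OF a] mor_mult[OF a] mX[OF *(1)]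
          by (simp add: tm[OF *(1)] tm[OF *(2)] Yar[OF *(1)])
      qed
      then show ?thesis by (simp add: mor_def Y_def)
    qed
    have fX: "ab_functor C (mid X)" using X by (simp add: is_extn_def)
    show "ar (mid Y) G G (\<lambda>x\<in>carrier G. x) x = x" if "G \<in> C" "x \<in> carrier (ob (mid Y) G)" for G x
      using that Yar[OF that(1)] ab_functorD(4)[OF fX that(1)] by (auto simp: Yob)
    show "ar (mid Y) G K (compose (carrier G) h f) x = ar (mid Y) H K h (ar (mid Y) G H f x)"
      if *: "G \<in> C" "H \<in> C" "K \<in> C" "f \<in> mor G H" "h \<in> mor H K" and x: "x \<in> carrier (ob (mid Y) G)" for G H K f h x
      using x mor_closed[OF Xf(8)[OF *(1,2,4)]] ab_functorD(5)[OF fX *(1-5)] by (auto simp: Yob Yar[OF *(1)] Yar[OF *(2)])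
  qed (rule C)
  have Fm: "incl Y G \<in> mor (ob F G) (ob (mid Y) G)" if G: "G \<in> C" for G
  proof -
    note i = Xf(2)[OF G] and FG = group.is_monoid[OF ab_functorD(2)[OF F G]]
    have "incl Y G \<in> hom (ob F G) (ob (mid Y) G)"
    proof (rule homI)
      show "incl Y G a \<in> carrier (ob (mid Y) G)" if "a \<in> carrier (ob F G)" for a
        using mor_closed[OF i that] by (simp add: Yincl[OF that] Yob)
      show "incl Y G (a \<otimes>\<^bsub>ob F G\<^esub> b) = incl Y G a \<otimes>\<^bsub>ob (mid Y) G\<^esub> incl Y G b"
        if "a \<in> carrier (ob F G)" "b \<in> carrier (ob F G)" for a b
        using mor_mult[OF i that] mor_closed[OF i that(1)] mor_closed[OF i that(2)]
        by (simp add: Yincl that monoid.m_closed[OF FG] tm[OF G])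
    qed
    then show ?thesis by (simp add: mor_def Y_def)
  qed
  have Qm: "proj Y G \<in> mor (ob (mid Y) G) (ob Q G)" if G: "G \<in> C" for G
  proof -
    note p = Xf(4)[OF G]
    have "proj Y G \<in> hom (ob (mid Y) G) (ob Q G)"
    proof (rule homI)
      show "proj Y G x \<in> carrier (ob Q G)" if "x \<in> carrier (ob (mid Y) G)" for x
        using that mor_closed[OF p] by (auto simp: Yob Yproj[OF G])
      fix x y assume "x \<in> carrier (ob (mid Y) G)" "y \<in> carrier (ob (mid Y) G)"
      then obtain x' y' where x: "x = \<iota> G x'" "x' \<in> carrier (ob (mid X) G)" and y: "y = \<iota> G y'" "y' \<in> carrier (ob (mid X) G)"
        by (auto simp: Yob)
      show "proj Y G (x \<otimes>\<^bsub>ob (mid Y) G\<^esub> y) = proj Y G x \<otimes>\<^bsub>ob Q G\<^esub> proj Y G y"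
        unfolding x(1) y(1) using x(2) y(2) mor_mult[OF p] mX[OF G]
        by (simp add: tm[OF G] Yproj[OF G])
    qed
    then show ?thesis by (simp add: mor_def Y_def Yob)
  qed
  have Fnat: "incl Y H (ar F G H f a) = ar (mid Y) G H f (incl Y G a)"
    if *: "G \<in> C" "H \<in> C" "f \<in> mor G H" "a \<in> carrier (ob F G)" for G H f a
    using Xf(9)[OF *] mor_closed[OF Xf(2)[OF *(1)] *(4)] mor_closed[OF ab_functorD(3)[OF F *(1-3)] *(4)]
    by (simp add: Yincl *(4) Yar[OF *(1)])
  have Qnat: "proj Y H (ar (mid Y) G H f x) = ar Q G H f (proj Y G x)"
    if *: "G \<in> C" "H \<in> C" "f \<in> mor G H" "x \<in> carrier (ob (mid Y) G)" for G H f x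
  proof -
    obtain x' where x: "x = \<iota> G x'" "x' \<in> carrier (ob (mid X) G)"
      using *(4) by (auto simp: Yob)
    show ?thesis
      unfolding x(1) using Xf(10)[OF *(1-3) x(2)] mor_closed[OF Xf(8)[OF *(1-3)] x(2)]
      by (simp add: Yar[OF *(1) x(2)] Yproj[OF *(1) x(2)] Yproj[OF *(2)])
  qed
  have "is_extn C Q F Y"
    unfolding is_extn_def
  proof (intro conjI ballI func nat_transI Fm Qm Fnat Qnat)
    fix G assume G: "G \<in> C"
    have "inj_on (incl Y G) (carrier (ob F G))"
    proof (rule inj_onI)
      fix a b assume ab: "a \<in> carrier (ob F G)" "b \<in> carrier (ob F G)" "incl Y G a = incl Y G b"
      then have "incl X G a = incl X G b"
        using inj_onD[OF inj[OF G]] mor_closed[OF Xf(2)[OF G]] by (simp add: Yincl)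
      then show "a = b"
        using inj_onD[OF Xf(3)[OF G]] ab by simp
    qed
    then show "incl Y G \<in> mon (ob F G) (ob (mid Y) G)"
      using morD[OF Fm[OF G]] by (simp add: mon_def)
    show "incl Y G ` carrier (ob F G) = kernel (ob (mid Y) G) (ob Q G) (proj Y G)"
    proof (rule Set.set_eqI)
      fix y
      have "y \<in> kernel (ob (mid Y) G) (ob Q G) (proj Y G) \<longleftrightarrow>
          (\<exists>x\<in>carrier (ob (mid X) G). y = \<iota> G x \<and> proj X G x = \<one>\<^bsub>ob Q G\<^esub>)"
        by (auto simp: kernel_def Yob Yproj[OF G])
      also have "\<dots> \<longleftrightarrow> (\<exists>a\<in>carrier (ob F G). y = \<iota> G (incl X G a))"
        using Xf(6)[OF G] Xf(7)[OF G] mor_closed[OF Xf(2)[OF G]] by metis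
      finally show "y \<in> incl Y G ` carrier (ob F G) \<longleftrightarrow> y \<in> kernel (ob (mid Y) G) (ob Q G) (proj Y G)"
        by (auto simp: Yincl image_iff)
    qed
    have "proj Y G ` carrier (ob (mid Y) G) = proj X G ` carrier (ob (mid X) G)"
      using Yproj[OF G] by (auto simp: Yob image_image)
    then show "proj Y G \<in> epi (ob (mid Y) G) (ob Q G)"
      using morD[OF Qm[OF G]] Xf(5)[OF G] by (simp add: epi_def)
  qed
  moreover have "extn_equiv C Q F X Y"
    unfolding extn_equiv_def
  proof (intro exI conjI ballI)
    let ?\<eta> = "\<lambda>G. \<lambda>x\<in>carrier (ob (mid X) G). \<iota> G x"
    show "nat_trans C (mid X) (mid Y) ?\<eta>"
    proof (rule nat_transI)
      show "?\<eta> G \<in> mor (ob (mid X) G) (ob (mid Y) G)" if "G \<in> C" for G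
        using iso[OF that] by (simp add: mor_def iso_def)
      show "?\<eta> H (ar (mid X) G H f x) = ar (mid Y) G H f (?\<eta> G x)"
        if *: "G \<in> C" "H \<in> C" "f \<in> mor G H" "x \<in> carrier (ob (mid X) G)" for G H f x
        using mor_closed[OF Xf(8)[OF *(1-3)] *(4)] *(4) by (simp add: Yar[OF *(1)])
    qed
    fix G assume G: "G \<in> C"
    show "?\<eta> G \<in> iso (ob (mid X) G) (ob (mid Y) G)" by (rule iso[OF G])
    show "?\<eta> G (incl X G a) = incl Y G a" if "a \<in> carrier (ob F G)" for a
      using mor_closed[OF Xf(2)[OF G] that] that by (simp add: Yincl)
    show "proj Y G (?\<eta> G x) = proj X G x" if "x \<in> carrier (ob (mid X) G)" for x
      using that by (simp add: Yproj[OF G])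
  qed
  ultimately show ?thesis by blast
qed

context choose_gcd
begin

lemma countable_gr:
  assumes "G \<in> gr" shows "countable (carrier G)"
proof -
  obtain S where "finite S" "generate G S = carrier G"
    using assms by (auto simp: gr_def)
  then show ?thesis
    by (metis countable_finite countable_generate)
qed

lemma countable_twist:
  assumes G: "G \<in> gr"
  shows "countable (carrier (ob (mid (twist k)) G))"
proof -
  have "countable (carrier (Ab G))"
    using countable_gr[OF G] by (simp add: carrier_abelianization[OF gr_group[OF G]])
  then show ?thesis
    using countable_sym_pow[OF ab(1)[OF G]] by simp
qed

text \<open>For k = 0 the cocycle is trivial and the middle terms have the same underlying sets, so
  the identity is an equivalence.\<close>

lemma twist_zero_equiv_split:
  "ab_extn_equiv (twist 0) (split_extn abelianization sym_ab)"
  unfolding extn_equiv_def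
proof (intro exI conjI ballI)
  let ?\<eta> = "\<lambda>G. \<lambda>x\<in>carrier (ob (mid (twist 0)) G). x"
  let ?S = "split_extn abelianization sym_ab"
  have Sob: "ob (mid ?S) G = SymAb G \<times>\<times> Ab G" for G
    by (simp add: split_extn_def)
  show iso: "?\<eta> G \<in> iso (ob (mid (twist 0)) G) (ob (mid ?S) G)" if G: "G \<in> gr" for G
  proof -
    interpret S: comm_group "Sym d (Ab G)" by (rule comm_group_sym_pow[OF ab(1)[OF G]])
    interpret A: comm_group "Ab G" by (rule ab(1)[OF G])
    have "?\<eta> G \<in> hom (ob (mid (twist 0)) G) (ob (mid ?S) G)"
      by (rule homI) (auto simp: Sob sym_ab_simps cocyc_zero[OF ab(1)[OF G]])
    then show ?thesis
      by (simp add: iso_def bij_betw_def Sob sym_ab_simps inj_on_def)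
  qed
  show "nat_trans gr (mid (twist 0)) (mid ?S) ?\<eta>"
  proof (rule nat_transI)
    show "?\<eta> G \<in> mor (ob (mid (twist 0)) G) (ob (mid ?S) G)" if "G \<in> gr" for G
      using iso[OF that] by (simp add: mor_def iso_def)
    show "?\<eta> H (ar (mid (twist 0)) G H f x) = ar (mid ?S) G H f (?\<eta> G x)"
      if *: "G \<in> gr" "H \<in> gr" "f \<in> mor G H" "x \<in> carrier (ob (mid (twist 0)) G)" for G H f x
    proof -
      obtain a v where x: "x = (a, v)" "a \<in> carrier (SymAb G)" "v \<in> carrier (Ab G)"
        using *(4) by (auto simp: sym_ab_simps)
      have "(ar sym_ab G H f a, ar abelianization G H f v) \<in> carrier (ob (mid (twist 0)) H)"
        using mor_closed[OF ab(3)[OF *(1-3)] x(3)] mor_closed[OF sym_ab(3)[OF *(1-3)] x(2)]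
        by (simp add: sym_ab_simps)
      moreover have "ar (mid ?S) G H f (a, v) = (ar sym_ab G H f a, ar abelianization G H f v)"
        using x by (simp add: split_extn_def)
      ultimately show ?thesis
        using *(4) by (simp only: x twist_simps(2)[OF x(2,3)] restrict_apply if_True)
    qed
  qed
  fix G :: "'a monoid" assume G: "G \<in> gr"
  interpret A: comm_group "Ab G" by (rule ab(1)[OF G])
  show "?\<eta> G (incl (twist 0) G a) = incl ?S G a" if "a \<in> carrier (SymAb G)" for a
    using that by (simp add: split_extn_def sym_ab_simps)
  show "proj ?S G (?\<eta> G x) = proj (twist 0) G x" if "x \<in> carrier (ob (mid (twist 0)) G)" for x
    using that by (auto simp: split_extn_def sym_ab_simps twist_def)
qed

end

section \<open>The Baer sum of two extensions with sections\<close>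

lemma (in comm_group) coset_eq_iff:
  assumes "subgroup N G" "x \<in> carrier G" "y \<in> carrier G"
  shows "N #> x = N #> y \<longleftrightarrow> (\<exists>n\<in>N. x = n \<otimes> y)"
  using assms repr_independence[of x N y] rcos_self[of x N] by (auto simp: r_coset_def)

context choose_gcd
begin

context
  fixes X Y :: "('x, 'e) ab_extn" and k l s s'
  assumes X: "is_ab_extn X" and Y: "is_ab_extn Y"
    and s: "sect k X s" and s': "sect l Y s'"
begin

lemma baer_pb_simps:
  "(x, y) \<otimes>\<^bsub>baer_pb X Y G\<^esub> (x', y') = (x \<otimes>\<^bsub>ob (mid X) G\<^esub> x', y \<otimes>\<^bsub>ob (mid Y) G\<^esub> y')"
  "\<one>\<^bsub>baer_pb X Y G\<^esub> = (\<one>\<^bsub>ob (mid X) G\<^esub>, \<one>\<^bsub>ob (mid Y) G\<^esub>)"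
  "(x, y) \<in> carrier (baer_pb X Y G) \<longleftrightarrow>
     x \<in> carrier (ob (mid X) G) \<and> y \<in> carrier (ob (mid Y) G) \<and> proj X G x = proj Y G y"
  by (simp_all add: baer_pb_def DirProd_def)

context
  fixes G :: "'x monoid"
  assumes G: "G \<in> gr"
begin

abbreviation (input) "BS \<equiv> ob (mid (baer_sum sym_ab X Y)) G"
abbreviation (input) "TW \<equiv> ob (mid (twist (k + l))) G"
abbreviation (input) "MX \<equiv> ob (mid X) G"
abbreviation (input) "MY \<equiv> ob (mid Y) G"
abbreviation (input) "PB \<equiv> baer_pb X Y G"
abbreviation (input) "AD \<equiv> baer_antidiag sym_ab X Y G"
abbreviation (input) "SG \<equiv> SymAb G"
abbreviation (input) "AG \<equiv> Ab G"

interpretation S: comm_group "SG" by (rule sym_ab(1)[OF G])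
interpretation A: comm_group "AG" by (rule ab(1)[OF G])
interpretation E: comm_group "MX" by (rule is_extnD(1)[OF X G])
interpretation E': comm_group "MY" by (rule is_extnD(1)[OF Y G])

lemmas baer_X = is_extnD[OF X G]
lemmas baer_Y = is_extnD[OF Y G]
lemmas baer_X_simps = mor_closed[OF baer_X(2)] mor_mult[OF baer_X(2)] mor_mult[OF baer_X(4)] baer_X(6)
lemmas baer_Y_simps = mor_closed[OF baer_Y(2)] mor_mult[OF baer_Y(2)] mor_mult[OF baer_Y(4)] baer_Y(6)

lemma comm_group_baer_pb: "comm_group PB"
proof (rule comm_groupI)
  fix p q r assume pqr: "p \<in> carrier PB" "q \<in> carrier PB" "r \<in> carrier PB"
  obtain x y where p: "p = (x, y)" "x \<in> carrier MX" "y \<in> carrier MY" "proj X G x = proj Y G y"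
    using pqr(1) by (cases p) (auto simp: baer_pb_simps)
  obtain x' y' where q: "q = (x', y')" "x' \<in> carrier MX" "y' \<in> carrier MY" "proj X G x' = proj Y G y'"
    using pqr(2) by (cases q) (auto simp: baer_pb_simps)
  obtain x'' y'' where r: "r = (x'', y'')" "x'' \<in> carrier MX" "y'' \<in> carrier MY"
    using pqr(3) by (cases r) (auto simp: baer_pb_simps)
  show "p \<otimes>\<^bsub>PB\<^esub> q \<in> carrier PB"
    using p q by (simp add: baer_pb_simps baer_X_simps baer_Y_simps)
  show "p \<otimes>\<^bsub>PB\<^esub> q \<otimes>\<^bsub>PB\<^esub> r = p \<otimes>\<^bsub>PB\<^esub> (q \<otimes>\<^bsub>PB\<^esub> r)"
    using p q r by (simp add: baer_pb_simps E.m_assoc E'.m_assoc)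
  show "p \<otimes>\<^bsub>PB\<^esub> q = q \<otimes>\<^bsub>PB\<^esub> p"
    using p q by (simp add: baer_pb_simps E.m_comm E'.m_comm)
  show "\<one>\<^bsub>PB\<^esub> \<otimes>\<^bsub>PB\<^esub> p = p"
    using p by (simp add: baer_pb_simps)
  show "\<exists>q\<in>carrier PB. q \<otimes>\<^bsub>PB\<^esub> p = \<one>\<^bsub>PB\<^esub>"
    using p by (intro bexI[of _ "(inv\<^bsub>MX\<^esub> x, inv\<^bsub>MY\<^esub> y)"])
      (simp_all add: baer_pb_simps mor_inv[OF baer_X(4)] mor_inv[OF baer_Y(4)] E.is_group E'.is_group A.is_group)
qed (simp add: baer_pb_simps mor_one[OF baer_X(4)] mor_one[OF baer_Y(4)] E.is_group E'.is_group A.is_group)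

interpretation PB: comm_group "PB" by (rule comm_group_baer_pb)

text \<open>The antidiagonal is the image of a homomorphism, because inversion is one in an abelian
  group.\<close>

lemma baer_antidiag_subgroup: "subgroup AD PB"
proof -
  have "(\<lambda>a. (incl X G a, incl Y G (inv\<^bsub>SG\<^esub> a))) \<in> hom SG PB"
    by (rule homI) (simp_all add: baer_pb_simps baer_X_simps baer_Y_simps S.inv_mult)
  then have "subgroup ((\<lambda>a. (incl X G a, incl Y G (inv\<^bsub>SG\<^esub> a))) ` carrier SG) PB"
    by (intro group_hom.img_is_subgroup group_homI S.is_group PB.is_group)
  then show ?thesis
    by (simp add: baer_antidiag_def setcompr_eq_image)
qed

lemma baer_antidiag_normal: "AD \<lhd> PB"
  using PB.subgroup_imp_normal[OF baer_antidiag_subgroup] .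

abbreviation (input) baer_coset where "baer_coset p \<equiv> AD #>\<^bsub>PB\<^esub> p"

lemma baer_coset_eq_iff:
  assumes "p \<in> carrier PB" "q \<in> carrier PB"
  shows "baer_coset p = baer_coset q \<longleftrightarrow> (\<exists>t\<in>carrier SG.
     p = (incl X G t, incl Y G (inv\<^bsub>SG\<^esub> t)) \<otimes>\<^bsub>PB\<^esub> q)"
  unfolding PB.coset_eq_iff[OF baer_antidiag_subgroup assms] by (auto simp: baer_antidiag_def)

lemma baer_coset_eqI:
  assumes "p \<in> carrier PB" "q \<in> carrier PB" "t \<in> carrier SG"
    "p = (incl X G t, incl Y G (inv\<^bsub>SG\<^esub> t)) \<otimes>\<^bsub>PB\<^esub> q"
  shows "baer_coset p = baer_coset q"
  using baer_coset_eq_iff[OF assms(1,2)] assms(3,4) by blast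

lemma baer_ob: "BS = PB Mod AD"
  by (simp add: baer_sum_def)

text \<open>The antidiagonal projects to the unit, so the projection is constant on each coset and
  \<open>the_elem\<close> is meaningful.\<close>

lemma baer_proj:
  assumes "(x, y) \<in> carrier PB"
  shows "proj (baer_sum sym_ab X Y) G (baer_coset (x, y)) = proj X G x"
proof -
  have "(\<lambda>(x, y). proj X G x) ` baer_coset (x, y) = {proj X G x}"
  proof -
    have "proj X G x' = proj X G x" if m: "(x', y') \<in> baer_coset (x, y)" for x' y'
    proof -
      obtain t where "t \<in> carrier SG" "x' = incl X G t \<otimes>\<^bsub>MX\<^esub> x"
        using m by (auto simp: r_coset_def baer_antidiag_def baer_pb_simps)
      then show ?thesis
        using assms baer_X_simps mor_closed[OF baer_Y(4)] by (simp add: baer_pb_simps)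
    qed
    then have "(\<lambda>(x, y). proj X G x) ` baer_coset (x, y) = (\<lambda>_. proj X G x) ` baer_coset (x, y)"
      by (intro image_cong) (auto split: prod.split)
    also have "\<dots> = {proj X G x}"
      by (rule image_constant[OF PB.rcos_self[OF assms baer_antidiag_subgroup]])
    finally show ?thesis .
  qed
  moreover have "baer_coset (x, y) \<in> carrier (PB Mod AD)"
    using assms by (auto simp: carrier_FactGroup)
  ultimately show ?thesis
    by (simp add: baer_sum_def)
qed

text \<open>The pair of s and s' is a section of the pullback with one cocycle in each component.
  Modulo the antidiagonal the second cocycle can be moved into the first component, where the two
  add up to the multiple k + l.\<close>

definition baer_iso where
  "baer_iso = (\<lambda>(a, v)\<in>carrier TW. baer_coset (incl X G a \<otimes>\<^bsub>MX\<^esub> s G v, s' G v))"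

lemmas sX = sectD[OF s G]
lemmas sY = sectD[OF s' G]

lemma baer_rep_closed:
  assumes "a \<in> carrier SG" "v \<in> carrier AG"
  shows "(incl X G a \<otimes>\<^bsub>MX\<^esub> s G v, s' G v) \<in> carrier PB"
  using assms sX(1,2)[OF assms(2)] sY(1,2)[OF assms(2)] by (simp add: baer_pb_simps baer_X_simps)

lemma baer_iso_apply:
  assumes "a \<in> carrier SG" "v \<in> carrier AG"
  shows "baer_iso (a, v) = baer_coset (incl X G a \<otimes>\<^bsub>MX\<^esub> s G v, s' G v)"
  using assms by (simp add: baer_iso_def sym_ab_simps)

lemma baer_iso_iso: "baer_iso \<in> iso TW BS"
proof -
  interpret N: normal "AD" "PB" by (rule baer_antidiag_normal)
  have h: "baer_iso \<in> hom TW BS"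
  proof (rule homI)
    fix p assume "p \<in> carrier TW"
    then obtain a v where p: "p = (a, v)" "a \<in> carrier SG" "v \<in> carrier AG"
      by (auto simp: sym_ab_simps)
    show "baer_iso p \<in> carrier BS"
      using baer_rep_closed[OF p(2,3)] by (auto simp: p(1) baer_iso_apply[OF p(2,3)] baer_ob carrier_FactGroup)
  next
    fix p q assume "p \<in> carrier TW" "q \<in> carrier TW"
    then obtain a v b w where p: "p = (a, v)" "a \<in> carrier SG" "v \<in> carrier AG"
      and q: "q = (b, w)" "b \<in> carrier SG" "w \<in> carrier AG"
      by (auto simp: sym_ab_simps)
    let ?ck = "cocyc AG k v w" and ?cl = "cocyc AG l v w"
    let ?ab = "a \<otimes>\<^bsub>SG\<^esub> b" and ?vw = "v \<otimes>\<^bsub>AG\<^esub> w"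
    note ck = cocyc_sym_ab_closed[OF G, of k v w] and cl = cocyc_sym_ab_closed[OF G, of l v w]
    have abS: "?ab \<in> carrier SG" and vw: "?vw \<in> carrier AG"
      and abc: "?ab \<otimes>\<^bsub>SG\<^esub> (?ck \<otimes>\<^bsub>SG\<^esub> ?cl) \<in> carrier SG"
      using p q ck cl by simp_all
    have pq: "p \<otimes>\<^bsub>TW\<^esub> q = (?ab \<otimes>\<^bsub>SG\<^esub> (?ck \<otimes>\<^bsub>SG\<^esub> ?cl), ?vw)"
      by (simp add: p(1) q(1) sym_ab_simps cocyc_add[OF ab(1)[OF G]])
    let ?P = "(incl X G a \<otimes>\<^bsub>MX\<^esub> s G v, s' G v)" and ?Q = "(incl X G b \<otimes>\<^bsub>MX\<^esub> s G w, s' G w)"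
    let ?R = "(incl X G (?ab \<otimes>\<^bsub>SG\<^esub> (?ck \<otimes>\<^bsub>SG\<^esub> ?cl)) \<otimes>\<^bsub>MX\<^esub> s G ?vw, s' G ?vw)"
    note P = baer_rep_closed[OF p(2,3)] and Q = baer_rep_closed[OF q(2,3)] and R = baer_rep_closed[OF abc vw]
    have PQ: "?P \<otimes>\<^bsub>PB\<^esub> ?Q = (incl X G ?ab \<otimes>\<^bsub>MX\<^esub> incl X G ?ck \<otimes>\<^bsub>MX\<^esub> s G ?vw,
        incl Y G ?cl \<otimes>\<^bsub>MY\<^esub> s' G ?vw)"
    proof -
      have "incl X G a \<otimes>\<^bsub>MX\<^esub> s G v \<otimes>\<^bsub>MX\<^esub> (incl X G b \<otimes>\<^bsub>MX\<^esub> s G w)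
          = incl X G ?ab \<otimes>\<^bsub>MX\<^esub> (s G v \<otimes>\<^bsub>MX\<^esub> s G w)"
        using p q sX(1) by (simp add: baer_X_simps E.m_ac)
      then show ?thesis
        using sX(1)[OF vw] sY(1)[OF vw] sX(3)[OF p(3) q(3)] sY(3)[OF p(3) q(3)] baer_X_simps(1)[OF abS]
          baer_X_simps(1)[OF ck] baer_Y_simps(1)[OF cl]
        by (simp add: baer_pb_simps E.m_ac E'.m_comm)
    qed
    \<comment> \<open>Multiplication by the antidiagonal element of the second cocycle removes it
      from the second component and adds it to the first.\<close>
    have rel: "?R = (incl X G ?cl, incl Y G (inv\<^bsub>SG\<^esub> ?cl)) \<otimes>\<^bsub>PB\<^esub> (?P \<otimes>\<^bsub>PB\<^esub> ?Q)"
    proof -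
      have 1: "incl X G (?ab \<otimes>\<^bsub>SG\<^esub> (?ck \<otimes>\<^bsub>SG\<^esub> ?cl)) \<otimes>\<^bsub>MX\<^esub> s G ?vw
          = incl X G ?cl \<otimes>\<^bsub>MX\<^esub> (incl X G ?ab \<otimes>\<^bsub>MX\<^esub> incl X G ?ck \<otimes>\<^bsub>MX\<^esub> s G ?vw)"
        using abS ck cl sX(1)[OF vw] baer_X_simps(1)[OF abS] baer_X_simps(1)[OF ck] baer_X_simps(1)[OF cl]
        by (simp add: baer_X_simps(2) E.m_ac)
      have "incl Y G (inv\<^bsub>SG\<^esub> ?cl) \<otimes>\<^bsub>MY\<^esub> incl Y G ?cl = \<one>\<^bsub>MY\<^esub>"
        using cl mor_one[OF baer_Y(2) S.is_group E'.is_group] by (simp flip: baer_Y_simps(2))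
      then have 2: "s' G ?vw = incl Y G (inv\<^bsub>SG\<^esub> ?cl) \<otimes>\<^bsub>MY\<^esub> (incl Y G ?cl \<otimes>\<^bsub>MY\<^esub> s' G ?vw)"
        using cl sY(1)[OF vw] baer_Y_simps(1) by (simp flip: E'.m_assoc)
      show ?thesis
        unfolding PQ unfolding baer_pb_simps 1[symmetric] 2[symmetric] ..
    qed
    have "baer_coset ?R = baer_coset (?P \<otimes>\<^bsub>PB\<^esub> ?Q)"
      by (rule baer_coset_eqI[OF R PB.m_closed[OF P Q] cl rel])
    then show "baer_iso (p \<otimes>\<^bsub>TW\<^esub> q)
        = baer_iso p \<otimes>\<^bsub>BS\<^esub> baer_iso q"
      unfolding pq by (simp add: p(1) q(1) baer_iso_apply[OF abc vw] baer_iso_apply[OF p(2,3)]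
          baer_iso_apply[OF q(2,3)] baer_ob N.rcos_sum[OF P Q])
  qed
  moreover have "inj_on baer_iso (carrier TW)"
  proof (rule inj_onI)
    fix p q assume "p \<in> carrier TW" "q \<in> carrier TW"
      and eq: "baer_iso p = baer_iso q"
    then obtain a v b w where p: "p = (a, v)" "a \<in> carrier SG" "v \<in> carrier AG"
      and q: "q = (b, w)" "b \<in> carrier SG" "w \<in> carrier AG"
      by (auto simp: sym_ab_simps)
    obtain t where t: "t \<in> carrier SG"
      "incl X G a \<otimes>\<^bsub>MX\<^esub> s G v = incl X G t \<otimes>\<^bsub>MX\<^esub> (incl X G b \<otimes>\<^bsub>MX\<^esub> s G w)"
      "s' G v = incl Y G (inv\<^bsub>SG\<^esub> t) \<otimes>\<^bsub>MY\<^esub> s' G w"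
      using eq baer_coset_eq_iff[OF baer_rep_closed[OF p(2,3)] baer_rep_closed[OF q(2,3)]]
      unfolding p(1) q(1) baer_iso_apply[OF p(2,3)] baer_iso_apply[OF q(2,3)] baer_pb_simps by auto
    have it: "inv\<^bsub>SG\<^esub> t \<in> carrier SG" using t(1) by simp
    \<comment> \<open>Projection yields v = w; the second component then shows that t is trivial,
      and the first that a = b.\<close>
    have "proj Y G (s' G v) = proj Y G (s' G w)"
      using t(1) sY(1,2)[OF q(3)] q(3) it by (subst t(3)) (simp add: baer_Y_simps)
    then have vw: "v = w" using sY(2) p q by simp
    then have "incl Y G (inv\<^bsub>SG\<^esub> t) = \<one>\<^bsub>MY\<^esub>"
      using t(3) sY(1)[OF q(3)] baer_Y_simps(1)[OF it] by simp
    then have "incl Y G (inv\<^bsub>SG\<^esub> t) = incl Y G \<one>\<^bsub>SG\<^esub>"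
      using mor_one[OF baer_Y(2) S.is_group E'.is_group] by simp
    then have "inv\<^bsub>SG\<^esub> t = \<one>\<^bsub>SG\<^esub>"
      using inj_onD[OF baer_Y(3)] it by blast
    then have "t = \<one>\<^bsub>SG\<^esub>" using t(1) by simp
    then have "incl X G a = incl X G b"
      using t(2) vw sX(1)[OF q(3)] baer_X_simps(1) p q mor_one[OF baer_X(2) S.is_group E.is_group] by simp
    then have "a = b"
      using inj_onD[OF baer_X(3)] p q by blast
    with vw show "p = q" using p q by simp
  qed
  moreover have "carrier BS \<subseteq> baer_iso ` carrier TW"
  proof
    fix c assume "c \<in> carrier BS"
    then obtain x y where c: "c = baer_coset (x, y)" and xy: "(x, y) \<in> carrier PB"
      by (auto simp: baer_ob carrier_FactGroup)
    let ?v = "proj X G x"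
    have x: "x \<in> carrier MX" and y: "y \<in> carrier MY" and v: "?v \<in> carrier AG"
      and yv: "proj Y G y = ?v"
      using xy mor_closed[OF baer_Y(4)] by (auto simp: baer_pb_simps)
    have x': "x \<otimes>\<^bsub>MX\<^esub> inv\<^bsub>MX\<^esub> s G ?v \<in> carrier MX"
      using x sX(1)[OF v] by simp
    have "proj X G (x \<otimes>\<^bsub>MX\<^esub> inv\<^bsub>MX\<^esub> s G ?v) = \<one>\<^bsub>AG\<^esub>"
      using x sX(1,2)[OF v] v by (simp add: baer_X_simps mor_inv[OF baer_X(4) E.is_group A.is_group])
    then obtain r where r: "r \<in> carrier SG" "x \<otimes>\<^bsub>MX\<^esub> inv\<^bsub>MX\<^esub> s G ?v = incl X G r"
      using baer_X(7)[OF x'] by blast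
    have y': "y \<otimes>\<^bsub>MY\<^esub> inv\<^bsub>MY\<^esub> s' G ?v \<in> carrier MY"
      using y sY(1)[OF v] by simp
    have "proj Y G (y \<otimes>\<^bsub>MY\<^esub> inv\<^bsub>MY\<^esub> s' G ?v) = \<one>\<^bsub>AG\<^esub>"
      using y sY(1,2)[OF v] v yv by (simp add: baer_Y_simps mor_inv[OF baer_Y(4) E'.is_group A.is_group])
    then obtain u where u: "u \<in> carrier SG" "y \<otimes>\<^bsub>MY\<^esub> inv\<^bsub>MY\<^esub> s' G ?v = incl Y G u"
      using baer_Y(7)[OF y'] by blast
    have xr: "x = incl X G r \<otimes>\<^bsub>MX\<^esub> s G ?v"
      unfolding r(2)[symmetric] using x sX(1)[OF v] by (simp add: E.m_assoc)
    have yu: "y = incl Y G u \<otimes>\<^bsub>MY\<^esub> s' G ?v"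
      unfolding u(2)[symmetric] using y sY(1)[OF v] by (simp add: E'.m_assoc)
    \<comment> \<open>The antidiagonal carries u over to the first component and leaves only the
      section in the second.\<close>
    let ?a = "u \<otimes>\<^bsub>SG\<^esub> r"
    have a: "?a \<in> carrier SG" using u r by simp
    have iu: "inv\<^bsub>SG\<^esub> u \<in> carrier SG" using u(1) by simp
    have "inv\<^bsub>SG\<^esub> u \<otimes>\<^bsub>SG\<^esub> ?a = r"
      using u(1) r(1) by (simp flip: S.m_assoc)
    then have "incl X G r = incl X G (inv\<^bsub>SG\<^esub> u) \<otimes>\<^bsub>MX\<^esub> incl X G ?a"
      using baer_X_simps(2)[OF iu a] by simp
    then have rel: "(x, y) = (incl X G (inv\<^bsub>SG\<^esub> u), incl Y G (inv\<^bsub>SG\<^esub> (inv\<^bsub>SG\<^esub> u)))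
        \<otimes>\<^bsub>PB\<^esub> (incl X G ?a \<otimes>\<^bsub>MX\<^esub> s G ?v, s' G ?v)"
      unfolding baer_pb_simps S.inv_inv[OF u(1)] yu[symmetric]
      using xr E.m_assoc[OF baer_X_simps(1)[OF iu] baer_X_simps(1)[OF a] sX(1)[OF v]] by simp
    have "c = baer_iso (?a, ?v)"
      unfolding c baer_iso_apply[OF a v]
      by (rule baer_coset_eqI[OF xy baer_rep_closed[OF a v] iu rel])
    then show "c \<in> baer_iso ` carrier TW"
      using a v by (intro image_eqI[of _ _ "(?a, ?v)"]) (simp_all add: sym_ab_simps)
  qed
  moreover have "baer_iso ` carrier TW \<subseteq> carrier BS"
    using h by (auto simp: hom_def)
  ultimately show ?thesis
    by (auto simp: iso_def bij_betw_def)
qed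

end

text \<open>Naturality comes from that of the two sections, since arrows map antidiagonals into
  antidiagonals.\<close>

lemma twist_equiv_baer_sum: "ab_extn_equiv (twist (k + l)) (baer_sum sym_ab X Y)"
  unfolding extn_equiv_def
proof (intro exI conjI ballI)
  let ?B = "baer_sum sym_ab X Y" and ?T = "twist (k + l) :: ('x, _, _, _) extn"
  show iso: "baer_iso G \<in> iso (ob (mid ?T) G) (ob (mid ?B) G)" if "G \<in> gr" for G
    by (rule baer_iso_iso[OF that])
  show "nat_trans gr (mid ?T) (mid ?B) baer_iso"
  proof (rule nat_transI)
    show "baer_iso G \<in> mor (ob (mid ?T) G) (ob (mid ?B) G)" if "G \<in> gr" for G
      using iso[OF that] by (simp add: mor_def iso_def baer_iso_def[OF that])
    show "baer_iso H (ar (mid ?T) G H f p) = ar (mid ?B) G H f (baer_iso G p)"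
      if *: "G \<in> gr" "H \<in> gr" "f \<in> mor G H" "p \<in> carrier (ob (mid ?T) G)" for G H f p
    proof -
      note GX = is_extnD[OF X *(1)] and GY = is_extnD[OF Y *(1)]
      note fX = GX(8)[OF *(2,3)] and fY = GY(8)[OF *(2,3)]
      obtain a v where p: "p = (a, v)" "a \<in> carrier (SymAb G)" "v \<in> carrier (Ab G)"
        using *(4) by (auto simp: sym_ab_simps)
      let ?a = "ar sym_ab G H f a" and ?v = "ar abelianization G H f v"
      have av: "?a \<in> carrier (SymAb H)" "?v \<in> carrier (Ab H)"
        using mor_closed[OF sym_ab(3)[OF *(1-3)] p(2)] mor_closed[OF ab(3)[OF *(1-3)] p(3)] by auto
      let ?\<psi> = "\<lambda>(x, y). (ar (mid X) G H f x, ar (mid Y) G H f y)"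
      have \<psi>: "?\<psi> \<in> hom (baer_pb X Y G) (baer_pb X Y H)"
      proof (rule homI)
        show "?\<psi> q \<in> carrier (baer_pb X Y H)" if "q \<in> carrier (baer_pb X Y G)" for q
          using that mor_closed[OF fX] mor_closed[OF fY] GX(10)[OF *(2,3)] GY(10)[OF *(2,3)]
          by (cases q) (simp add: baer_pb_simps)
        show "?\<psi> (q \<otimes>\<^bsub>baer_pb X Y G\<^esub> q') = ?\<psi> q \<otimes>\<^bsub>baer_pb X Y H\<^esub> ?\<psi> q'"
          if "q \<in> carrier (baer_pb X Y G)" "q' \<in> carrier (baer_pb X Y G)" for q q'
          using that mor_mult[OF fX] mor_mult[OF fY] by (cases q; cases q') (simp add: baer_pb_simps)
      qed
      have \<psi>': "?\<psi> ` baer_antidiag sym_ab X Y G \<subseteq> baer_antidiag sym_ab X Y H"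
      proof
        fix q assume "q \<in> ?\<psi> ` baer_antidiag sym_ab X Y G"
        then obtain t where t: "t \<in> carrier (SymAb G)" "q = ?\<psi> (incl X G t, incl Y G (inv\<^bsub>SymAb G\<^esub> t))"
          by (auto simp: baer_antidiag_def)
        interpret S: comm_group "SymAb G" by (rule sym_ab(1)[OF *(1)])
        have "q = (incl X H (ar sym_ab G H f t), incl Y H (inv\<^bsub>SymAb H\<^esub> ar sym_ab G H f t))"
          using t GX(9)[OF *(2,3)] GY(9)[OF *(2,3)] mor_inv[OF sym_ab(3)[OF *(1-3)] sym_ab(2)[OF *(1)] sym_ab(2)[OF *(2)]]
          by simp
        then show "q \<in> baer_antidiag sym_ab X Y H"
          using mor_closed[OF sym_ab(3)[OF *(1-3)] t(1)] by (auto simp: baer_antidiag_def)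
      qed
      have "ar (mid ?B) G H f (baer_iso G p)
          = baer_antidiag sym_ab X Y H #>\<^bsub>baer_pb X Y H\<^esub> ?\<psi> (incl X G a \<otimes>\<^bsub>ob (mid X) G\<^esub> s G v, s' G v)"
        unfolding p(1) baer_iso_apply[OF *(1) p(2,3)]
        using quot_map_coset[OF baer_antidiag_normal[OF *(1)] baer_antidiag_normal[OF *(2)] \<psi> \<psi>' baer_rep_closed[OF *(1) p(2,3)]]
        by (simp add: baer_sum_def)
      also have "?\<psi> (incl X G a \<otimes>\<^bsub>ob (mid X) G\<^esub> s G v, s' G v) = (incl X H ?a \<otimes>\<^bsub>ob (mid X) H\<^esub> s H ?v, s' H ?v)"
        using mor_mult[OF fX mor_closed[OF GX(2) p(2)] sectD(1)[OF s *(1) p(3)]] GX(9)[OF *(2,3) p(2)]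
          sectD(4)[OF s *(1) p(3) *(2,3)] sectD(4)[OF s' *(1) p(3) *(2,3)] by simp
      also have "baer_antidiag sym_ab X Y H #>\<^bsub>baer_pb X Y H\<^esub> \<dots> = baer_iso H (?a, ?v)"
        by (rule baer_iso_apply[OF *(2) av, symmetric])
      finally show ?thesis
        by (simp add: p(1) twist_simps(2)[OF p(2,3)])
    qed
  qed
  fix G :: "'x monoid" assume G: "G \<in> gr"
  interpret A: comm_group "Ab G" by (rule ab(1)[OF G])
  interpret E: comm_group "ob (mid X) G" by (rule is_extnD(1)[OF X G])
  show "baer_iso G (incl ?T G a) = incl ?B G a" if a: "a \<in> carrier (SymAb G)" for a
    using mor_closed[OF is_extnD(2)[OF X G] a] a
    by (simp add: baer_iso_apply[OF G a A.one_closed] sect_one[OF X s G] sect_one[OF Y s' G] baer_sum_def)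
  show "proj ?B G (baer_iso G p) = proj ?T G p" if p_in: "p \<in> carrier (ob (mid ?T) G)" for p
  proof -
    obtain a v where p: "p = (a, v)" "a \<in> carrier (SymAb G)" "v \<in> carrier (Ab G)"
      using p_in by (auto simp: sym_ab_simps)
    have "proj X G (incl X G a \<otimes>\<^bsub>ob (mid X) G\<^esub> s G v) = v"
      using p sectD(1,2)[OF s G p(3)] mor_mult[OF is_extnD(4)[OF X G]] mor_closed[OF is_extnD(2)[OF X G]]
        is_extnD(6)[OF X G] by simp
    then show ?thesis
      unfolding p(1) twist_simps(4)[OF p(2,3)] baer_iso_apply[OF G p(2,3)] baer_proj[OF G baer_rep_closed[OF G p(2,3)]] .
  qed
qed

end

end

section \<open>Groups parametrised by the integers\<close>

lemma cyclic_param_comm_group: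
  fixes T :: "int \<Rightarrow> 'a" and R :: "'a monoid"
  assumes car: "carrier R = range T" and one: "\<one>\<^bsub>R\<^esub> = T 0"
    and mult: "\<And>k l. T k \<otimes>\<^bsub>R\<^esub> T l = T (k + l)"
  shows "comm_group R"
proof (rule comm_groupI)
  fix x y z assume "x \<in> carrier R" "y \<in> carrier R" "z \<in> carrier R"
  then obtain k l m where xyz: "x = T k" "y = T l" "z = T m"
    by (auto simp: car)
  show "x \<otimes>\<^bsub>R\<^esub> y \<in> carrier R" "x \<otimes>\<^bsub>R\<^esub> y \<otimes>\<^bsub>R\<^esub> z = x \<otimes>\<^bsub>R\<^esub> (y \<otimes>\<^bsub>R\<^esub> z)" "x \<otimes>\<^bsub>R\<^esub> y = y \<otimes>\<^bsub>R\<^esub> x" "\<one>\<^bsub>R\<^esub> \<otimes>\<^bsub>R\<^esub> x = x"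
    by (simp_all add: xyz mult one car add_ac)
  have "T (- k) \<otimes>\<^bsub>R\<^esub> x = \<one>\<^bsub>R\<^esub>"
    by (simp add: xyz mult one)
  then show "\<exists>y\<in>carrier R. y \<otimes>\<^bsub>R\<^esub> x = \<one>\<^bsub>R\<^esub>"
    by (auto simp: car)
qed (simp add: one car)

lemma cyclic_param_iso:
  fixes T :: "int \<Rightarrow> 'a" and R :: "'a monoid"
  assumes car: "carrier R = range T" and one: "\<one>\<^bsub>R\<^esub> = T 0"
    and mult: "\<And>k l. T k \<otimes>\<^bsub>R\<^esub> T l = T (k + l)"
    and eq: "\<And>k l. T k = T l \<longleftrightarrow> int g dvd k - l" and g: "g > 0"
  shows "R \<cong> integer_mod_group g"
proof -
  have m: "T (k mod int g) = T k" for k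
    unfolding eq by (metis mod_mod_trivial mod_eq_dvd_iff)
  have "T \<in> hom (integer_mod_group g) R"
    by (rule homI) (simp_all add: car mult m)
  moreover have "bij_betw T (carrier (integer_mod_group g)) (carrier R)"
    unfolding bij_betw_def
  proof
    show "inj_on T (carrier (integer_mod_group g))"
      using g by (auto simp: inj_on_def eq carrier_integer_mod_group mod_eq_dvd_iff[symmetric])
    have "T k \<in> T ` {0..<int g}" for k
      using g by (intro image_eqI[of _ _ "k mod int g"]) (auto simp: m)
    then show "T ` carrier (integer_mod_group g) = carrier R"
      using g by (auto simp: car carrier_integer_mod_group)
  qed
  ultimately have "integer_mod_group g \<cong> R"
    by (auto simp: is_iso_def iso_def)
  then show ?thesis
    by (rule group.iso_sym[OF group_integer_mod_group])
qed

section \<open>The structure of the Ext group\<close>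

context choose_gcd
begin

text \<open>The extensions with invariant k. The model \<open>twist k\<close> has middle terms in
  another type and need not be a member itself, so membership is phrased as equivalence with
  it.\<close>

definition ext_class :: "int \<Rightarrow> ('x, 'e) ab_extn set" where
  "ext_class k = {X. is_ab_extn X \<and> ab_extn_equiv (twist k) X}"

context
  assumes inf_x: "infinite (UNIV :: 'x set)" and inf_e: "infinite (UNIV :: 'e set)"
begin

abbreviation (input) ext_cls :: "int \<Rightarrow> ('x, 'e) ab_extn set" where
  "ext_cls \<equiv> ext_class"

text \<open>Sections are what the uniqueness and shift lemmas speak about; this makes both available
  for classes.\<close>

lemma ext_class_iff_sect:
  fixes X :: "('x, 'e) ab_extn"
  assumes "is_ab_extn X"
  shows "X \<in> ext_cls k \<longleftrightarrow> (\<exists>s. sect k X s)"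
  using assms sect_extn_equiv[OF _ is_extn_twist sect_twist] sect_imp_extn_equiv_twist
  by (auto simp: ext_class_def)

lemma ext_class_nonempty: "\<exists>X. X \<in> ext_cls k"
  using transport_extn[OF is_extn_twist[of k] gr_group ab_functor_sym_ab countable_twist inf_e]
  by (auto simp: ext_class_def)

lemma ext_class_ex: "is_ab_extn X \<Longrightarrow> \<exists>k. X \<in> ext_cls k"
  using sect_exists[OF _ inf_x, of X] ext_class_iff_sect by blast

lemma ext_class_extn: "X \<in> ext_cls k \<Longrightarrow> is_ab_extn X"
  by (simp add: ext_class_def)

lemma ext_class_mono:
  assumes "int g dvd k - l"
  shows "ext_cls k \<subseteq> ext_cls l"
proof
  fix X assume X: "X \<in> ext_cls k"
  note E = ext_class_extn[OF X]
  obtain s where s: "sect k X s"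
    using X ext_class_iff_sect[OF E] by blast
  obtain c where "k - l = int g * c"
    using assms ..
  then have "l = k - c * int g"
    by (simp add: algebra_simps)
  then show "X \<in> ext_cls l"
    using sect_shift[OF E s, of c] ext_class_iff_sect[OF E] by blast
qed

text \<open>A common member has both invariants, which agree modulo g by \<open>sect_unique\<close>;
  conversely \<open>sect_shift\<close> realises every change by a multiple of g.\<close>

lemma ext_class_eq_iff: "ext_cls k = ext_cls l \<longleftrightarrow> int g dvd k - l"
proof
  assume eq: "ext_cls k = ext_cls l"
  obtain X where X: "X \<in> ext_cls k" using ext_class_nonempty by blast
  note E = ext_class_extn[OF X]
  obtain s s' where "sect k X s" "sect l X s'"
    using X eq ext_class_iff_sect[OF E] by blast
  then show "int g dvd k - l"
    by (rule sect_unique[OF E _ _ inf_x])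
next
  assume d: "int g dvd k - l"
  then have "int g dvd l - k" by (simp add: dvd_diff_commute)
  with d show "ext_cls k = ext_cls l"
    using ext_class_mono by blast
qed

lemma extn_rel_class:
  fixes X :: "('x, 'e) ab_extn"
  assumes X: "X \<in> ext_cls k"
  shows "extn_rel gr abelianization sym_ab `` {X} = ext_cls k"
proof -
  note E = ext_class_extn[OF X]
  have tX: "ab_extn_equiv (twist k) X"
    using X by (simp add: ext_class_def)
  have "ab_extn_equiv X Y \<longleftrightarrow> ab_extn_equiv (twist k) Y"
    if Y: "is_ab_extn Y" for Y :: "('x, 'e) ab_extn"
    using extn_equiv_trans[OF tX _ is_extn_twist] extn_equiv_trans[OF extn_equiv_sym[OF tX is_extn_twist E] _ E]
    by blast
  then show ?thesis
    using E by (auto simp: extn_rel_def ext_class_def)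
qed

abbreviation (input) Ext_ab where "Ext_ab \<equiv> Ext1 TYPE('e) (gr :: 'x monoid set) abelianization sym_ab"

lemma carrier_Ext1: "carrier Ext_ab = range ext_cls"
proof -
  have "carrier Ext_ab = (\<Union>X\<in>{X. is_ab_extn X}. {extn_rel gr abelianization sym_ab `` {X}})" (is "_ = ?L")
    by (simp add: Ext1_def quotient_def)
  also have "\<dots> = range ext_cls"
  proof (intro equalityI subsetI)
    fix c assume "c \<in> ?L"
    then obtain X where X: "is_ab_extn X" "c = extn_rel gr abelianization sym_ab `` {X}"
      by blast
    then obtain k where "X \<in> ext_cls k"
      using ext_class_ex by blast
    then show "c \<in> range ext_cls"
      using X(2) extn_rel_class by blast
  next
    fix c assume "c \<in> range ext_cls"
    then obtain k where k: "c = ext_cls k" by blast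
    obtain X where X: "X \<in> ext_cls k" using ext_class_nonempty by blast
    show "c \<in> ?L"
      using ext_class_extn[OF X] extn_rel_class[OF X] k by blast
  qed
  finally show ?thesis .
qed

text \<open>For all representatives the Baer sum is equivalent to \<open>twist (k + l)\<close>.
  Since classes and product are both defined by equivalence across types, the Baer sum itself never
  has to be copied.\<close>

lemma mult_Ext1: "ext_cls k \<otimes>\<^bsub>Ext_ab\<^esub> ext_cls l = ext_cls (k + l)"
proof -
  have baer: "ab_extn_equiv (twist (k + l)) (baer_sum sym_ab X Y)"
    if X: "X \<in> ext_cls k" and Y: "Y \<in> ext_cls l" for X Y
  proof -
    obtain s s' where "sect k X s" "sect l Y s'"
      using X Y ext_class_iff_sect[OF ext_class_extn[OF X]] ext_class_iff_sect[OF ext_class_extn[OF Y]] by blast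
    then show ?thesis
      by (rule twist_equiv_baer_sum[OF ext_class_extn[OF X] ext_class_extn[OF Y]])
  qed
  have mult: "ext_cls k \<otimes>\<^bsub>Ext_ab\<^esub> ext_cls l = {Z. is_ab_extn Z \<and>
      (\<exists>X\<in>ext_cls k. \<exists>Y\<in>ext_cls l. ab_extn_equiv Z (baer_sum sym_ab X Y))}"
    by (simp add: Ext1_def)
  show ?thesis
    unfolding mult
  proof (intro equalityI subsetI)
    fix Z :: "('x, 'e) ab_extn"
    assume "Z \<in> {Z. is_ab_extn Z \<and>
      (\<exists>X\<in>ext_cls k. \<exists>Y\<in>ext_cls l. ab_extn_equiv Z (baer_sum sym_ab X Y))}"
    then obtain X Y where Z: "is_ab_extn Z" "X \<in> ext_cls k" "Y \<in> ext_cls l"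
      "ab_extn_equiv Z (baer_sum sym_ab X Y)"
      by blast
    then show "Z \<in> ext_cls (k + l)"
      using extn_equiv_cancel_right[OF baer[OF Z(2,3)] Z(4) is_extn_twist Z(1)] by (simp add: ext_class_def)
  next
    fix Z assume Z: "Z \<in> ext_cls (k + l)"
    note E = ext_class_extn[OF Z]
    obtain X Y where XY: "X \<in> ext_cls k" "Y \<in> ext_cls l"
      using ext_class_nonempty by blast
    have "ab_extn_equiv Z (twist (k + l))"
      using Z by (intro extn_equiv_sym[OF _ is_extn_twist E]) (simp add: ext_class_def)
    then have "ab_extn_equiv Z (baer_sum sym_ab X Y)"
      by (rule extn_equiv_trans[OF _ baer[OF XY] E])
    then show "Z \<in> {Z. is_ab_extn Z \<and>
      (\<exists>X\<in>ext_cls k. \<exists>Y\<in>ext_cls l. ab_extn_equiv Z (baer_sum sym_ab X Y))}"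
      using E XY by blast
  qed
qed

lemma one_Ext1: "\<one>\<^bsub>Ext_ab\<^esub> = ext_cls 0"
proof -
  have "ab_extn_equiv Z (split_extn abelianization sym_ab)
      \<longleftrightarrow> ab_extn_equiv (twist 0) Z"
    if Z: "is_ab_extn Z" for Z :: "('x, 'e) ab_extn"
    using extn_equiv_cancel_right[OF twist_zero_equiv_split _ is_extn_twist Z]
      extn_equiv_trans[OF extn_equiv_sym[OF _ is_extn_twist Z] twist_zero_equiv_split Z] by blast
  then show ?thesis
    by (auto simp: Ext1_def ext_class_def)
qed

lemma comm_group_Ext1: "comm_group Ext_ab"
  by (rule cyclic_param_comm_group[OF carrier_Ext1 one_Ext1 mult_Ext1])

lemma Ext1_iso: "Ext_ab \<cong> integer_mod_group g"
  by (rule cyclic_param_iso[OF carrier_Ext1 one_Ext1 mult_Ext1 ext_class_eq_iff g_pos])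

lemma trivial_group_Ext1:
  assumes "g = 1"
  shows "trivial_group Ext_ab"
proof -
  have "ext_cls k = ext_cls 0" for k
    unfolding ext_class_eq_iff using assms by simp
  then show ?thesis
    using comm_group_group[OF comm_group_Ext1] carrier_Ext1 one_Ext1 by (auto simp: trivial_group_def)
qed

end

end

lemma choose_gcd_prime_power:
  assumes p: "prime p" "l \<ge> 1"
  shows "choose_gcd (p ^ l) p"
proof
  show "p ^ l > 0" "p > 0"
    using p prime_gt_0_nat by auto
  show "p ^ l = 1 \<Longrightarrow> p = 1"
    using p by auto
  show "0 < i \<Longrightarrow> i < p ^ l \<Longrightarrow> p dvd p ^ l choose i" for i
    using prime_dvd_choose_prime_power_mult[OF p(1), of i l 1] by simp
  show "int (p ^ l) dvd a * int p"
    if "\<And>i. 0 < i \<Longrightarrow> i < p ^ l \<Longrightarrow> int (p ^ l) dvd a * int (p ^ l choose i)" for a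
    using dvd_mult_choose_prime_power[OF p that] .
qed

text \<open>This includes d = 1, where no index i exists.\<close>

lemma choose_gcd_not_prime_power:
  assumes "d > 0" "\<nexists>p l :: nat. prime p \<and> l \<ge> 1 \<and> d = p ^ l"
  shows "choose_gcd d 1"
proof
  show "int d dvd a * int 1" if "\<And>i. 0 < i \<Longrightarrow> i < d \<Longrightarrow> int d dvd a * int (d choose i)" for a
    using dvd_mult_choose_not_prime_power[OF assms that] by simp
qed (use assms(1) in simp_all)

theorem theorem1:
  fixes d :: nat
  assumes "d > 0"
    and "infinite (UNIV :: 'x set)"
    and "infinite (UNIV :: 'e set)"
  shows "let Ext = Ext1 TYPE('e) (gr :: 'x monoid set) abelianization
                     (fctr_comp (sym_pow d) abelianization)
         in comm_group Ext \<and>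
            (\<forall>p l :: nat. prime p \<and> l \<ge> 1 \<and> d = p ^ l \<longrightarrow> Ext \<cong> integer_mod_group p) \<and>
            ((\<nexists>p l :: nat. prime p \<and> l \<ge> 1 \<and> d = p ^ l) \<longrightarrow> trivial_group Ext)"
  unfolding Let_def
proof (intro conjI allI impI)
  obtain g where "choose_gcd d g"
    using choose_gcd_prime_power choose_gcd_not_prime_power[OF assms(1)] by blast
  then show "comm_group (Ext1 TYPE('e) (gr :: 'x monoid set) abelianization (fctr_comp (sym_pow d) abelianization))"
    using assms(2,3) by (rule choose_gcd.comm_group_Ext1)
next
  fix p l :: nat
  assume "prime p \<and> l \<ge> 1 \<and> d = p ^ l"
  then have "choose_gcd d p"
    using choose_gcd_prime_power by simp
  then show "Ext1 TYPE('e) (gr :: 'x monoid set) abelianization (fctr_comp (sym_pow d) abelianization)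
      \<cong> integer_mod_group p"
    using assms(2,3) by (rule choose_gcd.Ext1_iso)
next
  assume "\<nexists>p l :: nat. prime p \<and> l \<ge> 1 \<and> d = p ^ l"
  then have "choose_gcd d 1"
    by (rule choose_gcd_not_prime_power[OF assms(1)])
  then show "trivial_group (Ext1 TYPE('e) (gr :: 'x monoid set) abelianization (fctr_comp (sym_pow d) abelianization))"
    using assms(2,3) refl by (rule choose_gcd.trivial_group_Ext1)
qed

end
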